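(* Let $(\Omega,\mathcal F,P)$ be a probability space, let $S$ be a $\mathcal T_{\varepsilon,\lambda}$-complete random normed module over $K$ ($K=\mathbb R$ or $\mathbb C$) with base $(\Omega,\mathcal F,P)$, and let $f:[0,\infty)\to(S,\mathcal T_{\varepsilon,\lambda})$ be a continuous function such that, for some $M\in L^0_+(\mathcal F)$, $\|f(s)\|\le M$ for all $s\ge0$. For $\eta\in L^0_{++}(\mathcal F)$ let $H(\eta)=\int_0^\infty e^{-\eta s}f(s)\,ds$ be the Laplace transform of $f$. Then for every real $t>0$, $$\lim_{k\to\infty}(-1)^k\Big(\frac kt\Big)^{k+1}\frac1{k!}\;\mathcal T_c\text{-}H^{(k)}\Big(\frac kt\Big)=f(t)$$ in $(S,\mathcal T_{\varepsilon,\lambda})$, where $k$ runs over positive integers and $\frac kt$ is identified with the corresponding constant element of $L^0_{++}(\mathcal F)$.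
   Context: $L^0(\mathcal F,K)$ is the algebra of ($P$-a.s.) equivalence classes of $K$-valued $\mathcal F$-measurable random variables on $\Omega$. For $f,g\in L^0(\mathcal F,\mathbb R)$, $f\le g$ means a.s. inequality and "$f>g$ on $\Omega$" means $f(\omega)>g(\omega)$ for almost all $\omega$. $L^0_+(\mathcal F)=\{\xi\in L^0(\mathcal F,\mathbb R):\xi\ge 0\}$ and $L^0_{++}(\mathcal F)=\{\xi\in L^0(\mathcal F,\mathbb R):\xi>0\text{ on }\Omega\}$. A random normed module over $K$ with base $(\Omega,\mathcal F,P)$ is a left $L^0(\mathcal F,K)$-module $S$ with a map $\|\cdot\|:S\to L^0_+(\mathcal F)$ (the $L^0$-norm) such that $\|x\|=0\Rightarrow x=\theta$ (the zero of $S$), $\|\zeta x\|=|\zeta|\,\|x\|$ and $\|x+y\|\le\|x\|+\|y\|$ for $\zeta\in L^0(\mathcal F,K)$, $x,y\in S$. The $(\varepsilon,\lambda)$-topology $\mathcal T_{\varepsilon,\lambda}$ on $S$ is the metrizable linear topology with local base at $\theta$ the sets $\{z: P(\|z\|<\varepsilon)>1-\lambda\}$, $\varepsilon>0$, $0<\lambda<1$; thus $z_n\to z$ iff $\|z_n-z\|\to0$ in probability. The locally $L^0$-convex topology $\mathcal T_c$ has local base at $\theta$ the sets $\{x\in S:\|x\|<\varepsilon\text{ on }\Omega\}$, $\varepsilon\in L^0_{++}(\mathcal F)$; it is defined in particular on $L^0(\mathcal F,\mathbb R)$ with $\|\cdot\|=|\cdot|$. $L^0_{++}(\mathcal F)$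 is a $\mathcal T_c$-open subset of $L^0(\mathcal F,\mathbb R)$. Integrals over compact intervals are Riemann integrals ($\mathcal T_{\varepsilon,\lambda}$-limits of Riemann sums; a $\mathcal T_{\varepsilon,\lambda}$-continuous $g:[a,b]\to S$ with $\bigvee_{u\in[a,b]}\|g(u)\|\in L^0_+(\mathcal F)$ is Riemann integrable), and $\int_0^\infty$ is the $\mathcal T_{\varepsilon,\lambda}$-limit of $\int_0^L$ as $L\to\infty$. $\mathcal T_c$-derivative: for a $\mathcal T_c$-open set $G\subset L^0(\mathcal F,\mathbb R)$, $H:G\to S$ and $x_0\in G$, $H$ is $\mathcal T_c$-differentiable at $x_0$ with $\mathcal T_c$-derivative $I\in S$ if $\frac{H(x_0+r)-H(x_0)}{r}-I$ converges to $\theta$ in $\mathcal T_c$ as $r\to 0$ in $\mathcal T_c$ through $r\in L^0(\mathcal F,\mathbb R)$ with $|r|\in L^0_{++}(\mathcal F)$ (so that $r$ is invertible in $L^0(\mathcal F,\mathbb R)$). $\mathcal T_c\text{-}H^{(k)}$ denotes the $k$-fold iterated $\mathcal T_c$-derivative of $H:L^0_{++}(\mathcal F)\to S$. *)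

theory Defs
  imports "HOL-Probability.Probability" "HOL-Algebra.Module"
begin

definition ae_eq :: "'w measure \<Rightarrow> (('w \<Rightarrow> 'b::topological_space) \<times> ('w \<Rightarrow> 'b)) set" where
  "ae_eq M = {(f, g). f \<in> borel_measurable M \<and> g \<in> borel_measurable M \<and> (AE \<omega> in M. f \<omega> = g \<omega>)}"

definition L0 :: "'w measure \<Rightarrow> ('w \<Rightarrow> 'b::topological_space) set set" where
  "L0 M = borel_measurable M // ae_eq M"

definition L0_class :: "'w measure \<Rightarrow> ('w \<Rightarrow> 'b::topological_space) \<Rightarrow> ('w \<Rightarrow> 'b) set" where
  "L0_class M f = ae_eq M `` {f}"

text \<open>Operations and relations on classes go through a chosen representative; they do not depend
  on the choice, since representatives of a class agree almost everywhere
  (\<open>L0_rep_class\<close> below).\<close>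

definition L0_rep :: "('w \<Rightarrow> 'b) set \<Rightarrow> 'w \<Rightarrow> 'b" where
  "L0_rep X = (SOME f. f \<in> X)"

definition L0_const :: "'w measure \<Rightarrow> 'b::topological_space \<Rightarrow> ('w \<Rightarrow> 'b) set" where
  "L0_const M c = L0_class M (\<lambda>_. c)"

definition L0_ring :: "'w measure \<Rightarrow> ('w \<Rightarrow> 'k::real_normed_field) set ring" where
  "L0_ring M =
    \<lparr>carrier = L0 M,
     monoid.mult = (\<lambda>X Y. L0_class M (\<lambda>\<omega>. L0_rep X \<omega> * L0_rep Y \<omega>)),
     one = L0_const M 1,
     zero = L0_const M 0,
     add = (\<lambda>X Y. L0_class M (\<lambda>\<omega>. L0_rep X \<omega> + L0_rep Y \<omega>))\<rparr>"

definition L0_abs :: "'w measure \<Rightarrow> ('w \<Rightarrow> 'k::real_normed_field) set \<Rightarrow> ('w \<Rightarrow> real) set" where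
  "L0_abs M X = L0_class M (\<lambda>\<omega>. norm (L0_rep X \<omega>))"

definition L0_of_real :: "'w measure \<Rightarrow> ('w \<Rightarrow> real) set \<Rightarrow> ('w \<Rightarrow> 'k::real_normed_field) set" where
  "L0_of_real M X = L0_class M (\<lambda>\<omega>. of_real (L0_rep X \<omega>))"

definition L0_le :: "'w measure \<Rightarrow> ('w \<Rightarrow> real) set \<Rightarrow> ('w \<Rightarrow> real) set \<Rightarrow> bool" where
  "L0_le M X Y \<longleftrightarrow> (AE \<omega> in M. L0_rep X \<omega> \<le> L0_rep Y \<omega>)"

definition L0_less :: "'w measure \<Rightarrow> ('w \<Rightarrow> real) set \<Rightarrow> ('w \<Rightarrow> real) set \<Rightarrow> bool" where
  "L0_less M X Y \<longleftrightarrow> (AE \<omega> in M. L0_rep X \<omega> < L0_rep Y \<omega>)"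

definition L0_nonneg :: "'w measure \<Rightarrow> ('w \<Rightarrow> real) set set" where
  "L0_nonneg M = {X \<in> L0 M. L0_le M (L0_const M 0) X}"

definition L0_pos :: "'w measure \<Rightarrow> ('w \<Rightarrow> real) set set" where
  "L0_pos M = {X \<in> L0 M. L0_less M (L0_const M 0) X}"

lemma equiv_ae_eq: "equiv (borel_measurable M) (ae_eq M)"
  unfolding ae_eq_def
  by (rule equivI) (auto simp: refl_on_def sym_def trans_def)

lemma L0_class_in_L0 [simp, intro]: "f \<in> borel_measurable M \<Longrightarrow> L0_class M f \<in> L0 M"
  by (simp add: L0_class_def L0_def quotientI)

lemma L0_class_eq_iff:
  assumes "f \<in> borel_measurable M" "g \<in> borel_measurable M"
  shows "L0_class M f = L0_class M g \<longleftrightarrow> (AE \<omega> in M. f \<omega> = g \<omega>)"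
  using eq_equiv_class_iff[OF equiv_ae_eq assms] assms by (simp add: L0_class_def ae_eq_def)

lemma L0_rep_in:
  assumes "X \<in> L0 M" shows "L0_rep X \<in> X"
  using assms equiv_ae_eq[of M] unfolding L0_def L0_rep_def
  by (metis in_quotient_imp_non_empty some_in_eq)

lemma L0_rep_measurable [measurable (raw), simp]:
  assumes "X \<in> L0 M" shows "L0_rep X \<in> borel_measurable M"
  using L0_rep_in[OF assms] assms equiv_ae_eq[of M] unfolding L0_def
  by (meson in_mono in_quotient_imp_subset)

lemma L0_rep_class:
  assumes "f \<in> borel_measurable M"
  shows "AE \<omega> in M. L0_rep (L0_class M f) \<omega> = f \<omega>"
proof -
  have "L0_rep (L0_class M f) \<in> L0_class M f"
    using assms by (intro L0_rep_in) auto
  then have "AE \<omega> in M. f \<omega> = L0_rep (L0_class M f) \<omega>"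
    unfolding L0_class_def ae_eq_def by blast
  then show ?thesis by eventually_elim simp
qed

lemma L0_class_rep [simp]:
  assumes "X \<in> L0 M" shows "L0_class M (L0_rep X) = X"
proof -
  from assms obtain f where f: "f \<in> borel_measurable M" "X = L0_class M f"
    by (auto simp: L0_def L0_class_def elim: quotientE)
  then show ?thesis
    using L0_rep_class[OF f(1)] L0_rep_measurable[OF assms] by (simp add: L0_class_eq_iff)
qed

lemma L0_const_in_L0 [simp, intro]: "L0_const M c \<in> L0 M"
  by (auto simp: L0_const_def)

lemma L0_rep_const: "AE \<omega> in M. L0_rep (L0_const M c) \<omega> = c"
  unfolding L0_const_def by (rule L0_rep_class) simp

lemma L0_eqI:
  assumes "X \<in> L0 M" "Y \<in> L0 M" "AE \<omega> in M. L0_rep X \<omega> = L0_rep Y \<omega>"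
  shows "X = Y"
  using assms L0_class_eq_iff[of "L0_rep X" M "L0_rep Y"] by simp

lemma cring_L0_ring:
  "cring (L0_ring M :: ('w \<Rightarrow> 'k::{real_normed_field, second_countable_topology}) set ring)"
proof -
  let ?R = "L0_ring M :: ('w \<Rightarrow> 'k) set ring"
  have add: "AE \<omega> in M. L0_rep (X \<oplus>\<^bsub>?R\<^esub> Y) \<omega> = L0_rep X \<omega> + L0_rep Y \<omega>"
    and addc: "X \<oplus>\<^bsub>?R\<^esub> Y \<in> L0 M"
    if "X \<in> L0 M" "Y \<in> L0 M" for X Y
    using that by (auto simp: L0_ring_def intro!: L0_rep_class)
  have mult: "AE \<omega> in M. L0_rep (X \<otimes>\<^bsub>?R\<^esub> Y) \<omega> = L0_rep X \<omega> * L0_rep Y \<omega>"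
    and multc: "X \<otimes>\<^bsub>?R\<^esub> Y \<in> L0 M"
    if "X \<in> L0 M" "Y \<in> L0 M" for X Y
    using that by (auto simp: L0_ring_def intro!: L0_rep_class)
  have one: "AE \<omega> in M. L0_rep \<one>\<^bsub>?R\<^esub> \<omega> = 1" and onec: "\<one>\<^bsub>?R\<^esub> \<in> L0 M"
    by (auto simp: L0_ring_def L0_rep_const)
  have zero: "AE \<omega> in M. L0_rep \<zero>\<^bsub>?R\<^esub> \<omega> = 0" and zeroc: "\<zero>\<^bsub>?R\<^esub> \<in> L0 M"
    by (auto simp: L0_ring_def L0_rep_const)
  have car: "carrier ?R = L0 M" by (simp add: L0_ring_def)
  note c = addc multc onec zeroc
  show ?thesis
  proof (intro cringI abelian_groupI comm_monoidI; unfold car)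
    fix X Y Z :: "('w \<Rightarrow> 'k) set"
    assume X: "X \<in> L0 M" and Y: "Y \<in> L0 M" and Z: "Z \<in> L0 M"
    show "X \<oplus>\<^bsub>?R\<^esub> Y \<oplus>\<^bsub>?R\<^esub> Z = X \<oplus>\<^bsub>?R\<^esub> (Y \<oplus>\<^bsub>?R\<^esub> Z)" (is "?l = ?r")
    proof (rule L0_eqI[of _ M])
      show "AE \<omega> in M. L0_rep ?l \<omega> = L0_rep ?r \<omega>"
        using add[OF X Y] add[OF addc[OF X Y] Z] add[OF Y Z] add[OF X addc[OF Y Z]]
        by eventually_elim (simp add: algebra_simps)
    qed (intro c X Y Z)+
    show "X \<otimes>\<^bsub>?R\<^esub> Y \<otimes>\<^bsub>?R\<^esub> Z = X \<otimes>\<^bsub>?R\<^esub> (Y \<otimes>\<^bsub>?R\<^esub> Z)" (is "?l = ?r")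
    proof (rule L0_eqI[of _ M])
      show "AE \<omega> in M. L0_rep ?l \<omega> = L0_rep ?r \<omega>"
        using mult[OF X Y] mult[OF multc[OF X Y] Z] mult[OF Y Z] mult[OF X multc[OF Y Z]]
        by eventually_elim (simp add: algebra_simps)
    qed (intro c X Y Z)+
    show "(X \<oplus>\<^bsub>?R\<^esub> Y) \<otimes>\<^bsub>?R\<^esub> Z = X \<otimes>\<^bsub>?R\<^esub> Z \<oplus>\<^bsub>?R\<^esub> Y \<otimes>\<^bsub>?R\<^esub> Z" (is "?l = ?r")
    proof (rule L0_eqI[of _ M])
      show "AE \<omega> in M. L0_rep ?l \<omega> = L0_rep ?r \<omega>"
        using add[OF X Y] mult[OF addc[OF X Y] Z] mult[OF X Z] mult[OF Y Z]
        add[OF multc[OF X Z] multc[OF Y Z]]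
        by eventually_elim (simp add: algebra_simps)
    qed (intro c X Y Z)+
  next
    fix X Y :: "('w \<Rightarrow> 'k) set"
    assume X: "X \<in> L0 M" and Y: "Y \<in> L0 M"
    show "X \<oplus>\<^bsub>?R\<^esub> Y = Y \<oplus>\<^bsub>?R\<^esub> X"
      by (simp add: L0_ring_def add.commute)
    show "X \<otimes>\<^bsub>?R\<^esub> Y = Y \<otimes>\<^bsub>?R\<^esub> X"
      by (simp add: L0_ring_def mult.commute)
  next
    fix X :: "('w \<Rightarrow> 'k) set"
    assume X: "X \<in> L0 M"
    show "\<zero>\<^bsub>?R\<^esub> \<oplus>\<^bsub>?R\<^esub> X = X" (is "?l = ?r")
    proof (rule L0_eqI[of _ M])
      show "AE \<omega> in M. L0_rep ?l \<omega> = L0_rep ?r \<omega>"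
        using zero add[OF zeroc X]
        by eventually_elim (simp)
    qed (intro c X)+
    show "\<one>\<^bsub>?R\<^esub> \<otimes>\<^bsub>?R\<^esub> X = X" (is "?l = ?r")
    proof (rule L0_eqI[of _ M])
      show "AE \<omega> in M. L0_rep ?l \<omega> = L0_rep ?r \<omega>"
        using one mult[OF onec X]
        by eventually_elim (simp)
    qed (intro c X)+
    let ?Y = "L0_class M (\<lambda>\<omega>. - L0_rep X \<omega>)"
    have Y: "?Y \<in> L0 M" using X by auto
    have Yr: "AE \<omega> in M. L0_rep ?Y \<omega> = - L0_rep X \<omega>" using X by (intro L0_rep_class) auto
    have YX: "?Y \<oplus>\<^bsub>?R\<^esub> X = \<zero>\<^bsub>?R\<^esub>" (is "?l = ?r")
    proof (rule L0_eqI[of _ M])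
      show "AE \<omega> in M. L0_rep ?l \<omega> = L0_rep ?r \<omega>"
        using Yr zero add[OF Y X]
        by eventually_elim (simp)
    qed (intro c X Y)+
    from Y YX show "\<exists>Y\<in>L0 M. Y \<oplus>\<^bsub>?R\<^esub> X = \<zero>\<^bsub>?R\<^esub>" by blast
  qed (use c in auto)
qed

text \<open>The field \<open>K\<close> is the type \<open>'k\<close>. By the Gelfand--Mazur theorem the types of class
  \<open>real_normed_field\<close> (whose norm is multiplicative) are, up to isometric isomorphism, exactly
  \<^typ>\<open>real\<close> and \<^typ>\<open>complex\<close>.\<close>

locale random_normed_module = prob_space M + S: Module.module "L0_ring M" S
  for M :: "'w measure"
    and S :: "(('w \<Rightarrow> 'k::{real_normed_field, second_countable_topology}) set, 's, 'm) module_scheme" +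
  fixes nrm :: "'s \<Rightarrow> ('w \<Rightarrow> real) set"
  assumes nrm_nonneg: "x \<in> carrier S \<Longrightarrow> nrm x \<in> L0_nonneg M"
    and nrm_eq_zero: "x \<in> carrier S \<Longrightarrow> nrm x = L0_const M 0 \<Longrightarrow> x = \<zero>\<^bsub>S\<^esub>"
    and nrm_smult: "\<zeta> \<in> L0 M \<Longrightarrow> x \<in> carrier S \<Longrightarrow>
          nrm (\<zeta> \<odot>\<^bsub>S\<^esub> x) = L0_abs M \<zeta> \<otimes>\<^bsub>L0_ring M\<^esub> nrm x"
    and nrm_triangle: "x \<in> carrier S \<Longrightarrow> y \<in> carrier S \<Longrightarrow>
          L0_le M (nrm (x \<oplus>\<^bsub>S\<^esub> y)) (nrm x \<oplus>\<^bsub>L0_ring M\<^esub> nrm y)"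

text \<open>The two topologies below are the translation-invariant ones with the given base at zero. They
  use only the additive structure of \<open>S\<close>, so they apply to \<^term>\<open>L0_ring M\<close> with \<^term>\<open>L0_abs M\<close> too.\<close>

definition el_ball ::
    "'w measure \<Rightarrow> ('s, 'm) ring_scheme \<Rightarrow> ('s \<Rightarrow> ('w \<Rightarrow> real) set) \<Rightarrow> real \<Rightarrow> real \<Rightarrow> 's \<Rightarrow> 's set" where
  "el_ball M S nrm \<epsilon> l x =
    {y \<in> carrier S. measure M {\<omega> \<in> space M. L0_rep (nrm (y \<ominus>\<^bsub>S\<^esub> x)) \<omega> < \<epsilon>} > 1 - l}"

definition el_topology ::
    "'w measure \<Rightarrow> ('s, 'm) ring_scheme \<Rightarrow> ('s \<Rightarrow> ('w \<Rightarrow> real) set) \<Rightarrow> 's topology" where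
  "el_topology M S nrm = topology (\<lambda>V. V \<subseteq> carrier S \<and>
    (\<forall>x\<in>V. \<exists>\<epsilon>>0. \<exists>l. 0 < l \<and> l < 1 \<and> el_ball M S nrm \<epsilon> l x \<subseteq> V))"

definition Tc_ball ::
    "'w measure \<Rightarrow> ('s, 'm) ring_scheme \<Rightarrow> ('s \<Rightarrow> ('w \<Rightarrow> real) set) \<Rightarrow> ('w \<Rightarrow> real) set \<Rightarrow> 's \<Rightarrow> 's set" where
  "Tc_ball M S nrm \<epsilon> x = {y \<in> carrier S. L0_less M (nrm (y \<ominus>\<^bsub>S\<^esub> x)) \<epsilon>}"

definition Tc_topology ::
    "'w measure \<Rightarrow> ('s, 'm) ring_scheme \<Rightarrow> ('s \<Rightarrow> ('w \<Rightarrow> real) set) \<Rightarrow> 's topology" where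
  "Tc_topology M S nrm = topology (\<lambda>V. V \<subseteq> carrier S \<and>
    (\<forall>x\<in>V. \<exists>\<epsilon>\<in>L0_pos M. Tc_ball M S nrm \<epsilon> x \<subseteq> V))"

text \<open>The \<open>(\<epsilon>, \<lambda>)\<close>-topology is metrizable, so completeness may be tested on sequences.\<close>

definition el_complete ::
    "'w measure \<Rightarrow> ('s, 'm) ring_scheme \<Rightarrow> ('s \<Rightarrow> ('w \<Rightarrow> real) set) \<Rightarrow> bool" where
  "el_complete M S nrm \<longleftrightarrow> (\<forall>x :: nat \<Rightarrow> 's.
    range x \<subseteq> carrier S \<longrightarrow>
    (\<forall>\<epsilon>>0. \<forall>l. 0 < l \<and> l < 1 \<longrightarrow> (\<exists>N. \<forall>m\<ge>N. \<forall>n\<ge>N. x m \<in> el_ball M S nrm \<epsilon> l (x n))) \<longrightarrow>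
    (\<exists>z. limitin (el_topology M S nrm) x z sequentially))"

lemma openin_el_topology:
  assumes "prob_space M" and nrm: "\<And>x. x \<in> carrier S \<Longrightarrow> nrm x \<in> L0 M" and "abelian_group S"
  shows "openin (el_topology M S nrm) V \<longleftrightarrow> V \<subseteq> carrier S \<and>
    (\<forall>x\<in>V. \<exists>\<epsilon>>0. \<exists>l. 0 < l \<and> l < 1 \<and> el_ball M S nrm \<epsilon> l x \<subseteq> V)"
proof -
  interpret prob_space M by fact
  interpret S: abelian_group S by fact
  have mono: "el_ball M S nrm (min \<epsilon> \<epsilon>') (min l l') x \<subseteq> el_ball M S nrm \<epsilon> l x" if "x \<in> carrier S"
    for \<epsilon> \<epsilon>' l l' x
  proof
    fix y assume y: "y \<in> el_ball M S nrm (min \<epsilon> \<epsilon>') (min l l') x"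
    then have "y \<in> carrier S" by (simp add: el_ball_def)
    with that have [measurable]: "L0_rep (nrm (y \<ominus>\<^bsub>S\<^esub> x)) \<in> borel_measurable M"
      by (intro L0_rep_measurable nrm) simp
    have "prob {\<omega> \<in> space M. L0_rep (nrm (y \<ominus>\<^bsub>S\<^esub> x)) \<omega> < min \<epsilon> \<epsilon>'}
        \<le> prob {\<omega> \<in> space M. L0_rep (nrm (y \<ominus>\<^bsub>S\<^esub> x)) \<omega> < \<epsilon>}"
      by (intro finite_measure_mono) auto
    with y show "y \<in> el_ball M S nrm \<epsilon> l x"
      by (auto simp: el_ball_def min_def split: if_splits)
  qed
  have "istopology (\<lambda>V. V \<subseteq> carrier S \<and>
      (\<forall>x\<in>V. \<exists>\<epsilon>>0. \<exists>l. 0 < l \<and> l < 1 \<and> el_ball M S nrm \<epsilon> l x \<subseteq> V))"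
    unfolding istopology_def
  proof (intro conjI allI impI ballI)
    fix A B x
    assume A: "A \<subseteq> carrier S \<and> (\<forall>x\<in>A. \<exists>\<epsilon>>0. \<exists>l. 0 < l \<and> l < 1 \<and> el_ball M S nrm \<epsilon> l x \<subseteq> A)"
      and B: "B \<subseteq> carrier S \<and> (\<forall>x\<in>B. \<exists>\<epsilon>>0. \<exists>l. 0 < l \<and> l < 1 \<and> el_ball M S nrm \<epsilon> l x \<subseteq> B)"
    then show "A \<inter> B \<subseteq> carrier S" by blast
    assume x: "x \<in> A \<inter> B"
    from A x obtain \<epsilon> l where 1: "\<epsilon> > 0" "0 < l" "l < 1" "el_ball M S nrm \<epsilon> l x \<subseteq> A" by blast
    from B x obtain \<epsilon>' l' where 2: "\<epsilon>' > 0" "0 < l'" "l' < 1" "el_ball M S nrm \<epsilon>' l' x \<subseteq> B" by blast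
    have "el_ball M S nrm (min \<epsilon> \<epsilon>') (min l l') x \<subseteq> A \<inter> B"
      using mono[of x \<epsilon> \<epsilon>' l l'] mono[of x \<epsilon>' \<epsilon> l' l] 1 2 A x by (auto simp: min.commute)
    then show "\<exists>\<epsilon>>0. \<exists>l. 0 < l \<and> l < 1 \<and> el_ball M S nrm \<epsilon> l x \<subseteq> A \<inter> B"
      using 1 2 by (intro exI[of _ "min \<epsilon> \<epsilon>'"] exI[of _ "min l l'"] conjI) auto
  next
    fix \<K> x
    assume K: "\<forall>V\<in>\<K>. V \<subseteq> carrier S \<and>
        (\<forall>x\<in>V. \<exists>\<epsilon>>0. \<exists>l. 0 < l \<and> l < 1 \<and> el_ball M S nrm \<epsilon> l x \<subseteq> V)"
    then show "\<Union>\<K> \<subseteq> carrier S" by blast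
    assume "x \<in> \<Union>\<K>"
    then obtain V where V: "V \<in> \<K>" "x \<in> V" by blast
    with K have "\<exists>\<epsilon>>0. \<exists>l. 0 < l \<and> l < 1 \<and> el_ball M S nrm \<epsilon> l x \<subseteq> V" by blast
    with V(1) show "\<exists>\<epsilon>>0. \<exists>l. 0 < l \<and> l < 1 \<and> el_ball M S nrm \<epsilon> l x \<subseteq> \<Union>\<K>"
      by (meson Sup_upper order_trans)
  qed
  then show ?thesis by (simp add: el_topology_def topology_inverse')
qed

lemma openin_Tc_topology:
  "openin (Tc_topology M S nrm) V \<longleftrightarrow> V \<subseteq> carrier S \<and>
    (\<forall>x\<in>V. \<exists>\<epsilon>\<in>L0_pos M. Tc_ball M S nrm \<epsilon> x \<subseteq> V)"
proof -
  have "istopology (\<lambda>V. V \<subseteq> carrier S \<and> (\<forall>x\<in>V. \<exists>\<epsilon>\<in>L0_pos M. Tc_ball M S nrm \<epsilon> x \<subseteq> V))"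
    unfolding istopology_def
  proof (intro conjI allI impI ballI)
    fix A B x
    assume A: "A \<subseteq> carrier S \<and> (\<forall>x\<in>A. \<exists>\<epsilon>\<in>L0_pos M. Tc_ball M S nrm \<epsilon> x \<subseteq> A)"
      and B: "B \<subseteq> carrier S \<and> (\<forall>x\<in>B. \<exists>\<epsilon>\<in>L0_pos M. Tc_ball M S nrm \<epsilon> x \<subseteq> B)"
    then show "A \<inter> B \<subseteq> carrier S" by blast
    assume x: "x \<in> A \<inter> B"
    from A x obtain d where 1: "d \<in> L0_pos M" "Tc_ball M S nrm d x \<subseteq> A" by blast
    from B x obtain e where 2: "e \<in> L0_pos M" "Tc_ball M S nrm e x \<subseteq> B" by blast
    have meas: "d \<in> L0 M" "e \<in> L0 M" using 1 2 by (auto simp: L0_pos_def)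
    let ?m = "L0_class M (\<lambda>\<omega>. min (L0_rep d \<omega>) (L0_rep e \<omega>))"
    have rep: "AE \<omega> in M. L0_rep ?m \<omega> = min (L0_rep d \<omega>) (L0_rep e \<omega>)"
      using meas by (intro L0_rep_class) auto
    have "AE \<omega> in M. L0_rep (L0_const M 0) \<omega> < L0_rep d \<omega>"
      "AE \<omega> in M. L0_rep (L0_const M 0) \<omega> < L0_rep e \<omega>"
      using 1 2 by (auto simp: L0_pos_def L0_less_def)
    with rep have "AE \<omega> in M. L0_rep (L0_const M 0) \<omega> < L0_rep ?m \<omega>"
      by eventually_elim simp
    then have m: "?m \<in> L0_pos M"
      using meas by (auto simp: L0_pos_def L0_less_def)
    have "Tc_ball M S nrm ?m x \<subseteq> Tc_ball M S nrm d x \<inter> Tc_ball M S nrm e x"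
    proof
      fix y assume y: "y \<in> Tc_ball M S nrm ?m x"
      then have "AE \<omega> in M. L0_rep (nrm (y \<ominus>\<^bsub>S\<^esub> x)) \<omega> < L0_rep ?m \<omega>"
        by (simp add: Tc_ball_def L0_less_def)
      with rep have "AE \<omega> in M. L0_rep (nrm (y \<ominus>\<^bsub>S\<^esub> x)) \<omega> < L0_rep d \<omega> \<and>
          L0_rep (nrm (y \<ominus>\<^bsub>S\<^esub> x)) \<omega> < L0_rep e \<omega>"
        by eventually_elim simp
      with y show "y \<in> Tc_ball M S nrm d x \<inter> Tc_ball M S nrm e x"
        by (simp add: Tc_ball_def L0_less_def AE_conj_iff)
    qed
    with 1 2 m show "\<exists>\<epsilon>\<in>L0_pos M. Tc_ball M S nrm \<epsilon> x \<subseteq> A \<inter> B" by blast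
  next
    fix \<K> x
    assume K: "\<forall>V\<in>\<K>. V \<subseteq> carrier S \<and> (\<forall>x\<in>V. \<exists>\<epsilon>\<in>L0_pos M. Tc_ball M S nrm \<epsilon> x \<subseteq> V)"
    then show "\<Union>\<K> \<subseteq> carrier S" by blast
    assume "x \<in> \<Union>\<K>"
    then obtain V where V: "V \<in> \<K>" "x \<in> V" by blast
    with K have "\<exists>\<epsilon>\<in>L0_pos M. Tc_ball M S nrm \<epsilon> x \<subseteq> V" by blast
    with V(1) show "\<exists>\<epsilon>\<in>L0_pos M. Tc_ball M S nrm \<epsilon> x \<subseteq> \<Union>\<K>"
      by (meson Sup_upper order_trans)
  qed
  then show ?thesis by (simp add: Tc_topology_def topology_inverse')
qed

definition riemann_sum ::
    "'w measure \<Rightarrow> (('w \<Rightarrow> 'k::real_normed_field) set, 's, 'm) module_scheme \<Rightarrow>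
     (real \<Rightarrow> 's) \<Rightarrow> (real \<times> real set) set \<Rightarrow> 's" where
  "riemann_sum M S g p =
    (\<Oplus>\<^bsub>S\<^esub>q\<in>p. L0_const M (of_real (measure lborel (snd q))) \<odot>\<^bsub>S\<^esub> g (fst q))"

definition mesh_filter :: "real \<Rightarrow> real \<Rightarrow> (real \<times> real set) set filter" where
  "mesh_filter a b = (INF \<delta>\<in>{0<..}.
    principal {p. p tagged_division_of {a..b} \<and> (\<forall>(u, J)\<in>p. measure lborel J < \<delta>)})"

definition has_riemann_integral ::
    "'w measure \<Rightarrow> (('w \<Rightarrow> 'k::real_normed_field) set, 's, 'm) module_scheme \<Rightarrow>
     ('s \<Rightarrow> ('w \<Rightarrow> real) set) \<Rightarrow> (real \<Rightarrow> 's) \<Rightarrow> real \<Rightarrow> real \<Rightarrow> 's \<Rightarrow> bool" where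
  "has_riemann_integral M S nrm g a b I \<longleftrightarrow>
    limitin (el_topology M S nrm) (riemann_sum M S g) I (mesh_filter a b)"

definition riemann_integral ::
    "'w measure \<Rightarrow> (('w \<Rightarrow> 'k::real_normed_field) set, 's, 'm) module_scheme \<Rightarrow>
     ('s \<Rightarrow> ('w \<Rightarrow> real) set) \<Rightarrow> (real \<Rightarrow> 's) \<Rightarrow> real \<Rightarrow> real \<Rightarrow> 's" where
  "riemann_integral M S nrm g a b = (THE I. has_riemann_integral M S nrm g a b I)"

definition has_improper_integral ::
    "'w measure \<Rightarrow> (('w \<Rightarrow> 'k::real_normed_field) set, 's, 'm) module_scheme \<Rightarrow>
     ('s \<Rightarrow> ('w \<Rightarrow> real) set) \<Rightarrow> (real \<Rightarrow> 's) \<Rightarrow> 's \<Rightarrow> bool" where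
  "has_improper_integral M S nrm g I \<longleftrightarrow>
    (\<forall>L\<ge>0. \<exists>J. has_riemann_integral M S nrm g 0 L J) \<and>
    limitin (el_topology M S nrm) (\<lambda>L. riemann_integral M S nrm g 0 L) I at_top"

definition has_laplace ::
    "'w measure \<Rightarrow> (('w \<Rightarrow> 'k::real_normed_field) set, 's, 'm) module_scheme \<Rightarrow>
     ('s \<Rightarrow> ('w \<Rightarrow> real) set) \<Rightarrow> (real \<Rightarrow> 's) \<Rightarrow> ('w \<Rightarrow> real) set \<Rightarrow> 's \<Rightarrow> bool" where
  "has_laplace M S nrm f \<eta> I \<longleftrightarrow>
    has_improper_integral M S nrm
      (\<lambda>s. L0_of_real M (L0_class M (\<lambda>\<omega>. exp (- (L0_rep \<eta> \<omega> * s)))) \<odot>\<^bsub>S\<^esub> f s) I"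

definition laplace ::
    "'w measure \<Rightarrow> (('w \<Rightarrow> 'k::real_normed_field) set, 's, 'm) module_scheme \<Rightarrow>
     ('s \<Rightarrow> ('w \<Rightarrow> real) set) \<Rightarrow> (real \<Rightarrow> 's) \<Rightarrow> ('w \<Rightarrow> real) set \<Rightarrow> 's" where
  "laplace M S nrm f \<eta> = (THE I. has_laplace M S nrm f \<eta> I)"

text \<open>The domain of \<open>H\<close>, an open set containing \<open>x\<close>, is not mentioned: values of the total
  function \<open>H\<close> away from \<open>x\<close> do not affect the limit.\<close>

definition has_Tc_derivative ::
    "'w measure \<Rightarrow> (('w \<Rightarrow> 'k::real_normed_field) set, 's, 'm) module_scheme \<Rightarrow>
     ('s \<Rightarrow> ('w \<Rightarrow> real) set) \<Rightarrow> (('w \<Rightarrow> real) set \<Rightarrow> 's) \<Rightarrow> ('w \<Rightarrow> real) set \<Rightarrow> 's \<Rightarrow> bool" where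
  "has_Tc_derivative M S nrm H x I \<longleftrightarrow> I \<in> carrier S \<and>
    limitin (Tc_topology M S nrm)
      (\<lambda>r. (L0_of_real M (inv\<^bsub>L0_ring M\<^esub> r) \<odot>\<^bsub>S\<^esub> (H (x \<oplus>\<^bsub>L0_ring M\<^esub> r) \<ominus>\<^bsub>S\<^esub> H x)) \<ominus>\<^bsub>S\<^esub> I)
      \<zero>\<^bsub>S\<^esub>
      (atin_within (Tc_topology M (L0_ring M) (L0_abs M)) \<zero>\<^bsub>L0_ring M\<^esub>
        {r \<in> L0 M. L0_abs M r \<in> L0_pos M})"

definition Tc_deriv ::
    "'w measure \<Rightarrow> (('w \<Rightarrow> 'k::real_normed_field) set, 's, 'm) module_scheme \<Rightarrow>
     ('s \<Rightarrow> ('w \<Rightarrow> real) set) \<Rightarrow> (('w \<Rightarrow> real) set \<Rightarrow> 's) \<Rightarrow> ('w \<Rightarrow> real) set \<Rightarrow> 's" where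
  "Tc_deriv M S nrm H x = (THE I. has_Tc_derivative M S nrm H x I)"

end

theory Submission
  imports Defs "HOL-Real_Asymp.Real_Asymp"
begin

text \<open>
  Convergence in the topology \<open>(\<epsilon>, \<lambda>)\<close> is convergence in probability, metrized by
  \<open>d x y = E (min 1 \<parallel>x - y\<parallel>)\<close>. The weight \<open>1 / (1 + B)\<close> makes the norms of the differences
  \<open>f u - f v\<close> uniformly bounded, so that \<open>f\<close> becomes uniformly continuous in weighted mean on compact
  intervals; comparing two Riemann sums on a common refinement then gives the Riemann integrals, and an
  almost sure exponential bound gives the integrals over the half-line. Every estimate between
  integrals is inherited from Riemann sums: almost sure inequalities survive limits in probability
  by passing to a subsequence.

  The elements \<open>D\<^sub>k(\<eta>)\<close>, the integrals of \<open>(-s)\<^sup>k e\<^sup>-\<^sup>\<eta>\<^sup>s f(s)\<close> over the half-line, satisfy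
  \<open>\<parallel>D\<^sub>k(\<eta> + r) - D\<^sub>k(\<eta>) - r D\<^sub>k\<^sub>+\<^sub>1(\<eta>)\<parallel> \<le> r\<^sup>2 C(\<eta>)\<close> whenever \<open>\<bar>r\<bar> \<le> \<eta>/2\<close>, with \<open>C(\<eta>)\<close> in \<open>L\<^sup>0\<close>, so they
  are the iterated derivatives of the Laplace transform. The \<open>k\<close>-th Post--Widder approximant
  is thus the mean of \<open>f\<close> under an Erlang density with mean \<open>t(k + 1)/k\<close> and second
  moment \<open>t\<^sup>2(k + 2)/k\<^sup>2\<close> about \<open>t\<close>, and Chebyshev's argument in weighted mean concludes.
\<close>

section \<open>Random scalars and the random norm\<close>

context random_normed_module
begin

text \<open>An element of \<open>S\<close> is not a function on the probability space: only its norm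
  is, and only up to a null set that depends on the element. So the scalar Post--Widder theorem
  cannot be applied for each \<omega>, and no single null set serves all \<open>f s\<close>. Riemann
  sums are the way around this: each involves finitely many elements, a sequence of them countably
  many, and their exceptional sets can be united. The scalar bounds, in contrast, are genuine
  functions of s and \<omega>, whose Riemann sums converge for almost every \<omega>. Two kinds of
  smallness must be kept apart. The existence of integrals and the final limit live in probability,
  where means can be used. A derivative in the locally convex topology needs almost sure bounds,
  with radii that vary with \<omega>; hence the error of a difference quotient is estimated by
  \<open>\<bar>r\<bar> * C \<omega>\<close> with a random \<open>C\<close>. The restriction to
  \<bar>r\<bar> \<le> \<eta>/2 keeps \<eta> + r positive and leaves half of the exponential
  decay.\<close>

definition nr :: "'s \<Rightarrow> 'w \<Rightarrow> real" where
  "nr x = L0_rep (nrm x)"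

definition sc :: "('w \<Rightarrow> real) \<Rightarrow> ('w \<Rightarrow> 'k) set" where
  "sc u = L0_class M (\<lambda>\<omega>. of_real (u \<omega>))"

text \<open>Scalars enter as real functions rather than as classes: identities between kernels are
  then proved by real arithmetic, and \<open>act_cong\<close> disposes of null sets.\<close>

definition act :: "('w \<Rightarrow> real) \<Rightarrow> 's \<Rightarrow> 's" where
  "act u x = sc u \<odot>\<^bsub>S\<^esub> x"

lemma carrier_L0_ring: "carrier (L0_ring M :: ('w \<Rightarrow> 'b::real_normed_field) set ring) = L0 M"
  by (simp add: L0_ring_def)

lemma L0_rep_add:
  fixes X Y :: "('w \<Rightarrow> 'b::{real_normed_field, second_countable_topology}) set"
  assumes "X \<in> L0 M" "Y \<in> L0 M"
  shows "AE \<omega> in M. L0_rep (X \<oplus>\<^bsub>L0_ring M\<^esub> Y) \<omega> = L0_rep X \<omega> + L0_rep Y \<omega>"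
  using assms by (auto simp: L0_ring_def intro!: L0_rep_class)

lemma L0_rep_mult:
  fixes X Y :: "('w \<Rightarrow> 'b::{real_normed_field, second_countable_topology}) set"
  assumes "X \<in> L0 M" "Y \<in> L0 M"
  shows "AE \<omega> in M. L0_rep (X \<otimes>\<^bsub>L0_ring M\<^esub> Y) \<omega> = L0_rep X \<omega> * L0_rep Y \<omega>"
  using assms by (auto simp: L0_ring_def intro!: L0_rep_class)

lemma L0_rep_abs:
  fixes X :: "('w \<Rightarrow> 'b::{real_normed_field, second_countable_topology}) set"
  assumes "X \<in> L0 M"
  shows "AE \<omega> in M. L0_rep (L0_abs M X) \<omega> = norm (L0_rep X \<omega>)"
  using assms by (auto simp: L0_abs_def intro!: L0_rep_class)

lemma nrm_L0: "x \<in> carrier S \<Longrightarrow> nrm x \<in> L0 M"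
  using nrm_nonneg by (auto simp: L0_nonneg_def)

lemma nr_measurable [measurable (raw), simp]: "x \<in> carrier S \<Longrightarrow> nr x \<in> borel_measurable M"
  unfolding nr_def by (intro L0_rep_measurable nrm_L0)

lemma nr_nonneg: "x \<in> carrier S \<Longrightarrow> AE \<omega> in M. 0 \<le> nr x \<omega>"
  using nrm_nonneg[of x] L0_rep_const[of M "0::real"] unfolding L0_nonneg_def L0_le_def nr_def
  by auto

lemma nr_add:
  assumes "x \<in> carrier S" "y \<in> carrier S"
  shows "AE \<omega> in M. nr (x \<oplus>\<^bsub>S\<^esub> y) \<omega> \<le> nr x \<omega> + nr y \<omega>"
  using nrm_triangle[OF assms] L0_rep_add[OF nrm_L0[OF assms(1)] nrm_L0[OF assms(2)]]
  unfolding L0_le_def nr_def by eventually_elim simp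

lemma sc_L0 [simp]: "u \<in> borel_measurable M \<Longrightarrow> sc u \<in> L0 M"
  by (simp add: sc_def L0_class_in_L0)

lemma sc_rep: "u \<in> borel_measurable M \<Longrightarrow> AE \<omega> in M. L0_rep (sc u) \<omega> = of_real (u \<omega>)"
  by (simp add: sc_def L0_rep_class)

lemma act_closed [simp, intro]: "u \<in> borel_measurable M \<Longrightarrow> x \<in> carrier S \<Longrightarrow> act u x \<in> carrier S"
  by (simp add: act_def carrier_L0_ring)

lemma sc_cong:
  assumes "u \<in> borel_measurable M" "v \<in> borel_measurable M" "AE \<omega> in M. u \<omega> = v \<omega>"
  shows "sc u = sc v"
  unfolding sc_def using assms by (subst L0_class_eq_iff) auto

lemma act_cong:
  assumes "u \<in> borel_measurable M" "v \<in> borel_measurable M" "AE \<omega> in M. u \<omega> = v \<omega>"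
  shows "act u x = act v x"
  unfolding act_def using sc_cong[OF assms] by simp

lemma sc_add:
  assumes [measurable]: "u \<in> borel_measurable M" "v \<in> borel_measurable M"
  shows "sc (\<lambda>\<omega>. u \<omega> + v \<omega>) = sc u \<oplus>\<^bsub>L0_ring M\<^esub> sc v"
proof (rule L0_eqI[of _ M])
  show "sc u \<oplus>\<^bsub>L0_ring M\<^esub> sc v \<in> L0 M"
    using S.R.add.m_closed[of "sc u" "sc v"] by (simp add: carrier_L0_ring)
  show "AE \<omega> in M. L0_rep (sc (\<lambda>\<omega>. u \<omega> + v \<omega>)) \<omega> = L0_rep (sc u \<oplus>\<^bsub>L0_ring M\<^esub> sc v) \<omega>"
    using sc_rep[of u] sc_rep[of v] sc_rep[of "\<lambda>\<omega>. u \<omega> + v \<omega>"] L0_rep_add[of "sc u" "sc v"] assms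
    by (auto elim!: eventually_elim2[OF eventually_conj])
qed auto

lemma sc_mult:
  assumes [measurable]: "u \<in> borel_measurable M" "v \<in> borel_measurable M"
  shows "sc (\<lambda>\<omega>. u \<omega> * v \<omega>) = sc u \<otimes>\<^bsub>L0_ring M\<^esub> sc v"
proof (rule L0_eqI[of _ M])
  show "sc u \<otimes>\<^bsub>L0_ring M\<^esub> sc v \<in> L0 M"
    using S.R.m_closed[of "sc u" "sc v"] by (simp add: carrier_L0_ring)
  show "AE \<omega> in M. L0_rep (sc (\<lambda>\<omega>. u \<omega> * v \<omega>)) \<omega> = L0_rep (sc u \<otimes>\<^bsub>L0_ring M\<^esub> sc v) \<omega>"
    using sc_rep[of u] sc_rep[of v] sc_rep[of "\<lambda>\<omega>. u \<omega> * v \<omega>"] L0_rep_mult[of "sc u" "sc v"] assms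
    by (auto elim!: eventually_elim2[OF eventually_conj])
qed auto

lemma act_add_left:
  assumes "u \<in> borel_measurable M" "v \<in> borel_measurable M" "x \<in> carrier S"
  shows "act (\<lambda>\<omega>. u \<omega> + v \<omega>) x = act u x \<oplus>\<^bsub>S\<^esub> act v x"
  using assms unfolding act_def sc_add[OF assms(1,2)]
  by (intro S.smult_l_distr) (auto simp: carrier_L0_ring)

lemma act_act:
  assumes "u \<in> borel_measurable M" "v \<in> borel_measurable M" "x \<in> carrier S"
  shows "act u (act v x) = act (\<lambda>\<omega>. u \<omega> * v \<omega>) x"
  using assms unfolding act_def sc_mult[OF assms(1,2)]
  by (intro S.smult_assoc1[symmetric]) (auto simp: carrier_L0_ring)

lemma act_diff_right:
  assumes "u \<in> borel_measurable M" "x \<in> carrier S" "y \<in> carrier S"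
  shows "act u (x \<ominus>\<^bsub>S\<^esub> y) = act u x \<ominus>\<^bsub>S\<^esub> act u y"
  using assms unfolding act_def a_minus_def
  by (simp add: S.smult_r_distr S.smult_r_minus carrier_L0_ring)

lemma act_one: "x \<in> carrier S \<Longrightarrow> act (\<lambda>_. 1) x = x"
  using S.smult_one[of x] by (simp add: act_def sc_def L0_ring_def L0_const_def)

lemma act_zero: "x \<in> carrier S \<Longrightarrow> act (\<lambda>_. 0) x = \<zero>\<^bsub>S\<^esub>"
  using S.smult_l_null[of x] by (simp add: act_def sc_def L0_ring_def L0_const_def)

lemma act_uminus:
  assumes "u \<in> borel_measurable M" "x \<in> carrier S"
  shows "act (\<lambda>\<omega>. - u \<omega>) x = \<ominus>\<^bsub>S\<^esub> act u x"
proof -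
  have "act (\<lambda>\<omega>. - u \<omega>) x \<oplus>\<^bsub>S\<^esub> act u x = \<zero>\<^bsub>S\<^esub>"
    using assms act_add_left[of "\<lambda>\<omega>. - u \<omega>" u x] by (simp add: act_zero)
  then show ?thesis
    using assms by (intro S.M.minus_equality[symmetric]) auto
qed

lemma act_diff_left:
  assumes "u \<in> borel_measurable M" "v \<in> borel_measurable M" "x \<in> carrier S"
  shows "act (\<lambda>\<omega>. u \<omega> - v \<omega>) x = act u x \<ominus>\<^bsub>S\<^esub> act v x"
  using assms act_add_left[of u "\<lambda>\<omega>. - v \<omega>" x] by (simp add: act_uminus a_minus_def)

lemma nr_act:
  assumes "u \<in> borel_measurable M" "x \<in> carrier S"
  shows "AE \<omega> in M. nr (act u x) \<omega> = \<bar>u \<omega>\<bar> * nr x \<omega>"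
proof -
  have 1: "L0_abs M (sc u) \<in> L0 M"
    using assms by (auto simp: L0_abs_def)
  have 2: "nr (act u x) = L0_rep (L0_abs M (sc u) \<otimes>\<^bsub>L0_ring M\<^esub> nrm x)"
    using nrm_smult[of "sc u" x] assms by (simp add: nr_def act_def)
  have 3: "sc u \<in> L0 M" using assms by simp
  show ?thesis
    unfolding 2 using L0_rep_mult[OF 1 nrm_L0[OF assms(2)]] L0_rep_abs[OF 3] sc_rep[OF assms(1)]
    by eventually_elim (simp add: nr_def)
qed

lemma nr_zero: "AE \<omega> in M. nr \<zero>\<^bsub>S\<^esub> \<omega> = 0"
  using nr_act[of "\<lambda>_. 0" "\<zero>\<^bsub>S\<^esub>"] by (simp add: act_zero)

lemma nr_eq_0: 
  assumes "x \<in> carrier S" "AE \<omega> in M. nr x \<omega> = 0"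
  shows "x = \<zero>\<^bsub>S\<^esub>"
proof (rule nrm_eq_zero[OF assms(1)])
  show "nrm x = L0_const M 0"
    using assms L0_rep_const[of M "0::real"]
    by (intro L0_eqI[of _ M] nrm_L0) (auto simp: nr_def)
qed

lemma nr_uminus:
  assumes "x \<in> carrier S"
  shows "AE \<omega> in M. nr (\<ominus>\<^bsub>S\<^esub> x) \<omega> = nr x \<omega>"
  using nr_act[of "\<lambda>_. - 1" x] assms act_uminus[of "\<lambda>_. 1" x] by (simp add: act_one)

lemma nr_diff:
  assumes "x \<in> carrier S" "y \<in> carrier S"
  shows "AE \<omega> in M. nr (x \<ominus>\<^bsub>S\<^esub> y) \<omega> \<le> nr x \<omega> + nr y \<omega>"
  using nr_add[of x "\<ominus>\<^bsub>S\<^esub> y"] nr_uminus[of y] assms by (auto simp: a_minus_def)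

lemma diff_telescope:
  assumes "x \<in> carrier S" "y \<in> carrier S" "z \<in> carrier S"
  shows "x \<ominus>\<^bsub>S\<^esub> z = (x \<ominus>\<^bsub>S\<^esub> y) \<oplus>\<^bsub>S\<^esub> (y \<ominus>\<^bsub>S\<^esub> z)"
proof -
  have "\<ominus>\<^bsub>S\<^esub> y \<oplus>\<^bsub>S\<^esub> (y \<oplus>\<^bsub>S\<^esub> \<ominus>\<^bsub>S\<^esub> z) = \<ominus>\<^bsub>S\<^esub> z"
    using assms by (simp add: S.M.r_neg1)
  then show ?thesis
    using assms by (simp add: a_minus_def S.M.a_assoc)
qed

lemma nr_diff_triangle:
  assumes "x \<in> carrier S" "y \<in> carrier S" "z \<in> carrier S"
  shows "AE \<omega> in M. nr (x \<ominus>\<^bsub>S\<^esub> z) \<omega> \<le> nr (x \<ominus>\<^bsub>S\<^esub> y) \<omega> + nr (y \<ominus>\<^bsub>S\<^esub> z) \<omega>"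
  using assms by (subst diff_telescope[OF assms]) (intro nr_add, auto)

lemma nr_diff_commute:
  assumes "x \<in> carrier S" "y \<in> carrier S"
  shows "AE \<omega> in M. nr (x \<ominus>\<^bsub>S\<^esub> y) \<omega> = nr (y \<ominus>\<^bsub>S\<^esub> x) \<omega>"
proof -
  have "\<ominus>\<^bsub>S\<^esub> (y \<ominus>\<^bsub>S\<^esub> x) = x \<ominus>\<^bsub>S\<^esub> y"
    using assms by (simp add: a_minus_def S.M.minus_add S.M.a_comm)
  then show ?thesis using nr_uminus[of "y \<ominus>\<^bsub>S\<^esub> x"] assms by auto
qed

section \<open>Finite sums in the module\<close>

lemma nr_finsum:
  assumes "finite A" "\<And>i. i \<in> A \<Longrightarrow> y i \<in> carrier S"
  shows "AE \<omega> in M. nr (\<Oplus>\<^bsub>S\<^esub>i\<in>A. y i) \<omega> \<le> (\<Sum>i\<in>A. nr (y i) \<omega>)"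
  using assms
proof (induction A rule: finite_induct)
  case empty
  then show ?case using nr_zero by auto
next
  case (insert i A)
  have "AE \<omega> in M. nr (y i \<oplus>\<^bsub>S\<^esub> (\<Oplus>\<^bsub>S\<^esub>i\<in>A. y i)) \<omega> \<le> nr (y i) \<omega> + nr (\<Oplus>\<^bsub>S\<^esub>i\<in>A. y i) \<omega>"
    using insert.prems by (intro nr_add) auto
  moreover have "AE \<omega> in M. nr (\<Oplus>\<^bsub>S\<^esub>i\<in>A. y i) \<omega> \<le> (\<Sum>i\<in>A. nr (y i) \<omega>)"
    using insert by auto
  moreover have "(\<Oplus>\<^bsub>S\<^esub>i\<in>insert i A. y i) = y i \<oplus>\<^bsub>S\<^esub> (\<Oplus>\<^bsub>S\<^esub>i\<in>A. y i)"
    using insert by (intro S.M.finsum_insert) auto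
  ultimately show ?case using insert.hyps by (auto elim: eventually_elim2)
qed

text \<open>Serves to cut a length into the lengths of intersections, and to collect all kernel
  weights in front of the single element \<open>f t\<close>.\<close>

lemma act_finsum_left:
  assumes "finite A" "\<And>i. i \<in> A \<Longrightarrow> u i \<in> borel_measurable M" "x \<in> carrier S"
  shows "act (\<lambda>\<omega>. \<Sum>i\<in>A. u i \<omega>) x = (\<Oplus>\<^bsub>S\<^esub>i\<in>A. act (u i) x)"
  using assms
proof (induction A rule: finite_induct)
  case empty
  then show ?case by (simp add: act_zero)
next
  case (insert i A)
  have "(\<Oplus>\<^bsub>S\<^esub>i\<in>insert i A. act (u i) x) = act (u i) x \<oplus>\<^bsub>S\<^esub> (\<Oplus>\<^bsub>S\<^esub>i\<in>A. act (u i) x)"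
    using insert by (intro S.M.finsum_insert) auto
  with insert show ?case by (simp add: act_add_left)
qed

lemma act_finsum_right:
  assumes "finite A" "\<And>i. i \<in> A \<Longrightarrow> y i \<in> carrier S" "u \<in> borel_measurable M"
  shows "act u (\<Oplus>\<^bsub>S\<^esub>i\<in>A. y i) = (\<Oplus>\<^bsub>S\<^esub>i\<in>A. act u (y i))"
  unfolding act_def using assms by (intro S.finsum_smult_ldistr) (auto simp: carrier_L0_ring)

lemma finsum_diff:
  assumes "finite A" "\<And>i. i \<in> A \<Longrightarrow> x i \<in> carrier S" "\<And>i. i \<in> A \<Longrightarrow> y i \<in> carrier S"
  shows "(\<Oplus>\<^bsub>S\<^esub>i\<in>A. x i \<ominus>\<^bsub>S\<^esub> y i) = (\<Oplus>\<^bsub>S\<^esub>i\<in>A. x i) \<ominus>\<^bsub>S\<^esub> (\<Oplus>\<^bsub>S\<^esub>i\<in>A. y i)"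
proof -
  have "(\<Oplus>\<^bsub>S\<^esub>i\<in>A. \<ominus>\<^bsub>S\<^esub> y i) = \<ominus>\<^bsub>S\<^esub> (\<Oplus>\<^bsub>S\<^esub>i\<in>A. y i)"
  proof -
    have "(\<Oplus>\<^bsub>S\<^esub>i\<in>A. \<ominus>\<^bsub>S\<^esub> y i) = (\<Oplus>\<^bsub>S\<^esub>i\<in>A. act (\<lambda>_. - 1) (y i))"
      using assms act_uminus[of "\<lambda>_. 1"] by (intro S.M.finsum_cong') (auto simp: act_one)
    also have "\<dots> = act (\<lambda>_. - 1) (\<Oplus>\<^bsub>S\<^esub>i\<in>A. y i)"
      using assms by (intro act_finsum_right[symmetric]) auto
    also have "\<dots> = \<ominus>\<^bsub>S\<^esub> (\<Oplus>\<^bsub>S\<^esub>i\<in>A. y i)"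
      using assms act_uminus[of "\<lambda>_. 1" "\<Oplus>\<^bsub>S\<^esub>i\<in>A. y i"] by (simp add: act_one)
    finally show ?thesis .
  qed
  moreover have "(\<Oplus>\<^bsub>S\<^esub>i\<in>A. x i \<oplus>\<^bsub>S\<^esub> \<ominus>\<^bsub>S\<^esub> y i) = (\<Oplus>\<^bsub>S\<^esub>i\<in>A. x i) \<oplus>\<^bsub>S\<^esub> (\<Oplus>\<^bsub>S\<^esub>i\<in>A. \<ominus>\<^bsub>S\<^esub> y i)"
    using assms by (intro S.M.finsum_addf) auto
  ultimately show ?thesis by (simp add: a_minus_def)
qed

lemma finsum_swap:
  assumes "finite A" "finite C" "\<And>i j. i \<in> A \<Longrightarrow> j \<in> C \<Longrightarrow> y i j \<in> carrier S"
  shows "(\<Oplus>\<^bsub>S\<^esub>i\<in>A. \<Oplus>\<^bsub>S\<^esub>j\<in>C. y i j) = (\<Oplus>\<^bsub>S\<^esub>j\<in>C. \<Oplus>\<^bsub>S\<^esub>i\<in>A. y i j)"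
  using assms
proof (induction A rule: finite_induct)
  case empty
  then show ?case by (simp add: S.M.finsum_zero)
next
  case (insert i A)
  have "(\<Oplus>\<^bsub>S\<^esub>i\<in>insert i A. \<Oplus>\<^bsub>S\<^esub>j\<in>C. y i j) = (\<Oplus>\<^bsub>S\<^esub>j\<in>C. y i j) \<oplus>\<^bsub>S\<^esub> (\<Oplus>\<^bsub>S\<^esub>i\<in>A. \<Oplus>\<^bsub>S\<^esub>j\<in>C. y i j)"
    using insert by (intro S.M.finsum_insert) (auto intro!: S.M.finsum_closed)
  also have "\<dots> = (\<Oplus>\<^bsub>S\<^esub>j\<in>C. y i j) \<oplus>\<^bsub>S\<^esub> (\<Oplus>\<^bsub>S\<^esub>j\<in>C. \<Oplus>\<^bsub>S\<^esub>i\<in>A. y i j)"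
    using insert by simp
  also have "\<dots> = (\<Oplus>\<^bsub>S\<^esub>j\<in>C. y i j \<oplus>\<^bsub>S\<^esub> (\<Oplus>\<^bsub>S\<^esub>i\<in>A. y i j))"
    using insert.prems by (intro S.M.finsum_addf[symmetric]) (auto intro!: S.M.finsum_closed)
  also have "\<dots> = (\<Oplus>\<^bsub>S\<^esub>j\<in>C. \<Oplus>\<^bsub>S\<^esub>i\<in>insert i A. y i j)"
    using insert by (intro S.M.finsum_cong' refl S.M.finsum_insert[symmetric])
      (auto intro!: S.M.finsum_closed)
  finally show ?case .
qed

end

section \<open>Convergence in probability\<close>

context prob_space
begin

text \<open>Truncation gives every nonnegative random variable a finite mean. The price is that
  \<open>E1\<close> is subadditive but not homogeneous; where sums with weights are estimated,
  genuine means take its place.\<close>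

definition E1 :: "('a \<Rightarrow> real) \<Rightarrow> real" where
  "E1 X = (\<integral>\<omega>. min 1 (X \<omega>) \<partial>M)"

lemma integrable_min1:
  fixes X :: "'a \<Rightarrow> real"
  assumes "X \<in> borel_measurable M" "AE \<omega> in M. 0 \<le> X \<omega>"
  shows "integrable M (\<lambda>\<omega>. min 1 (X \<omega>))"
  proof (rule integrable_const_bound)
  show "AE \<omega> in M. norm (min 1 (X \<omega>)) \<le> 1"
    using assms(2) by eventually_elim auto
qed (use assms(1) in simp)

lemma E1_nonneg: "AE \<omega> in M. 0 \<le> X \<omega> \<Longrightarrow> 0 \<le> E1 X"
  unfolding E1_def by (intro integral_nonneg_AE) auto

lemma E1_mono:
  assumes "X \<in> borel_measurable M" "Y \<in> borel_measurable M" "AE \<omega> in M. 0 \<le> X \<omega>"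
    "AE \<omega> in M. X \<omega> \<le> Y \<omega>"
  shows "E1 X \<le> E1 Y"
proof -
  have "AE \<omega> in M. 0 \<le> Y \<omega>" using assms(3,4) by eventually_elim simp
  with assms show ?thesis
    unfolding E1_def by (intro integral_mono_AE integrable_min1) auto
qed

lemma E1_cong:
  assumes "X \<in> borel_measurable M" "Y \<in> borel_measurable M" "AE \<omega> in M. X \<omega> = Y \<omega>"
  shows "E1 X = E1 Y"
  unfolding E1_def using assms by (intro integral_cong_AE) auto

lemma E1_add:
  assumes "X \<in> borel_measurable M" "Y \<in> borel_measurable M" "AE \<omega> in M. 0 \<le> X \<omega>"
    "AE \<omega> in M. 0 \<le> Y \<omega>"
  shows "E1 (\<lambda>\<omega>. X \<omega> + Y \<omega>) \<le> E1 X + E1 Y"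
proof -
  have "AE \<omega> in M. 0 \<le> X \<omega> + Y \<omega>" using assms(3,4) by eventually_elim simp
  then have "E1 (\<lambda>\<omega>. X \<omega> + Y \<omega>) \<le> (\<integral>\<omega>. min 1 (X \<omega>) + min 1 (Y \<omega>) \<partial>M)"
    unfolding E1_def using assms
    by (intro integral_mono_AE integrable_min1 Bochner_Integration.integrable_add) auto
  then show ?thesis
    using assms by (simp add: E1_def integrable_min1)
qed

lemma E1_le_add:
  assumes "X \<in> borel_measurable M" "Y \<in> borel_measurable M" "Z \<in> borel_measurable M"
    "AE \<omega> in M. 0 \<le> X \<omega>" "AE \<omega> in M. 0 \<le> Y \<omega>" "AE \<omega> in M. 0 \<le> Z \<omega>"
    "AE \<omega> in M. Z \<omega> \<le> X \<omega> + Y \<omega>"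
  shows "E1 Z \<le> E1 X + E1 Y"
  using E1_mono[of Z "\<lambda>\<omega>. X \<omega> + Y \<omega>"] E1_add[of X Y] assms by simp

lemma E1_eq_0D:
  assumes "X \<in> borel_measurable M" "AE \<omega> in M. 0 \<le> X \<omega>" "E1 X = 0"
  shows "AE \<omega> in M. X \<omega> = 0"
proof -
  have "AE \<omega> in M. min 1 (X \<omega>) = 0"
    using assms integrable_min1[of X]
    by (subst integral_nonneg_eq_0_iff_AE[symmetric]) (auto simp: E1_def)
  then show ?thesis by eventually_elim (auto simp: min_def split: if_splits)
qed

text \<open>Markov's inequality for \<open>min 1 X\<close>. The level is \<open>min 1 e\<close>
  because the truncated variable never exceeds 1.\<close>

lemma prob_less_gt_if_E1:
  assumes [measurable]: "X \<in> borel_measurable M" and X: "AE \<omega> in M. 0 \<le> X \<omega>"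
    and e: "0 < e" and l: "E1 X < min 1 e * l"
  shows "prob {\<omega> \<in> space M. X \<omega> < e} > 1 - l"
proof -
  have c: "prob {\<omega> \<in> space M. X \<omega> < e} = 1 - prob {\<omega> \<in> space M. X \<omega> \<ge> e}"
    by (subst prob_compl[symmetric]) (auto intro!: arg_cong[where f=prob])
  have "min 1 e * prob {\<omega> \<in> space M. X \<omega> \<ge> e} = (\<integral>\<omega>. min 1 e * indicator {\<omega> \<in> space M. X \<omega> \<ge> e} \<omega> \<partial>M)"
    by simp
  also have "\<dots> \<le> E1 X"
    unfolding E1_def
  proof (intro integral_mono_AE integrable_min1 assms)
    show "AE \<omega> in M. min 1 e * indicator {\<omega> \<in> space M. X \<omega> \<ge> e} \<omega> \<le> min 1 (X \<omega>)"
      using X by eventually_elim (auto simp: indicator_def min_def)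
  qed (simp_all add: integrable_indicator_iff emeasure_eq_measure)
  finally have "min 1 e * prob {\<omega> \<in> space M. X \<omega> \<ge> e} < min 1 e * l" using l by simp
  with e have "prob {\<omega> \<in> space M. X \<omega> \<ge> e} < l"
    by (subst (asm) mult_less_cancel_left_pos) auto
  with c show ?thesis by simp
qed

text \<open>The truncated variable is below \<open>e\<close> where \<open>X < e\<close>, and at most
  1 on the remaining set, whose probability is below \<open>l\<close>.\<close>

lemma E1_less_if_prob:
  assumes [measurable]: "X \<in> borel_measurable M" and X: "AE \<omega> in M. 0 \<le> X \<omega>"
    and e: "0 < e" and l: "prob {\<omega> \<in> space M. X \<omega> < e} > 1 - l"
  shows "E1 X < e + l"
proof -
  have c: "prob {\<omega> \<in> space M. X \<omega> < e} = 1 - prob {\<omega> \<in> space M. X \<omega> \<ge> e}"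
    by (subst prob_compl[symmetric]) (auto intro!: arg_cong[where f=prob])
  have [simp]: "integrable M (indicat_real {\<omega> \<in> space M. X \<omega> \<ge> e})"
    by (intro integrable_real_indicator) (auto simp: emeasure_eq_measure)
  have "E1 X \<le> (\<integral>\<omega>. e + indicator {\<omega> \<in> space M. X \<omega> \<ge> e} \<omega> \<partial>M)"
    unfolding E1_def
  proof (intro integral_mono_AE integrable_min1 assms)
    show "AE \<omega> in M. min 1 (X \<omega>) \<le> e + indicator {\<omega> \<in> space M. X \<omega> \<ge> e} \<omega>"
      using X AE_space by eventually_elim (use e in \<open>auto simp: indicator_def min_def\<close>)
  qed auto
  also have "\<dots> = e + prob {\<omega> \<in> space M. X \<omega> \<ge> e}"
    by (simp add: prob_space)
  finally show ?thesis using c l by simp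
qed

text \<open>Multiplication by a fixed random variable is continuous at 0 in probability: off a set
  of small probability \<open>Z\<close> is bounded by a constant. The modulus \<open>d\<close> is
  uniform in \<open>X\<close>, so the lemma applies along arbitrary filters. It drives every step in
  which an unbounded random factor occurs.\<close>

lemma E1_mult_small:
  assumes [measurable]: "Z \<in> borel_measurable M" and Z: "AE \<omega> in M. 0 \<le> Z \<omega>" and "0 < e"
  shows "\<exists>d>0. \<forall>X. X \<in> borel_measurable M \<longrightarrow> (AE \<omega> in M. 0 \<le> X \<omega>) \<longrightarrow> E1 X < d \<longrightarrow>
    E1 (\<lambda>\<omega>. Z \<omega> * X \<omega>) < e"
proof -
  have "(\<lambda>n. prob {\<omega> \<in> space M. real n < Z \<omega>}) \<longlonglongrightarrow> prob (\<Inter>n. {\<omega> \<in> space M. real n < Z \<omega>})"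
    by (intro finite_Lim_measure_decseq) (auto simp: decseq_def)
  moreover have "(\<Inter>n. {\<omega> \<in> space M. real n < Z \<omega>}) = {}"
    proof (intro equals0I)
    fix \<omega> assume "\<omega> \<in> (\<Inter>n. {\<omega> \<in> space M. real n < Z \<omega>})"
    then have "real n < Z \<omega>" for n by blast
    then show False using reals_Archimedean2[of "Z \<omega>"] by (meson less_asym)
  qed
  ultimately have "(\<lambda>n. prob {\<omega> \<in> space M. real n < Z \<omega>}) \<longlonglongrightarrow> 0" by simp
  then have "\<forall>\<^sub>F n in sequentially. prob {\<omega> \<in> space M. real n < Z \<omega>} < e / 2"
    using \<open>0 < e\<close> by (intro order_tendstoD) auto
  then obtain n where n: "prob {\<omega> \<in> space M. real n < Z \<omega>} < e / 2"
    by (auto simp: eventually_sequentially)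
  \<comment> \<open>\<open>K \<ge> 1\<close> is what makes
    \<open>min 1 (K * x) \<le> K * min 1 x\<close> true for nonnegative x.\<close>
  define K where "K = max 1 (real n)"
  have K: "K \<ge> 1" "K \<ge> real n" by (auto simp: K_def)
  show ?thesis
  proof (intro exI[of _ "e / (2 * K)"] conjI allI impI)
    show "0 < e / (2 * K)" using K \<open>0 < e\<close> by simp
    fix X assume X[measurable]: "X \<in> borel_measurable M" "AE \<omega> in M. 0 \<le> X \<omega>" "E1 X < e / (2 * K)"
    have "AE \<omega> in M. 0 \<le> Z \<omega> * X \<omega>" using Z X(2) by eventually_elim simp
    then have "E1 (\<lambda>\<omega>. Z \<omega> * X \<omega>) \<le>
        (\<integral>\<omega>. K * min 1 (X \<omega>) + indicator {\<omega> \<in> space M. real n < Z \<omega>} \<omega> \<partial>M)"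
      unfolding E1_def
    proof (intro integral_mono_AE integrable_min1 Bochner_Integration.integrable_add
        integrable_mult_right X)
      show "AE \<omega> in M. min 1 (Z \<omega> * X \<omega>) \<le> K * min 1 (X \<omega>) + indicator {\<omega> \<in> space M. real n < Z \<omega>} \<omega>"
        using X(2) Z AE_space
      proof eventually_elim
        case (elim \<omega>)
        show ?case
        proof (cases "real n < Z \<omega>")
          case True
          have "0 \<le> K * min 1 (X \<omega>)" using elim K by (intro mult_nonneg_nonneg) auto
          then have "1 \<le> K * min 1 (X \<omega>) + indicator {\<omega> \<in> space M. real n < Z \<omega>} \<omega>"
            using True elim by simp
          then show ?thesis by (rule order_trans[OF min.cobounded1])
        next
          case False
          then have "Z \<omega> * X \<omega> \<le> K * X \<omega>" using elim K by (intro mult_right_mono) auto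
          moreover have "Z \<omega> * X \<omega> \<le> K * min 1 (X \<omega>)" if "X \<omega> \<le> 1"
            using that calculation by (simp add: min_def)
          ultimately have "min 1 (Z \<omega> * X \<omega>) \<le> K * min 1 (X \<omega>)" using K by (cases "X \<omega> \<le> 1") auto
          then show ?thesis using False by simp
        qed
      qed
    qed (auto intro!: integrable_real_indicator simp: emeasure_eq_measure)
    also have "\<dots> = K * E1 X + prob {\<omega> \<in> space M. real n < Z \<omega>}"
      unfolding E1_def using X integrable_min1[of X]
      by (subst Bochner_Integration.integral_add)
        (auto intro!: integrable_real_indicator simp: emeasure_eq_measure)
    also have "\<dots> < e / 2 + e / 2"
      using X(3) K n by (intro add_strict_mono) (auto simp: field_simps)
    finally show "E1 (\<lambda>\<omega>. Z \<omega> * X \<omega>) < e" by simp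
  qed
qed

text \<open>The truncated variables tend to 0 in mean, so a subsequence of them tends to 0 almost
  surely; once a truncated value has dropped below 1 it equals the original value.\<close>

lemma E1_tendsto_0_AE_subseq:
  assumes X: "\<And>n. X n \<in> borel_measurable M" "\<And>n. AE \<omega> in M. 0 \<le> X n \<omega>"
    and lim: "(\<lambda>n. E1 (X n)) \<longlonglongrightarrow> 0"
  shows "\<exists>r. strict_mono r \<and> (AE \<omega> in M. (\<lambda>n. X (r n) \<omega>) \<longlonglongrightarrow> 0)"
proof -
  have "(\<integral>\<omega>. norm (min 1 (X n \<omega>)) \<partial>M) = E1 (X n)" for n
  proof -
    have "AE \<omega> in M. norm (min 1 (X n \<omega>)) = min 1 (X n \<omega>)"
      using X(2)[of n] by eventually_elim auto
    then show ?thesis unfolding E1_def using X(1)[of n] by (intro integral_cong_AE) auto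
  qed
  with lim have "(\<lambda>n. \<integral>\<omega>. norm (min 1 (X n \<omega>)) \<partial>M) \<longlonglongrightarrow> 0" by simp
  from tendsto_L1_AE_subseq[OF integrable_min1[OF X] this]
  obtain r where r: "strict_mono r" "AE \<omega> in M. (\<lambda>n. min 1 (X (r n) \<omega>)) \<longlonglongrightarrow> 0" by blast
  have "AE \<omega> in M. (\<lambda>n. X (r n) \<omega>) \<longlonglongrightarrow> 0"
    using r(2)
  proof eventually_elim
    case (elim \<omega>)
    then have "\<forall>\<^sub>F n in sequentially. min 1 (X (r n) \<omega>) < 1" by (rule order_tendstoD) simp
    then have "\<forall>\<^sub>F n in sequentially. min 1 (X (r n) \<omega>) = X (r n) \<omega>" by eventually_elim auto
    from tendsto_cong[OF this] elim show ?case by simp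
  qed
  with r(1) show ?thesis by blast
qed

end

context random_normed_module
begin

section \<open>The metric of the topology, and limits of module operations\<close>

lemma diff_zero: "x \<in> carrier S \<Longrightarrow> x \<ominus>\<^bsub>S\<^esub> \<zero>\<^bsub>S\<^esub> = x"
  using S.M.minus_equality[of "\<zero>\<^bsub>S\<^esub>" "\<zero>\<^bsub>S\<^esub>"] by (simp add: a_minus_def)

lemma diff_eq_zero_iff:
  assumes "x \<in> carrier S" "y \<in> carrier S"
  shows "x \<ominus>\<^bsub>S\<^esub> y = \<zero>\<^bsub>S\<^esub> \<longleftrightarrow> x = y"
proof
  assume "x \<ominus>\<^bsub>S\<^esub> y = \<zero>\<^bsub>S\<^esub>"
  then have "\<ominus>\<^bsub>S\<^esub> (\<ominus>\<^bsub>S\<^esub> y) = x"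
    using assms unfolding a_minus_def by (intro S.M.minus_equality) auto
  with assms show "x = y" by simp
qed (use assms in \<open>simp add: a_minus_def S.M.r_neg\<close>)

definition mdist :: "'s \<Rightarrow> 's \<Rightarrow> real" where
  "mdist x y = E1 (nr (x \<ominus>\<^bsub>S\<^esub> y))"

text \<open>The case distinction is there because \<^locale>\<open>Metric_space\<close> demands nonnegativity and symmetry
  on the whole type, whereas the norm is unspecified outside the carrier.\<close>

lemma Metric_space_mdist: "Metric_space (carrier S) (\<lambda>x y. if x \<in> carrier S \<and> y \<in> carrier S then mdist x y else 0)"
proof
  fix x y z
  let ?d = "\<lambda>x y. if x \<in> carrier S \<and> y \<in> carrier S then mdist x y else 0"
  show "0 \<le> ?d x y"
    using nr_nonneg[of "x \<ominus>\<^bsub>S\<^esub> y"] by (auto simp: mdist_def intro!: E1_nonneg)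
  show "?d x y = ?d y x"
    using nr_diff_commute[of x y] by (auto simp: mdist_def intro!: E1_cong)
  show "?d x y = 0 \<longleftrightarrow> x = y" if xy: "x \<in> carrier S" "y \<in> carrier S"
  proof
    assume "?d x y = 0"
    then have "AE \<omega> in M. nr (x \<ominus>\<^bsub>S\<^esub> y) \<omega> = 0"
      using xy nr_nonneg[of "x \<ominus>\<^bsub>S\<^esub> y"] by (intro E1_eq_0D) (auto simp: mdist_def)
    then have "x \<ominus>\<^bsub>S\<^esub> y = \<zero>\<^bsub>S\<^esub>" using xy by (intro nr_eq_0) auto
    then show "x = y" using xy by (simp add: diff_eq_zero_iff)
  next
    assume "x = y"
    then have "x \<ominus>\<^bsub>S\<^esub> y = \<zero>\<^bsub>S\<^esub>" using xy by (simp add: diff_eq_zero_iff)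
    moreover have "E1 (nr \<zero>\<^bsub>S\<^esub>) = E1 (\<lambda>_. 0)" using nr_zero by (intro E1_cong) auto
    ultimately show "?d x y = 0" by (simp add: mdist_def E1_def)
  qed
  show "?d x z \<le> ?d x y + ?d y z" if "x \<in> carrier S" "y \<in> carrier S" "z \<in> carrier S"
    using that nr_diff_triangle[OF that] by (auto simp: mdist_def intro!: E1_le_add nr_nonneg)
qed

sublocale el: Metric_space "carrier S" "\<lambda>x y. if x \<in> carrier S \<and> y \<in> carrier S then mdist x y else 0"
  by (rule Metric_space_mdist)

lemma el_topology_eq: "el_topology M S nrm = el.mtopology"
unfolding topology_eq
proof
  fix V
  have ag: "abelian_group S" by (rule S.M.abelian_group_axioms)
  have oi: "openin (el_topology M S nrm) V \<longleftrightarrow> V \<subseteq> carrier S \<and>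
      (\<forall>x\<in>V. \<exists>\<epsilon>>0. \<exists>l. 0 < l \<and> l < 1 \<and> el_ball M S nrm \<epsilon> l x \<subseteq> V)"
    by (rule openin_el_topology) (fact prob_space_axioms, erule nrm_L0, fact ag)
  \<comment> \<open>The radius \<open>min 1 \<epsilon> * l\<close> is the one that Markov's
    inequality in \<open>prob_less_gt_if_E1\<close> asks for.\<close>
  have 1: "\<exists>r>0. el.mball x r \<subseteq> el_ball M S nrm \<epsilon> l x" if "\<epsilon> > 0" "0 < l" "x \<in> carrier S" for \<epsilon> l x
  proof (intro exI[of _ "min 1 \<epsilon> * l"] conjI subsetI)
    fix y assume "y \<in> el.mball x (min 1 \<epsilon> * l)"
    then have y: "y \<in> carrier S" "mdist y x < min 1 \<epsilon> * l" using that el.commute[of x y] by auto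
    then show "y \<in> el_ball M S nrm \<epsilon> l x"
      using prob_less_gt_if_E1[of "nr (y \<ominus>\<^bsub>S\<^esub> x)" \<epsilon> l] nr_nonneg[of "y \<ominus>\<^bsub>S\<^esub> x"] that
      by (simp add: el_ball_def mdist_def nr_def[symmetric])
  qed (use that in auto)
  \<comment> \<open>A point of the ball has distance below \<epsilon> + l, so r is shared between
    the two parameters; the cap 1/2 keeps l below 1.\<close>
  have 2: "\<exists>\<epsilon>>0. \<exists>l. 0 < l \<and> l < 1 \<and> el_ball M S nrm \<epsilon> l x \<subseteq> el.mball x r" if "r > 0" "x \<in> carrier S" for r x
  proof (rule exI[of _ "r/2"], intro conjI, use that in simp, rule exI[of _ "min (1/2) (r/2)"], intro conjI subsetI)
    fix y assume y: "y \<in> el_ball M S nrm (r/2) (min (1/2) (r/2)) x"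
    then have "y \<in> carrier S" by (simp add: el_ball_def)
    then have "mdist y x < r/2 + min (1/2) (r/2)"
      using E1_less_if_prob[of "nr (y \<ominus>\<^bsub>S\<^esub> x)" "r/2" "min (1/2) (r/2)"] nr_nonneg[of "y \<ominus>\<^bsub>S\<^esub> x"] that y
      by (simp add: el_ball_def mdist_def nr_def[symmetric])
    then have "mdist y x < r" by simp
    then show "y \<in> el.mball x r"
      using el.commute[of x y] \<open>y \<in> carrier S\<close> that by simp
  qed (use that in auto)
  show "openin (el_topology M S nrm) V = openin el.mtopology V"
  proof
    assume "openin (el_topology M S nrm) V"
    then have V: "V \<subseteq> carrier S"
        "\<And>x. x \<in> V \<Longrightarrow> \<exists>\<epsilon>>0. \<exists>l. 0 < l \<and> l < 1 \<and> el_ball M S nrm \<epsilon> l x \<subseteq> V"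
      unfolding oi by auto
    have "\<exists>r>0. el.mball x r \<subseteq> V" if "x \<in> V" for x
    proof -
      from V(2)[OF that] obtain \<epsilon> l where el: "\<epsilon> > 0" "0 < l" "el_ball M S nrm \<epsilon> l x \<subseteq> V" by blast
      from 1[OF el(1,2), of x] V(1) that obtain r where "r > 0" "el.mball x r \<subseteq> el_ball M S nrm \<epsilon> l x"
        by blast
      with el(3) show ?thesis by (intro exI[of _ r]) simp
    qed
    with V(1) show "openin el.mtopology V" by (simp add: el.openin_mtopology)
  next
    assume "openin el.mtopology V"
    then have V: "V \<subseteq> carrier S" "\<And>x. x \<in> V \<Longrightarrow> \<exists>r>0. el.mball x r \<subseteq> V"
      by (simp_all add: el.openin_mtopology)
    have "\<exists>\<epsilon>>0. \<exists>l. 0 < l \<and> l < 1 \<and> el_ball M S nrm \<epsilon> l x \<subseteq> V" if "x \<in> V" for x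
    proof -
      from V(2)[OF that] obtain r where r: "r > 0" "el.mball x r \<subseteq> V" by blast
      from 2[OF r(1), of x] V(1) that obtain \<epsilon> l
        where "\<epsilon> > 0" "0 < l" "l < 1" "el_ball M S nrm \<epsilon> l x \<subseteq> el.mball x r" by blast
      with r(2) show ?thesis by (intro exI[of _ \<epsilon>] exI[of _ l] conjI) simp_all
    qed
    with V(1) show "openin (el_topology M S nrm) V"
      unfolding oi by simp
  qed
qed

lemma limitin_el_iff:
  "limitin (el_topology M S nrm) X x F \<longleftrightarrow>
    x \<in> carrier S \<and> (\<forall>e>0. \<forall>\<^sub>F n in F. X n \<in> carrier S \<and> mdist (X n) x < e)"
proof -
  have "(X n \<in> carrier S \<and> (if X n \<in> carrier S \<and> x \<in> carrier S then mdist (X n) x else 0) < e) \<longleftrightarrow>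
     (X n \<in> carrier S \<and> mdist (X n) x < e)" if "x \<in> carrier S" for n e using that by auto
  then show ?thesis
    unfolding el_topology_eq el.limitin_metric by (auto cong: conj_cong)
qed

lemma limitin_el_unique:
  "limitin (el_topology M S nrm) X x F \<Longrightarrow> limitin (el_topology M S nrm) X y F \<Longrightarrow> F \<noteq> bot \<Longrightarrow> x = y"
  unfolding el_topology_eq by (rule el.limitin_metric_unique)

lemma topspace_el [simp]: "topspace (el_topology M S nrm) = carrier S"
  by (simp add: el_topology_eq)

lemma mdist_nonneg: "x \<in> carrier S \<Longrightarrow> y \<in> carrier S \<Longrightarrow> 0 \<le> mdist x y"
  using el.nonneg[of x y] by simp

lemma mdist_commute: "x \<in> carrier S \<Longrightarrow> y \<in> carrier S \<Longrightarrow> mdist x y = mdist y x"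
  using el.commute[of x y] by simp

lemma mdist_triangle:
  "x \<in> carrier S \<Longrightarrow> y \<in> carrier S \<Longrightarrow> z \<in> carrier S \<Longrightarrow> mdist x z \<le> mdist x y + mdist y z"
  using el.triangle[of x y z] by simp

lemma el_complete_Cauchy:
  assumes "el_complete M S nrm" "\<And>n::nat. X n \<in> carrier S"
    "\<And>e. e > 0 \<Longrightarrow> \<exists>N. \<forall>m\<ge>N. \<forall>n\<ge>N. mdist (X m) (X n) < e"
  shows "\<exists>x. limitin (el_topology M S nrm) X x sequentially"
proof -
  have "\<exists>N. \<forall>m\<ge>N. \<forall>n\<ge>N. X m \<in> el_ball M S nrm \<epsilon> l (X n)" if "\<epsilon> > 0" "0 < l" for \<epsilon> l
  proof -
    from that have "0 < min 1 \<epsilon> * l" by simp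
    from assms(3)[OF this] obtain N where N: "\<And>m n. m \<ge> N \<Longrightarrow> n \<ge> N \<Longrightarrow> mdist (X m) (X n) < min 1 \<epsilon> * l"
      by blast
    show ?thesis
    proof (intro exI[of _ N] allI impI)
      fix m n assume "N \<le> m" "N \<le> n"
      from N[OF this] show "X m \<in> el_ball M S nrm \<epsilon> l (X n)"
        using prob_less_gt_if_E1[of "nr (X m \<ominus>\<^bsub>S\<^esub> X n)" \<epsilon> l] nr_nonneg[of "X m \<ominus>\<^bsub>S\<^esub> X n"] that assms(2)
        by (simp add: el_ball_def mdist_def nr_def[symmetric])
    qed
  qed
  then show ?thesis
    using assms(1)[unfolded el_complete_def, rule_format, of X] assms(2) by blast
qed

lemma limitin_el_add:
  assumes "limitin (el_topology M S nrm) X x F" "limitin (el_topology M S nrm) Y y F"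
  shows "limitin (el_topology M S nrm) (\<lambda>n. X n \<oplus>\<^bsub>S\<^esub> Y n) (x \<oplus>\<^bsub>S\<^esub> y) F"
  unfolding limitin_el_iff
proof (intro conjI allI impI)
  have xy: "x \<in> carrier S" "y \<in> carrier S" using assms by (auto simp: limitin_el_iff)
  then show "x \<oplus>\<^bsub>S\<^esub> y \<in> carrier S" by simp
  fix e :: real assume "e > 0"
  then have "e / 2 > 0" by simp
  then have "\<forall>\<^sub>F n in F. X n \<in> carrier S \<and> mdist (X n) x < e/2"
     "\<forall>\<^sub>F n in F. Y n \<in> carrier S \<and> mdist (Y n) y < e/2"
    using assms unfolding limitin_el_iff by blast+
  then show "\<forall>\<^sub>F n in F. X n \<oplus>\<^bsub>S\<^esub> Y n \<in> carrier S \<and> mdist (X n \<oplus>\<^bsub>S\<^esub> Y n) (x \<oplus>\<^bsub>S\<^esub> y) < e"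
  proof eventually_elim
    case (elim n)
    have eq: "X n \<oplus>\<^bsub>S\<^esub> Y n \<ominus>\<^bsub>S\<^esub> (x \<oplus>\<^bsub>S\<^esub> y) = (X n \<ominus>\<^bsub>S\<^esub> x) \<oplus>\<^bsub>S\<^esub> (Y n \<ominus>\<^bsub>S\<^esub> y)"
      using elim xy by (simp add: a_minus_def S.M.minus_add S.M.a_ac)
    have "mdist (X n \<oplus>\<^bsub>S\<^esub> Y n) (x \<oplus>\<^bsub>S\<^esub> y) \<le> mdist (X n) x + mdist (Y n) y"
      unfolding mdist_def eq using elim xy by (intro E1_le_add nr_add nr_nonneg) auto
    with elim show ?case by simp
  qed
qed

text \<open>The factor \<open>u\<close> may be unbounded, so the map is not Lipschitz for
  \<open>mdist\<close>; its modulus of continuity comes from \<open>E1_mult_small\<close>.\<close>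

lemma limitin_el_act:
  assumes "limitin (el_topology M S nrm) X x F" and u: "u \<in> borel_measurable M"
  shows "limitin (el_topology M S nrm) (\<lambda>n. act u (X n)) (act u x) F"
  unfolding limitin_el_iff
proof (intro conjI allI impI)
  have x: "x \<in> carrier S" using assms by (auto simp: limitin_el_iff)
  then show "act u x \<in> carrier S" using u by simp
  fix e :: real assume "e > 0"
  with E1_mult_small[of "\<lambda>\<omega>. \<bar>u \<omega>\<bar>" e] u obtain d where d: "d > 0"
    "\<And>X. X \<in> borel_measurable M \<Longrightarrow> (AE \<omega> in M. 0 \<le> X \<omega>) \<Longrightarrow> E1 X < d \<Longrightarrow> E1 (\<lambda>\<omega>. \<bar>u \<omega>\<bar> * X \<omega>) < e"
    by auto
  have "\<forall>\<^sub>F n in F. X n \<in> carrier S \<and> mdist (X n) x < d"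
    using assms d(1) by (auto simp: limitin_el_iff)
  then show "\<forall>\<^sub>F n in F. act u (X n) \<in> carrier S \<and> mdist (act u (X n)) (act u x) < e"
  proof eventually_elim
    case (elim n)
    have "mdist (act u (X n)) (act u x) = E1 (nr (act u (X n \<ominus>\<^bsub>S\<^esub> x)))"
      using elim x u by (simp add: mdist_def act_diff_right)
    also have "\<dots> = E1 (\<lambda>\<omega>. \<bar>u \<omega>\<bar> * nr (X n \<ominus>\<^bsub>S\<^esub> x) \<omega>)"
      using elim x u by (intro E1_cong nr_act) auto
    also have "\<dots> < e"
      using elim x d(2)[of "nr (X n \<ominus>\<^bsub>S\<^esub> x)"] nr_nonneg[of "X n \<ominus>\<^bsub>S\<^esub> x"] by (simp add: mdist_def)
    finally show ?case using elim u by simp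
  qed
qed

lemma limitin_el_diff:
  assumes "limitin (el_topology M S nrm) X x F" "limitin (el_topology M S nrm) Y y F"
  shows "limitin (el_topology M S nrm) (\<lambda>n. X n \<ominus>\<^bsub>S\<^esub> Y n) (x \<ominus>\<^bsub>S\<^esub> y) F"
proof -
  have neg: "act (\<lambda>_. - 1) z = \<ominus>\<^bsub>S\<^esub> z" if "z \<in> carrier S" for z
    using that act_uminus[of "\<lambda>_. 1" z] by (simp add: act_one)
  have "limitin (el_topology M S nrm) (\<lambda>n. X n \<oplus>\<^bsub>S\<^esub> act (\<lambda>_. - 1) (Y n)) (x \<oplus>\<^bsub>S\<^esub> act (\<lambda>_. - 1) y) F"
    using assms by (intro limitin_el_add limitin_el_act) auto
  moreover have "\<forall>\<^sub>F n in F. Y n \<in> carrier S \<and> mdist (Y n) y < 1"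
    using assms(2) zero_less_one unfolding limitin_el_iff by blast
  then have "\<forall>\<^sub>F n in F. X n \<oplus>\<^bsub>S\<^esub> act (\<lambda>_. - 1) (Y n) = X n \<ominus>\<^bsub>S\<^esub> Y n"
    by eventually_elim (simp add: neg a_minus_def)
  moreover have "x \<oplus>\<^bsub>S\<^esub> act (\<lambda>_. - 1) y = x \<ominus>\<^bsub>S\<^esub> y"
    using assms(2) by (simp add: neg a_minus_def limitin_el_iff)
  ultimately show ?thesis
    using limitin_transform_eventually[of "\<lambda>n. X n \<oplus>\<^bsub>S\<^esub> act (\<lambda>_. - 1) (Y n)" "\<lambda>n. X n \<ominus>\<^bsub>S\<^esub> Y n" F] by simp
qed

text \<open>The bounds \<open>c n\<close> vary with n because they will be scalar Riemann sums.
  Along a subsequence the distance of \<open>X n\<close> to \<open>x\<close> tends to 0 almost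
  surely, the bounds keep their limit there, and the countably many exceptional sets are
  united.\<close>

lemma nr_le_of_limitin:
  assumes lim: "limitin (el_topology M S nrm) X x sequentially"
    and X: "\<And>n. X n \<in> carrier S"
    and le: "\<And>n. AE \<omega> in M. nr (X n) \<omega> \<le> c n \<omega>"
    and c: "AE \<omega> in M. (\<lambda>n. c n \<omega>) \<longlonglongrightarrow> C \<omega>"
  shows "AE \<omega> in M. nr x \<omega> \<le> C \<omega>"
proof -
  have x: "x \<in> carrier S" using lim by (auto simp: limitin_el_iff)
  have "(\<lambda>n. E1 (nr (X n \<ominus>\<^bsub>S\<^esub> x))) \<longlonglongrightarrow> 0"
  proof (rule tendstoI)
    fix e :: real assume "e > 0"
    with lim have "\<forall>\<^sub>F n in sequentially. X n \<in> carrier S \<and> mdist (X n) x < e"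
      by (auto simp: limitin_el_iff)
    then show "\<forall>\<^sub>F n in sequentially. dist (E1 (nr (X n \<ominus>\<^bsub>S\<^esub> x))) 0 < e"
      by eventually_elim (use mdist_nonneg[OF X x] in \<open>auto simp: mdist_def\<close>)
  qed
  then obtain r where r: "strict_mono r" "AE \<omega> in M. (\<lambda>n. nr (X (r n) \<ominus>\<^bsub>S\<^esub> x) \<omega>) \<longlonglongrightarrow> 0"
    using E1_tendsto_0_AE_subseq[of "\<lambda>n. nr (X n \<ominus>\<^bsub>S\<^esub> x)"] X x nr_nonneg[OF S.M.minus_closed[OF X x]] by auto
  have "AE \<omega> in M. \<forall>n. nr x \<omega> \<le> nr (X (r n) \<ominus>\<^bsub>S\<^esub> x) \<omega> + c (r n) \<omega>"
    unfolding AE_all_countable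
  proof
    fix n
    have "AE \<omega> in M. nr x \<omega> \<le> nr (x \<ominus>\<^bsub>S\<^esub> X (r n)) \<omega> + nr (X (r n)) \<omega>"
      using nr_diff_triangle[of x "X (r n)" "\<zero>\<^bsub>S\<^esub>"] x X by (simp add: diff_zero)
    then show "AE \<omega> in M. nr x \<omega> \<le> nr (X (r n) \<ominus>\<^bsub>S\<^esub> x) \<omega> + c (r n) \<omega>"
      using nr_diff_commute[OF x X[of "r n"]] le[of "r n"] by eventually_elim linarith
  qed
  with r(2) c show ?thesis
  proof eventually_elim
    case (elim \<omega>)
    have "(\<lambda>n. c (r n) \<omega>) \<longlonglongrightarrow> C \<omega>"
      using LIMSEQ_subseq_LIMSEQ[OF elim(2) r(1)] by (simp add: o_def)
    then have "(\<lambda>n. nr (X (r n) \<ominus>\<^bsub>S\<^esub> x) \<omega> + c (r n) \<omega>) \<longlonglongrightarrow> 0 + C \<omega>"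
      by (intro tendsto_add elim(1))
    then show ?case using elim(3) by (intro LIMSEQ_le_const[of _ "C \<omega>"]) auto
  qed
qed

end

section \<open>Riemann sums and integrability\<close>

definition mesh_below :: "real \<Rightarrow> real \<Rightarrow> real \<Rightarrow> (real \<times> real set) set \<Rightarrow> bool" where
  "mesh_below d a b p \<longleftrightarrow> p tagged_division_of {a..b} \<and> (\<forall>q\<in>p. measure lborel (snd q) < d)"

lemma mesh_below_mono: "mesh_below d a b p \<Longrightarrow> d \<le> e \<Longrightarrow> mesh_below e a b p"
  by (force simp: mesh_below_def)

text \<open>The base sets are directed, the one for \<open>min d e\<close> being contained in those
  for \<open>d\<close> and \<open>e\<close>; a property is therefore eventual exactly when it holds
  on a single base set.\<close>

lemma eventually_mesh_filter:
  "eventually P (mesh_filter a b) \<longleftrightarrow> (\<exists>d>0. \<forall>p. mesh_below d a b p \<longrightarrow> P p)"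
proof -
  have "mesh_filter a b = (INF d\<in>{0<..}. principal {p. mesh_below d a b p})"
    unfolding mesh_filter_def mesh_below_def by (simp add: case_prod_beta)
  also have "eventually P \<dots> \<longleftrightarrow> (\<exists>d\<in>{0<..}. eventually P (principal {p. mesh_below d a b p}))"
  proof (rule eventually_INF_base)
    fix d e :: real assume "d \<in> {0<..}" "e \<in> {0<..}"
    then show "\<exists>x\<in>{0<..}. principal {p. mesh_below x a b p}
        \<le> inf (principal {p. mesh_below d a b p}) (principal {p. mesh_below e a b p})"
      by (intro bexI[of _ "min d e"]) (auto intro: mesh_below_mono)
  qed auto
  finally show ?thesis by (auto simp: eventually_principal)
qed

text \<open>Cousin's lemma for the constant gauge of radius d/4: both endpoints of an interval lie
  within d/4 of its tag.\<close>

lemma mesh_below_exists: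
  assumes "0 < d" "a \<le> b"
  shows "\<exists>p. mesh_below d a b p"
proof -
  have "gauge (\<lambda>x::real. ball x (d / 4))" using assms by (intro gauge_ball) auto
  then obtain p where p: "p tagged_division_of {a..b}" "(\<lambda>x. ball x (d / 4)) fine p"
    by (rule fine_division_exists_real)
  have "measure lborel (snd q) < d" if "q \<in> p" for q
  proof -
    obtain u J where q: "q = (u, J)" by (cases q)
    with that p obtain x y where J: "J = {x..y}" "u \<in> J" "J \<subseteq> ball u (d / 4)"
      by (metis box_real(2) fineD tagged_division_ofD(2,4))
    then have "x \<in> ball u (d/4)" "y \<in> ball u (d/4)" "x \<le> y" by (auto simp del: mem_ball)
    then have "\<bar>u - x\<bar> < d / 4" "\<bar>u - y\<bar> < d / 4" by (auto simp: dist_real_def)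
    then have "y - x < d" using assms(1) by linarith
    with \<open>x \<le> y\<close> show ?thesis by (simp add: q J)
  qed
  with p show ?thesis by (auto simp: mesh_below_def)
qed

lemma mesh_filter_neq_bot: "a \<le> b \<Longrightarrow> mesh_filter a b \<noteq> bot"
  using mesh_below_exists by (auto simp: trivial_limit_def eventually_mesh_filter)

text \<open>Almost sure statements survive only countably many exceptional sets, so limits along the
  mesh filter are turned into limits along such sequences of divisions.\<close>

lemma filterlim_mesh_filter:
  assumes "\<And>n. mesh_below (1 / real (Suc n)) a b (p n)"
  shows "filterlim p (mesh_filter a b) sequentially"
  unfolding filterlim_iff eventually_mesh_filter
proof (intro allI impI, elim exE conjE)
  fix P d assume d: "0 < (d::real)" "\<forall>p. mesh_below d a b p \<longrightarrow> P p"
  then obtain N where N: "1 / real (Suc N) < d" using nat_approx_posE by blast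
  have "P (p n)" if "n \<ge> N" for n
  proof -
    have "1 / real (Suc n) \<le> 1 / real (Suc N)" using that by (simp add: frac_le)
    with N have "mesh_below d a b (p n)" by (intro mesh_below_mono[OF assms]) simp
    with d show ?thesis by blast
  qed
  then show "\<forall>\<^sub>F n in sequentially. P (p n)" by (auto simp: eventually_sequentially)
qed

lemma mesh_below_tag:
  assumes "mesh_below d a b p" "q \<in> p"
  shows "fst q \<in> {a..b}" "snd q \<subseteq> {a..b}" "fst q \<in> snd q" "measure lborel (snd q) < d"
    "x \<in> snd q \<Longrightarrow> \<bar>x - fst q\<bar> < d" "\<exists>c d. snd q = {c..d}"
proof -
  obtain u J where q: "q = (u, J)" by (cases q)
  from assms have p: "p tagged_division_of {a..b}" "measure lborel (snd q) < d"
    by (auto simp: mesh_below_def)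
  with assms q obtain y z where J: "J = {y..z}" "u \<in> J" "J \<subseteq> {a..b}"
    by (metis box_real(2) tagged_division_ofD(2,3,4))
  with p q show "fst q \<in> {a..b}" "snd q \<subseteq> {a..b}" "fst q \<in> snd q" "measure lborel (snd q) < d"
    "\<exists>c d. snd q = {c..d}" by auto
  show "\<bar>x - fst q\<bar> < d" if "x \<in> snd q"
    using that J p(2) q by auto
qed

lemma mesh_below_finite: "mesh_below d a b p \<Longrightarrow> finite p"
  by (auto simp: mesh_below_def)

text \<open>Additivity of the integral of the indicator of \<open>J\<close> over the intervals of
  \<open>q\<close>; passing through the integral absorbs the endpoints that neighbouring intervals
  share.\<close>

lemma sum_content_Int_tagged_division:
  fixes a b :: real
  assumes q: "q tagged_division_of {a..b}" and J: "J = {c..d}" "J \<subseteq> {a..b}"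
  shows "(\<Sum>r\<in>q. measure lborel (J \<inter> snd r)) = measure lborel J"
proof -
  have m: "integral K (indicator J) = measure lborel (J \<inter> K)" if "K = {x..y}" for K x y
  proof -
    have "J \<inter> K = {max c x..min d y}" using J that by auto
    then have "J \<inter> K \<in> lmeasurable" "J \<inter> K \<in> sets lborel" by auto
    then show ?thesis
      using integral_indicator[of J K] by simp
  qed
  have "(indicator J :: real \<Rightarrow> real) integrable_on {a..b}"
    unfolding J by (simp add: integrable_on_indicator)
  from integral_combine_tagged_division_topdown[of "indicator J" a b q] this q
  have "integral {a..b} (indicator J) = (\<Sum>(x, K)\<in>q. integral K (indicator J :: real \<Rightarrow> real))" by simp
  also have "\<dots> = (\<Sum>r\<in>q. measure lborel (J \<inter> snd r))"
  proof (intro sum.cong refl, clarify)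
    fix u K assume "(u, K) \<in> q"
    with q obtain x y where "K = {x..y}" by (metis box_real(2) tagged_division_ofD(4))
    from m[OF this] show "integral K (indicator J) = measure lborel (J \<inter> snd (u, K))" by simp
  qed
  finally have "(\<Sum>r\<in>q. measure lborel (J \<inter> snd r)) = integral {a..b} (indicator J)" by simp
  also have "\<dots> = measure lborel (J \<inter> {a..b})" using m by blast
  also have "J \<inter> {a..b} = J" using J by blast
  finally show ?thesis .
qed

lemma sum_content_tagged_division:
  fixes a b :: real
  assumes "q tagged_division_of {a..b}" "a \<le> b"
  shows "(\<Sum>r\<in>q. measure lborel (snd r)) = b - a"
proof -
  have "(\<Sum>r\<in>q. measure lborel ({a..b} \<inter> snd r)) = (\<Sum>r\<in>q. measure lborel (snd r))"
  proof (intro sum.cong refl)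
    fix r assume "r \<in> q"
    then have "snd r \<subseteq> {a..b}" using assms(1) by (metis prod.collapse tagged_division_ofD(3))
    then show "measure lborel ({a..b} \<inter> snd r) = measure lborel (snd r)" by (simp add: Int_absorb1)
  qed
  with sum_content_Int_tagged_division[OF assms(1), of "{a..b}"] assms(2) show ?thesis by simp
qed

lemma riemann_sum_close:
  fixes g :: "real \<Rightarrow> real"
  assumes g: "g integrable_on {a..b}" and p: "mesh_below d a b p" and "a \<le> b"
    and e: "\<And>u v. u \<in> {a..b} \<Longrightarrow> v \<in> {a..b} \<Longrightarrow> \<bar>u - v\<bar> < d \<Longrightarrow> \<bar>g u - g v\<bar> \<le> e"
  shows "\<bar>(\<Sum>q\<in>p. measure lborel (snd q) * g (fst q)) - integral {a..b} g\<bar> \<le> e * (b - a)"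
proof -
  have t: "p tagged_division_of {a..b}" using p by (simp add: mesh_below_def)
  have int: "g integrable_on snd q" if "q \<in> p" for q
    using mesh_below_tag(2,6)[OF p that] g by (metis integrable_on_subinterval)
  have "integral {a..b} g = (\<Sum>q\<in>p. integral (snd q) g)"
    using integral_combine_tagged_division_topdown[of g a b p] g t by (simp add: case_prod_beta)
  then have "\<bar>(\<Sum>q\<in>p. measure lborel (snd q) * g (fst q)) - integral {a..b} g\<bar>
      = \<bar>\<Sum>q\<in>p. measure lborel (snd q) * g (fst q) - integral (snd q) g\<bar>"
    by (simp add: sum_subtractf)
  also have "\<dots> \<le> (\<Sum>q\<in>p. e * measure lborel (snd q))"
  proof (intro order_trans[OF sum_abs] sum_mono)
    fix q assume q: "q \<in> p"
    note tag = mesh_below_tag[OF p q]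
    from tag(6) obtain x y where xy: "snd q = {x..y}" by blast
    with tag(3) have "x \<le> y" by auto
    have "integral {x..y} (\<lambda>v. g (fst q) - g v) = measure lborel (snd q) * g (fst q) - integral (snd q) g"
      using int[OF q] xy \<open>x \<le> y\<close> by (subst integral_diff) auto
    moreover have "norm (integral (cbox x y) (\<lambda>v. g (fst q) - g v)) \<le> e * Henstock_Kurzweil_Integration.content (cbox x y)"
    proof (rule has_integral_bound)
      show "((\<lambda>v. g (fst q) - g v) has_integral integral (cbox x y) (\<lambda>v. g (fst q) - g v)) (cbox x y)"
        using int[OF q] xy by (intro integrable_integral integrable_diff) auto
      \<comment> \<open>The mesh bound makes d positive, and then the hypothesis at u = v yields
        this.\<close>
      show "0 \<le> e" using e[OF tag(1) tag(1)] tag(4) measure_nonneg[of lborel "snd q"] by (auto simp del: measure_nonneg)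
      show "norm (g (fst q) - g v) \<le> e" if "v \<in> cbox x y" for v
        using that tag xy e[of "fst q" v] tag(5)[of v] by (auto simp: abs_minus_commute)
    qed
    ultimately show "\<bar>measure lborel (snd q) * g (fst q) - integral (snd q) g\<bar> \<le> e * measure lborel (snd q)"
      using xy by simp
  qed
  also have "\<dots> = e * (b - a)"
    using sum_content_tagged_division[OF t \<open>a \<le> b\<close>] by (simp add: sum_distrib_left[symmetric])
  finally show ?thesis .
qed

lemma riemann_sums_tendsto:
  fixes g :: "real \<Rightarrow> real"
  assumes g: "continuous_on {a..b} g" and p: "\<And>n. mesh_below (1 / real (Suc n)) a b (p n)" and "a \<le> b"
  shows "(\<lambda>n. \<Sum>q\<in>p n. measure lborel (snd q) * g (fst q)) \<longlonglongrightarrow> integral {a..b} g"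
proof (rule LIMSEQ_I)
  fix e :: real assume "0 < e"
  \<comment> \<open>The summand 1 keeps the denominator positive when a = b.\<close>
  define e' where "e' = e / (2 * (b - a + 1))"
  have e': "e' > 0" using \<open>0 < e\<close> \<open>a \<le> b\<close> by (simp add: e'_def)
  have "e' * (b - a) \<le> e / 2"
    using \<open>0 < e\<close> \<open>a \<le> b\<close> by (simp add: e'_def field_simps)
  with \<open>0 < e\<close> have less: "e' * (b - a) < e" by simp
  have "uniformly_continuous_on {a..b} g" using g by (intro compact_uniformly_continuous) auto
  then obtain d where d: "d > 0"
    "\<And>u v. u \<in> {a..b} \<Longrightarrow> v \<in> {a..b} \<Longrightarrow> dist u v < d \<Longrightarrow> dist (g u) (g v) < e'"
    using e' unfolding uniformly_continuous_on_def by (metis dist_commute)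
  from d(1) have "\<forall>\<^sub>F r in mesh_filter a b. mesh_below d a b r"
    unfolding eventually_mesh_filter by blast
  with filterlim_mesh_filter[OF p] have "\<forall>\<^sub>F n in sequentially. mesh_below d a b (p n)"
    by (simp add: filterlim_iff)
  then obtain N where N: "\<And>n. n \<ge> N \<Longrightarrow> mesh_below d a b (p n)" by (auto simp: eventually_sequentially)
  show "\<exists>N. \<forall>n\<ge>N. norm ((\<Sum>q\<in>p n. measure lborel (snd q) * g (fst q)) - integral {a..b} g) < e"
  proof (intro exI[of _ N] allI impI)
    fix n assume "n \<ge> N"
    have "\<bar>(\<Sum>q\<in>p n. measure lborel (snd q) * g (fst q)) - integral {a..b} g\<bar> \<le> e' * (b - a)"
      using g N[OF \<open>n \<ge> N\<close>] \<open>a \<le> b\<close> d(2)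
      by (intro riemann_sum_close[where d=d] integrable_continuous_real) (auto simp: dist_real_def less_imp_le)
    with less show "norm ((\<Sum>q\<in>p n. measure lborel (snd q) * g (fst q)) - integral {a..b} g) < e" by simp
  qed
qed

context random_normed_module
begin

section \<open>Riemann sums and Riemann integrability in the module\<close>

lemma riemann_sum_eq:
  "riemann_sum M S g p = (\<Oplus>\<^bsub>S\<^esub>q\<in>p. act (\<lambda>_. measure lborel (snd q)) (g (fst q)))"
  by (simp add: riemann_sum_def act_def sc_def L0_const_def)

lemma riemann_sum_closed:
  "(\<And>q. q \<in> p \<Longrightarrow> g (fst q) \<in> carrier S) \<Longrightarrow> riemann_sum M S g p \<in> carrier S"
  unfolding riemann_sum_eq by (intro S.M.finsum_closed) auto

text \<open>The refinement is not built as a tagged division: it is represented by all pairs of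
  intervals, weighted by the length of their intersection. Pairs that do not meet get weight 0, and
  both original tags stay available.\<close>

lemma riemann_sum_common_refinement:
  assumes p: "mesh_below d a b p" and q: "mesh_below d' a b q"
    and g: "\<And>u. u \<in> {a..b} \<Longrightarrow> g u \<in> carrier S"
  shows "riemann_sum M S g p \<ominus>\<^bsub>S\<^esub> riemann_sum M S g q =
    (\<Oplus>\<^bsub>S\<^esub>i\<in>p. \<Oplus>\<^bsub>S\<^esub>j\<in>q. act (\<lambda>_. measure lborel (snd i \<inter> snd j)) (g (fst i) \<ominus>\<^bsub>S\<^esub> g (fst j)))"
proof -
  note fin = mesh_below_finite[OF p] mesh_below_finite[OF q]
  have gp: "g (fst i) \<in> carrier S" if "i \<in> p" for i using mesh_below_tag(1)[OF p that] g by blast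
  have gq: "g (fst j) \<in> carrier S" if "j \<in> q" for j using mesh_below_tag(1)[OF q that] g by blast
  have split: "act (\<lambda>_. measure lborel (snd i)) x = (\<Oplus>\<^bsub>S\<^esub>j\<in>r. act (\<lambda>_. measure lborel (snd i \<inter> snd j)) x)"
    if r: "mesh_below d' a b r" and i: "mesh_below d a b s" "i \<in> s" and x: "x \<in> carrier S" for d d' r s i x
  proof -
    have "measure lborel (snd i) = (\<Sum>j\<in>r. measure lborel (snd i \<inter> snd j))"
      using sum_content_Int_tagged_division[of r a b "snd i"] r mesh_below_tag(2,6)[OF i]
      by (auto simp: mesh_below_def)
    then show ?thesis using x r by (simp add: act_finsum_left mesh_below_finite)
  qed
  have "riemann_sum M S g p = (\<Oplus>\<^bsub>S\<^esub>i\<in>p. \<Oplus>\<^bsub>S\<^esub>j\<in>q. act (\<lambda>_. measure lborel (snd i \<inter> snd j)) (g (fst i)))"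
    unfolding riemann_sum_eq using gp
    by (intro S.M.finsum_cong' refl split[OF q p]) (auto intro!: S.M.finsum_closed)
  moreover have "riemann_sum M S g q = (\<Oplus>\<^bsub>S\<^esub>j\<in>q. \<Oplus>\<^bsub>S\<^esub>i\<in>p. act (\<lambda>_. measure lborel (snd i \<inter> snd j)) (g (fst j)))"
    unfolding riemann_sum_eq using gq
    by (subst Int_commute) (intro S.M.finsum_cong' refl split[OF p q], auto intro!: S.M.finsum_closed)
  moreover have "\<dots> = (\<Oplus>\<^bsub>S\<^esub>i\<in>p. \<Oplus>\<^bsub>S\<^esub>j\<in>q. act (\<lambda>_. measure lborel (snd i \<inter> snd j)) (g (fst j)))"
    using fin gq by (intro finsum_swap) auto
  ultimately have "riemann_sum M S g p \<ominus>\<^bsub>S\<^esub> riemann_sum M S g q =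
      (\<Oplus>\<^bsub>S\<^esub>i\<in>p. (\<Oplus>\<^bsub>S\<^esub>j\<in>q. act (\<lambda>_. measure lborel (snd i \<inter> snd j)) (g (fst i)))
        \<ominus>\<^bsub>S\<^esub> (\<Oplus>\<^bsub>S\<^esub>j\<in>q. act (\<lambda>_. measure lborel (snd i \<inter> snd j)) (g (fst j))))"
    using fin gp gq by (simp add: finsum_diff S.M.finsum_closed)
  also have "\<dots> = (\<Oplus>\<^bsub>S\<^esub>i\<in>p. \<Oplus>\<^bsub>S\<^esub>j\<in>q. act (\<lambda>_. measure lborel (snd i \<inter> snd j)) (g (fst i) \<ominus>\<^bsub>S\<^esub> g (fst j)))"
  proof (intro S.M.finsum_cong' refl funcsetI)
    fix i assume i: "i \<in> p"
    show "(\<Oplus>\<^bsub>S\<^esub>j\<in>q. act (\<lambda>_. measure lborel (snd i \<inter> snd j)) (g (fst i) \<ominus>\<^bsub>S\<^esub> g (fst j))) \<in> carrier S"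
      using i gp gq by (intro S.M.finsum_closed) auto
    have "(\<Oplus>\<^bsub>S\<^esub>j\<in>q. act (\<lambda>_. measure lborel (snd i \<inter> snd j)) (g (fst i) \<ominus>\<^bsub>S\<^esub> g (fst j))) =
        (\<Oplus>\<^bsub>S\<^esub>j\<in>q. act (\<lambda>_. measure lborel (snd i \<inter> snd j)) (g (fst i))
          \<ominus>\<^bsub>S\<^esub> act (\<lambda>_. measure lborel (snd i \<inter> snd j)) (g (fst j)))"
      using i gp gq by (intro S.M.finsum_cong' refl act_diff_right) auto
    then show "(\<Oplus>\<^bsub>S\<^esub>j\<in>q. act (\<lambda>_. measure lborel (snd i \<inter> snd j)) (g (fst i)))
        \<ominus>\<^bsub>S\<^esub> (\<Oplus>\<^bsub>S\<^esub>j\<in>q. act (\<lambda>_. measure lborel (snd i \<inter> snd j)) (g (fst j))) =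
      (\<Oplus>\<^bsub>S\<^esub>j\<in>q. act (\<lambda>_. measure lborel (snd i \<inter> snd j)) (g (fst i) \<ominus>\<^bsub>S\<^esub> g (fst j)))"
      using i fin gp gq by (simp add: finsum_diff)
  qed
  finally show ?thesis .
qed

text \<open>The hypothesis is about genuine weighted means because these are linear, so that lengths
  can be factored out and add up to b - a; the truncation of \<open>E1\<close> enters only in the
  first inequality. If two intervals meet, each tag is within d of a common point, which explains
  the distance 2 * d.\<close>

lemma E1_riemann_sum_diff_le:
  assumes p: "mesh_below d a b p" and q: "mesh_below d a b q" and ab: "a \<le> b"
    and g: "\<And>u. u \<in> {a..b} \<Longrightarrow> g u \<in> carrier S"
    and w: "w \<in> borel_measurable M" "AE \<omega> in M. 0 \<le> w \<omega>"
    and int: "\<And>u v. u \<in> {a..b} \<Longrightarrow> v \<in> {a..b} \<Longrightarrow> integrable M (\<lambda>\<omega>. w \<omega> * nr (g u \<ominus>\<^bsub>S\<^esub> g v) \<omega>)"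
    and e: "\<And>u v. u \<in> {a..b} \<Longrightarrow> v \<in> {a..b} \<Longrightarrow> \<bar>u - v\<bar> < 2 * d \<Longrightarrow>
      (\<integral>\<omega>. w \<omega> * nr (g u \<ominus>\<^bsub>S\<^esub> g v) \<omega> \<partial>M) \<le> e"
  shows "E1 (\<lambda>\<omega>. w \<omega> * nr (riemann_sum M S g p \<ominus>\<^bsub>S\<^esub> riemann_sum M S g q) \<omega>) \<le> e * (b - a)"
proof -
  let ?D = "riemann_sum M S g p \<ominus>\<^bsub>S\<^esub> riemann_sum M S g q"
  let ?m = "\<lambda>i j. measure lborel (snd i \<inter> snd j)"
  note fin = mesh_below_finite[OF p] mesh_below_finite[OF q]
  have tp: "fst i \<in> {a..b}" if "i \<in> p" for i using mesh_below_tag(1)[OF p that] .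
  have tq: "fst i \<in> {a..b}" if "i \<in> q" for i using mesh_below_tag(1)[OF q that] .
  have gp: "g (fst i) \<in> carrier S" if "i \<in> p" for i using tp[OF that] g by blast
  have gq: "g (fst j) \<in> carrier S" if "j \<in> q" for j using tq[OF that] g by blast
  have D: "?D \<in> carrier S" using gp gq by (intro S.M.minus_closed riemann_sum_closed) auto
  have common: "?D = (\<Oplus>\<^bsub>S\<^esub>i\<in>p. \<Oplus>\<^bsub>S\<^esub>j\<in>q. act (\<lambda>_. ?m i j) (g (fst i) \<ominus>\<^bsub>S\<^esub> g (fst j)))"
    using g by (intro riemann_sum_common_refinement[OF p q]) auto
  have nrD: "AE \<omega> in M. nr ?D \<omega> \<le> (\<Sum>i\<in>p. \<Sum>j\<in>q. ?m i j * nr (g (fst i) \<ominus>\<^bsub>S\<^esub> g (fst j)) \<omega>)"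
  proof -
    have 1: "AE \<omega> in M. nr ?D \<omega> \<le> (\<Sum>i\<in>p. nr (\<Oplus>\<^bsub>S\<^esub>j\<in>q. act (\<lambda>_. ?m i j) (g (fst i) \<ominus>\<^bsub>S\<^esub> g (fst j))) \<omega>)"
      unfolding common using gp gq fin
      by (intro nr_finsum S.M.finsum_closed) auto
    have 2: "AE \<omega> in M. \<forall>i\<in>p. nr (\<Oplus>\<^bsub>S\<^esub>j\<in>q. act (\<lambda>_. ?m i j) (g (fst i) \<ominus>\<^bsub>S\<^esub> g (fst j))) \<omega> \<le>
        (\<Sum>j\<in>q. nr (act (\<lambda>_. ?m i j) (g (fst i) \<ominus>\<^bsub>S\<^esub> g (fst j))) \<omega>)"
      using gp gq fin by (intro AE_finite_allI nr_finsum) auto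
    have 3: "AE \<omega> in M. \<forall>i\<in>p. \<forall>j\<in>q. nr (act (\<lambda>_. ?m i j) (g (fst i) \<ominus>\<^bsub>S\<^esub> g (fst j))) \<omega> =
        ?m i j * nr (g (fst i) \<ominus>\<^bsub>S\<^esub> g (fst j)) \<omega>"
    proof (intro AE_finite_allI fin)
      fix i j assume "i \<in> p" "j \<in> q"
      then show "AE \<omega> in M. nr (act (\<lambda>_. ?m i j) (g (fst i) \<ominus>\<^bsub>S\<^esub> g (fst j))) \<omega> =
        ?m i j * nr (g (fst i) \<ominus>\<^bsub>S\<^esub> g (fst j)) \<omega>"
        using nr_act[of "\<lambda>_. ?m i j" "g (fst i) \<ominus>\<^bsub>S\<^esub> g (fst j)"] gp gq by simp
    qed
    show ?thesis using 1 2 3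
    proof eventually_elim
      case (elim \<omega>)
      note elim(1)
      also have "(\<Sum>i\<in>p. nr (\<Oplus>\<^bsub>S\<^esub>j\<in>q. act (\<lambda>_. ?m i j) (g (fst i) \<ominus>\<^bsub>S\<^esub> g (fst j))) \<omega>) \<le>
          (\<Sum>i\<in>p. \<Sum>j\<in>q. nr (act (\<lambda>_. ?m i j) (g (fst i) \<ominus>\<^bsub>S\<^esub> g (fst j))) \<omega>)"
        using elim(2) by (intro sum_mono) blast
      also have "\<dots> = (\<Sum>i\<in>p. \<Sum>j\<in>q. ?m i j * nr (g (fst i) \<ominus>\<^bsub>S\<^esub> g (fst j)) \<omega>)"
        using elim(3) by (intro sum.cong refl) blast
      finally show ?case .
    qed
  qed
  have "AE \<omega> in M. 0 \<le> w \<omega> * nr ?D \<omega>"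
    using w(2) nr_nonneg[OF D] by eventually_elim simp
  moreover have le: "AE \<omega> in M. w \<omega> * nr ?D \<omega> \<le> (\<Sum>i\<in>p. \<Sum>j\<in>q. ?m i j * (w \<omega> * nr (g (fst i) \<ominus>\<^bsub>S\<^esub> g (fst j)) \<omega>))"
    using nrD w(2)
  proof eventually_elim
    case (elim \<omega>)
    then have "w \<omega> * nr ?D \<omega> \<le> w \<omega> * (\<Sum>i\<in>p. \<Sum>j\<in>q. ?m i j * nr (g (fst i) \<ominus>\<^bsub>S\<^esub> g (fst j)) \<omega>)"
      by (intro mult_left_mono)
    then show ?case by (simp add: sum_distrib_left mult_ac)
  qed
  ultimately have "E1 (\<lambda>\<omega>. w \<omega> * nr ?D \<omega>) \<le>
      (\<integral>\<omega>. (\<Sum>i\<in>p. \<Sum>j\<in>q. ?m i j * (w \<omega> * nr (g (fst i) \<ominus>\<^bsub>S\<^esub> g (fst j)) \<omega>)) \<partial>M)"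
    unfolding E1_def using w D int tp tq
    by (intro integral_mono_AE integrable_min1 Bochner_Integration.integrable_sum integrable_mult_right)
      (auto elim: eventually_mono)
  also have "\<dots> = (\<Sum>i\<in>p. \<Sum>j\<in>q. ?m i j * (\<integral>\<omega>. w \<omega> * nr (g (fst i) \<ominus>\<^bsub>S\<^esub> g (fst j)) \<omega> \<partial>M))"
  proof -
    have i: "integrable M (\<lambda>\<omega>. ?m i j * (w \<omega> * nr (g (fst i) \<ominus>\<^bsub>S\<^esub> g (fst j)) \<omega>))" if "i \<in> p" "j \<in> q" for i j
      using int[OF tp[OF that(1)] tq[OF that(2)]] by (rule integrable_mult_right)
    have "(\<integral>\<omega>. (\<Sum>j\<in>q. ?m i j * (w \<omega> * nr (g (fst i) \<ominus>\<^bsub>S\<^esub> g (fst j)) \<omega>)) \<partial>M) =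
        (\<Sum>j\<in>q. ?m i j * (\<integral>\<omega>. w \<omega> * nr (g (fst i) \<ominus>\<^bsub>S\<^esub> g (fst j)) \<omega> \<partial>M))" if "i \<in> p" for i
      using i[OF that] by (subst Bochner_Integration.integral_sum) auto
    then show ?thesis
      using i by (subst Bochner_Integration.integral_sum) auto
  qed
  also have "\<dots> \<le> (\<Sum>i\<in>p. \<Sum>j\<in>q. ?m i j * e)"
  proof (intro sum_mono)
    fix i j assume ij: "i \<in> p" "j \<in> q"
    show "?m i j * (\<integral>\<omega>. w \<omega> * nr (g (fst i) \<ominus>\<^bsub>S\<^esub> g (fst j)) \<omega> \<partial>M) \<le> ?m i j * e"
    proof (cases "snd i \<inter> snd j = {}")
      case False
      then obtain x where x: "x \<in> snd i" "x \<in> snd j" by blast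
      with mesh_below_tag(5)[OF p ij(1)] mesh_below_tag(5)[OF q ij(2)]
      have "\<bar>x - fst i\<bar> < d" "\<bar>x - fst j\<bar> < d" by auto
      then have "\<bar>fst i - fst j\<bar> < 2 * d" by linarith
      with e tp tq ij show ?thesis by (intro mult_left_mono) auto
    qed auto
  qed
  also have "\<dots> = e * (\<Sum>i\<in>p. \<Sum>j\<in>q. ?m i j)"
    by (simp add: sum_distrib_left sum_distrib_right mult.commute)
  also have "(\<Sum>i\<in>p. \<Sum>j\<in>q. ?m i j) = (\<Sum>i\<in>p. measure lborel (snd i))"
  proof (intro sum.cong refl)
    fix i assume "i \<in> p"
    with mesh_below_tag(2,6)[OF p this] q show "(\<Sum>j\<in>q. ?m i j) = measure lborel (snd i)"
      using sum_content_Int_tagged_division by (metis mesh_below_def)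
  qed
  also have "\<dots> = b - a"
    using p ab by (intro sum_content_tagged_division) (auto simp: mesh_below_def)
  finally show ?thesis .
qed

text \<open>Removing the weight is multiplication by the random variable 1/w, possibly unbounded but
  fixed, so \<open>E1_mult_small\<close> gives a modulus that is uniform in x and y.\<close>

lemma mdist_small_if_weighted_small:
  assumes w: "w \<in> borel_measurable M" "AE \<omega> in M. 0 < w \<omega>" and "0 < e"
  shows "\<exists>d>0. \<forall>x\<in>carrier S. \<forall>y\<in>carrier S. E1 (\<lambda>\<omega>. w \<omega> * nr (x \<ominus>\<^bsub>S\<^esub> y) \<omega>) < d \<longrightarrow> mdist x y < e"
proof -
  have [measurable]: "w \<in> borel_measurable M" by fact
  have "AE \<omega> in M. 0 \<le> 1 / w \<omega>" using w(2) by eventually_elim simp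
  with E1_mult_small[of "\<lambda>\<omega>. 1 / w \<omega>" e] \<open>0 < e\<close> obtain d where d: "d > 0"
    "\<And>X. X \<in> borel_measurable M \<Longrightarrow> (AE \<omega> in M. 0 \<le> X \<omega>) \<Longrightarrow> E1 X < d \<Longrightarrow> E1 (\<lambda>\<omega>. 1 / w \<omega> * X \<omega>) < e"
    by auto
  show ?thesis
  proof (intro exI[of _ d] conjI ballI impI d(1))
    fix x y assume xy: "x \<in> carrier S" "y \<in> carrier S" and small: "E1 (\<lambda>\<omega>. w \<omega> * nr (x \<ominus>\<^bsub>S\<^esub> y) \<omega>) < d"
    have D: "x \<ominus>\<^bsub>S\<^esub> y \<in> carrier S" using xy by simp
    have [measurable]: "nr (x \<ominus>\<^bsub>S\<^esub> y) \<in> borel_measurable M" using D by simp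
    have "AE \<omega> in M. 0 \<le> w \<omega> * nr (x \<ominus>\<^bsub>S\<^esub> y) \<omega>" using w(2) nr_nonneg[OF D] by eventually_elim simp
    from d(2)[OF _ this small] have "E1 (\<lambda>\<omega>. 1 / w \<omega> * (w \<omega> * nr (x \<ominus>\<^bsub>S\<^esub> y) \<omega>)) < e" by simp
    also have "E1 (\<lambda>\<omega>. 1 / w \<omega> * (w \<omega> * nr (x \<ominus>\<^bsub>S\<^esub> y) \<omega>)) = mdist x y"
      unfolding mdist_def
    proof (rule E1_cong)
      show "AE \<omega> in M. 1 / w \<omega> * (w \<omega> * nr (x \<ominus>\<^bsub>S\<^esub> y) \<omega>) = nr (x \<ominus>\<^bsub>S\<^esub> y) \<omega>"
        using w(2) by eventually_elim simp
    qed simp_all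
    finally show "mdist x y < e" .
  qed
qed

text \<open>Completeness speaks of sequences, whereas the integral is a limit along the mesh filter.
  One sequence of ever finer divisions produces the candidate; the Cauchy estimate then compares an
  arbitrary fine division with a late member of this sequence.\<close>

lemma riemann_integrable:
  assumes complete: "el_complete M S nrm" and ab: "a \<le> b"
    and g: "\<And>u. u \<in> {a..b} \<Longrightarrow> g u \<in> carrier S"
    and w: "w \<in> borel_measurable M" "AE \<omega> in M. 0 < w \<omega>"
    and int: "\<And>u v. u \<in> {a..b} \<Longrightarrow> v \<in> {a..b} \<Longrightarrow> integrable M (\<lambda>\<omega>. w \<omega> * nr (g u \<ominus>\<^bsub>S\<^esub> g v) \<omega>)"
    and cont: "\<And>e. e > 0 \<Longrightarrow> \<exists>d>0. \<forall>u\<in>{a..b}. \<forall>v\<in>{a..b}. \<bar>u - v\<bar> < d \<longrightarrow>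
      (\<integral>\<omega>. w \<omega> * nr (g u \<ominus>\<^bsub>S\<^esub> g v) \<omega> \<partial>M) \<le> e"
  shows "\<exists>I. has_riemann_integral M S nrm g a b I"
proof -
  let ?R = "riemann_sum M S g"
  have R: "?R p \<in> carrier S" if "mesh_below d a b p" for d p
    using mesh_below_tag(1)[OF that] g by (intro riemann_sum_closed) blast
  have Cauchy: "\<exists>d>0. \<forall>p q. mesh_below d a b p \<longrightarrow> mesh_below d a b q \<longrightarrow> mdist (?R p) (?R q) < e" if "e > 0" for e
  proof -
    from mdist_small_if_weighted_small[OF w that] obtain e1 where e1: "e1 > 0"
      "\<And>x y. x \<in> carrier S \<Longrightarrow> y \<in> carrier S \<Longrightarrow> E1 (\<lambda>\<omega>. w \<omega> * nr (x \<ominus>\<^bsub>S\<^esub> y) \<omega>) < e1 \<Longrightarrow> mdist x y < e" by blast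
    define e2 where "e2 = e1 / (2 * (b - a + 1))"
    have e2: "e2 > 0" using \<open>0 < e1\<close> ab by (simp add: e2_def)
    have "e2 * (b - a) \<le> e1 / 2" using \<open>0 < e1\<close> ab by (simp add: e2_def field_simps)
    with \<open>0 < e1\<close> have less: "e2 * (b - a) < e1" by simp
    from cont[OF e2] obtain d where d: "d > 0" "\<And>u v. u \<in> {a..b} \<Longrightarrow> v \<in> {a..b} \<Longrightarrow> \<bar>u - v\<bar> < d \<Longrightarrow>
      (\<integral>\<omega>. w \<omega> * nr (g u \<ominus>\<^bsub>S\<^esub> g v) \<omega> \<partial>M) \<le> e2" by blast
    have w0: "AE \<omega> in M. 0 \<le> w \<omega>" using w(2) by eventually_elim simp
    show ?thesis
    proof (intro exI[of _ "d / 2"] conjI allI impI)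
      fix p q assume pq: "mesh_below (d / 2) a b p" "mesh_below (d / 2) a b q"
      have "E1 (\<lambda>\<omega>. w \<omega> * nr (?R p \<ominus>\<^bsub>S\<^esub> ?R q) \<omega>) \<le> e2 * (b - a)"
        using d(2) int g w w0 by (intro E1_riemann_sum_diff_le[OF pq ab]) auto
      with less show "mdist (?R p) (?R q) < e" using pq by (intro e1(2) R) auto
    qed (use d in simp)
  qed
  have "\<exists>p. mesh_below (1 / real (Suc n)) a b p" for n
    using ab by (intro mesh_below_exists) auto
  then obtain p where p: "\<And>n. mesh_below (1 / real (Suc n)) a b (p n)" by metis
  have ev: "\<forall>\<^sub>F n in sequentially. mesh_below d a b (p n)" if "d > 0" for d
    using filterlim_mesh_filter[OF p] that unfolding filterlim_iff eventually_mesh_filter by blast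
  have "\<exists>I. limitin (el_topology M S nrm) (\<lambda>n. ?R (p n)) I sequentially"
  proof (rule el_complete_Cauchy[OF complete R[OF p]])
    fix e :: real assume "e > 0"
    from Cauchy[OF this] obtain d where d: "d > 0"
      "\<And>p q. mesh_below d a b p \<Longrightarrow> mesh_below d a b q \<Longrightarrow> mdist (?R p) (?R q) < e" by blast
    from ev[OF d(1)] obtain N where "\<And>n. n \<ge> N \<Longrightarrow> mesh_below d a b (p n)" by (auto simp: eventually_sequentially)
    with d(2) show "\<exists>N. \<forall>m\<ge>N. \<forall>n\<ge>N. mdist (?R (p m)) (?R (p n)) < e" by blast
  qed
  then obtain I where I: "limitin (el_topology M S nrm) (\<lambda>n. ?R (p n)) I sequentially" by blast
  then have Ic: "I \<in> carrier S" by (simp add: limitin_el_iff)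
  have "limitin (el_topology M S nrm) ?R I (mesh_filter a b)"
    unfolding limitin_el_iff
  proof (intro conjI allI impI Ic)
    fix e :: real assume "e > 0"
    then have "e / 2 > 0" by simp
    from Cauchy[OF this] obtain d where d: "d > 0"
      "\<And>p q. mesh_below d a b p \<Longrightarrow> mesh_below d a b q \<Longrightarrow> mdist (?R p) (?R q) < e / 2" by blast
    have "\<forall>\<^sub>F n in sequentially. ?R (p n) \<in> carrier S \<and> mdist (?R (p n)) I < e / 2"
      using I \<open>e / 2 > 0\<close> unfolding limitin_el_iff by blast
    then have "\<forall>\<^sub>F n in sequentially. mesh_below d a b (p n) \<and> mdist (?R (p n)) I < e / 2"
      using ev[OF d(1)] by eventually_elim auto
    then obtain n where n: "mesh_below d a b (p n)" "mdist (?R (p n)) I < e / 2"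
      by (auto simp: eventually_sequentially)
    show "\<forall>\<^sub>F q in mesh_filter a b. ?R q \<in> carrier S \<and> mdist (?R q) I < e"
      unfolding eventually_mesh_filter
    proof (intro exI[of _ d] conjI allI impI d(1))
      fix q assume q: "mesh_below d a b q"
      show "?R q \<in> carrier S" using R[OF q] .
      have "mdist (?R q) I \<le> mdist (?R q) (?R (p n)) + mdist (?R (p n)) I"
        by (intro mdist_triangle R[OF q] R[OF p] Ic)
      with d(2)[OF q n(1)] n(2) show "mdist (?R q) I < e" by simp
    qed
  qed
  then show ?thesis by (auto simp: has_riemann_integral_def)
qed

lemma riemann_integral_unique:
  assumes "has_riemann_integral M S nrm g a b I" "a \<le> b"
  shows "riemann_integral M S nrm g a b = I"
  unfolding riemann_integral_def using assms mesh_filter_neq_bot[OF assms(2)]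
  by (intro the_equality) (auto simp: has_riemann_integral_def intro: limitin_el_unique)

lemma has_riemann_integral_sequence:
  assumes "has_riemann_integral M S nrm g a b I" "\<And>n. mesh_below (1 / real (Suc n)) a b (p n)"
  shows "limitin (el_topology M S nrm) (\<lambda>n. riemann_sum M S g (p n)) I sequentially"
  using assms(1) filterlim_mesh_filter[OF assms(2)]
  unfolding has_riemann_integral_def limitin_el_iff filterlim_iff by blast

end

section \<open>Almost sure estimates for Riemann integrals\<close>

lemma power_le_fact_exp:
  fixes x :: real
  assumes "0 \<le> x"
  shows "x ^ k \<le> fact k * exp x"
proof -
  \<comment> \<open>For nonnegative x every term and the Maclaurin remainder are nonnegative, so one
    term is bounded by the whole.\<close>
  obtain t where t: "exp x = (\<Sum>m<Suc k. x ^ m / fact m) + (exp t / fact (Suc k)) * x ^ Suc k"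
    using Maclaurin_exp_le[of x "Suc k"] by blast
  have "x ^ k / fact k \<le> (\<Sum>m<Suc k. x ^ m / fact m)"
    using assms by (intro member_le_sum) auto
  also have "\<dots> \<le> exp x" unfolding t using assms by simp
  finally show ?thesis by (simp add: field_simps)
qed

text \<open>Half of the decay pays for the power: apply the preceding bound to \<eta> s/2 and keep
  the other half for integration.\<close>

lemma power_mult_exp_le:
  fixes s :: real
  assumes "0 \<le> s" "0 < \<eta>"
  shows "s ^ k * exp (- (\<eta> * s)) \<le> fact k * (2 / \<eta>) ^ k * exp (- (\<eta> / 2 * s))"
proof -
  have "(\<eta> / 2 * s) ^ k \<le> fact k * exp (\<eta> / 2 * s)"
    using assms by (intro power_le_fact_exp) simp
  then have "(2 / \<eta>) ^ k * (\<eta> / 2 * s) ^ k * exp (- (\<eta> * s)) \<le>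
      (2 / \<eta>) ^ k * (fact k * exp (\<eta> / 2 * s)) * exp (- (\<eta> * s))"
    using assms by (intro mult_left_mono mult_right_mono) auto
  also have "(2 / \<eta>) ^ k * (\<eta> / 2 * s) ^ k = s ^ k"
    using assms by (simp add: power_mult_distrib[symmetric])
  also have "(2 / \<eta>) ^ k * (fact k * exp (\<eta> / 2 * s)) * exp (- (\<eta> * s)) =
      fact k * (2 / \<eta>) ^ k * (exp (\<eta> / 2 * s) * exp (- (\<eta> * s)))" by simp
  also have "exp (\<eta> / 2 * s) * exp (- (\<eta> * s)) = exp (- (\<eta> / 2 * s))"
    by (simp add: exp_add[symmetric])
  finally show ?thesis .
qed

lemma integral_exp_le:
  fixes A \<eta> :: real
  assumes "0 < \<eta>" "a \<le> b" "0 \<le> A"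
  shows "integral {a..b} (\<lambda>s. A * exp (- (\<eta> * s))) \<le> A / \<eta> * exp (- (\<eta> * a))"
proof -
  let ?F = "\<lambda>s. - (A / \<eta>) * exp (- (\<eta> * s))"
  have I: "((\<lambda>s. A * exp (- (\<eta> * s))) has_integral (?F b - ?F a)) {a..b}"
    using assms
    by (intro fundamental_theorem_of_calculus)
      (auto intro!: derivative_eq_intros simp: has_real_derivative_iff_has_vector_derivative[symmetric])
  have "0 \<le> A / \<eta> * exp (- (\<eta> * b))" using assms by simp
  then show ?thesis unfolding integral_unique[OF I] by simp
qed

lemma abs_exp_second_order_le:
  fixes x :: real
  shows "\<bar>exp x - 1 - x\<bar> \<le> x\<^sup>2 / 2 * exp \<bar>x\<bar>"
proof -
  obtain t where t: "\<bar>t\<bar> \<le> \<bar>x\<bar>" "exp x = (\<Sum>m<2. x ^ m / fact m) + (exp t / fact 2) * x ^ 2"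
    using Maclaurin_exp_le[of x 2] by blast
  then have "exp x - 1 - x = x\<^sup>2 / 2 * exp t" by (simp add: numeral_2_eq_2)
  moreover have "0 \<le> x\<^sup>2 / 2 * exp t" by simp
  ultimately have "\<bar>exp x - 1 - x\<bar> = x\<^sup>2 / 2 * exp t" by linarith
  also have "\<dots> \<le> x\<^sup>2 / 2 * exp \<bar>x\<bar>" using t(1) by (intro mult_left_mono) auto
  finally show ?thesis .
qed

text \<open>On the nonnegative half-line \<open>exp (- x)\<close> is 1-Lipschitz with values in
  [0,1]. Keeping both bounds in one minimum matters later: with a random rate of no finite mean,
  only the truncated difference can be averaged.\<close>

lemma abs_exp_diff_le:
  fixes x y :: real
  assumes "0 \<le> x" "0 \<le> y"
  shows "\<bar>exp (- x) - exp (- y)\<bar> \<le> min 1 \<bar>x - y\<bar>"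
proof -
  have *: "\<bar>exp (- x) - exp (- y)\<bar> \<le> min 1 (y - x)" if "0 \<le> x" "x \<le> y" for x y :: real
  proof -
    have "exp (- y) = exp (- x) * exp (- (y - x))" by (simp add: exp_add[symmetric])
    then have "exp (- x) - exp (- y) = exp (- x) * (1 - exp (- (y - x)))" by (simp add: algebra_simps)
    also have "\<dots> \<le> 1 * (1 - exp (- (y - x)))" using that by (intro mult_right_mono) auto
    also have "1 - exp (- (y - x)) \<le> y - x" using exp_ge_add_one_self[of "- (y - x)"] by linarith
    finally have "exp (- x) - exp (- y) \<le> y - x" by simp
    moreover have "exp (- x) - exp (- y) \<le> 1" "exp (- y) \<le> exp (- x)"
      using that exp_le_one_iff[of "- x"] exp_gt_zero[of "- y"] by (linarith, simp)
    ultimately show ?thesis by auto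
  qed
  show ?thesis
  proof (cases "x \<le> y")
    case True then show ?thesis using *[of x y] assms by simp
  next
    case False then show ?thesis using *[of y x] assms by (simp add: abs_minus_commute)
  qed
qed

context random_normed_module
begin

section \<open>Norm bounds and linearity for Riemann integrals\<close>

lemma nr_riemann_sum_le:
  assumes "finite p" "\<And>q. q \<in> p \<Longrightarrow> g (fst q) \<in> carrier S"
    and le: "\<And>q. q \<in> p \<Longrightarrow> AE \<omega> in M. nr (g (fst q)) \<omega> \<le> \<phi> (fst q) \<omega>"
  shows "AE \<omega> in M. nr (riemann_sum M S g p) \<omega> \<le> (\<Sum>q\<in>p. measure lborel (snd q) * \<phi> (fst q) \<omega>)"
proof -
  have 1: "AE \<omega> in M. nr (riemann_sum M S g p) \<omega> \<le>
      (\<Sum>q\<in>p. nr (act (\<lambda>_. measure lborel (snd q)) (g (fst q))) \<omega>)"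
    unfolding riemann_sum_eq using assms by (intro nr_finsum) auto
  have 2: "AE \<omega> in M. \<forall>q\<in>p. nr (act (\<lambda>_. measure lborel (snd q)) (g (fst q))) \<omega> \<le>
      measure lborel (snd q) * \<phi> (fst q) \<omega>"
  proof (rule AE_finite_allI[OF assms(1)])
    fix q assume q: "q \<in> p"
    have "AE \<omega> in M. nr (act (\<lambda>_. measure lborel (snd q)) (g (fst q))) \<omega> =
        measure lborel (snd q) * nr (g (fst q)) \<omega>"
      using nr_act[of "\<lambda>_. measure lborel (snd q)" "g (fst q)"] assms(2)[OF q] by simp
    with le[OF q] show "AE \<omega> in M. nr (act (\<lambda>_. measure lborel (snd q)) (g (fst q))) \<omega> \<le>
      measure lborel (snd q) * \<phi> (fst q) \<omega>"
      by eventually_elim (simp add: mult_left_mono)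
  qed
  show ?thesis using 1 2
    by eventually_elim (meson order_trans sum_mono)
qed

lemma riemann_sum_diff:
  assumes "finite p" "\<And>q. q \<in> p \<Longrightarrow> g (fst q) \<in> carrier S" "\<And>q. q \<in> p \<Longrightarrow> h (fst q) \<in> carrier S"
  shows "riemann_sum M S (\<lambda>s. g s \<ominus>\<^bsub>S\<^esub> h s) p = riemann_sum M S g p \<ominus>\<^bsub>S\<^esub> riemann_sum M S h p"
proof -
  have "riemann_sum M S (\<lambda>s. g s \<ominus>\<^bsub>S\<^esub> h s) p = (\<Oplus>\<^bsub>S\<^esub>q\<in>p. act (\<lambda>_. measure lborel (snd q)) (g (fst q))
      \<ominus>\<^bsub>S\<^esub> act (\<lambda>_. measure lborel (snd q)) (h (fst q)))"
    unfolding riemann_sum_eq using assms by (intro S.M.finsum_cong' refl) (auto simp: act_diff_right)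
  then show ?thesis using assms by (simp add: finsum_diff riemann_sum_eq)
qed

lemma riemann_sum_act:
  assumes "finite p" "\<And>q. q \<in> p \<Longrightarrow> g (fst q) \<in> carrier S" and u: "u \<in> borel_measurable M"
  shows "riemann_sum M S (\<lambda>s. act u (g s)) p = act u (riemann_sum M S g p)"
proof -
  have "riemann_sum M S (\<lambda>s. act u (g s)) p = (\<Oplus>\<^bsub>S\<^esub>q\<in>p. act u (act (\<lambda>_. measure lborel (snd q)) (g (fst q))))"
    unfolding riemann_sum_eq using assms
    by (intro S.M.finsum_cong' refl) (auto simp: act_act mult.commute)
  then show ?thesis using assms by (simp add: act_finsum_right riemann_sum_eq)
qed

text \<open>For each s the bound holds off a null set of its own. Only the countably many tags of a
  sequence of divisions enter, and on the right the Riemann sums of \<phi> converge for almost every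
  \<omega> by continuity in s.\<close>

lemma nr_riemann_integral_le:
  assumes I: "has_riemann_integral M S nrm g a b I" and ab: "a \<le> b"
    and g: "\<And>s. s \<in> {a..b} \<Longrightarrow> g s \<in> carrier S"
    and le: "\<And>s. s \<in> {a..b} \<Longrightarrow> AE \<omega> in M. nr (g s) \<omega> \<le> \<phi> s \<omega>"
    and cont: "AE \<omega> in M. continuous_on {a..b} (\<lambda>s. \<phi> s \<omega>)"
  shows "AE \<omega> in M. nr I \<omega> \<le> integral {a..b} (\<lambda>s. \<phi> s \<omega>)"
proof -
  have "\<exists>p. mesh_below (1 / real (Suc n)) a b p" for n
    using ab by (intro mesh_below_exists) auto
  then obtain p where p: "\<And>n. mesh_below (1 / real (Suc n)) a b (p n)" by metis
  have gp: "g (fst q) \<in> carrier S" if "q \<in> p n" for q n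
    using mesh_below_tag(1)[OF p that] g by blast
  show ?thesis
  proof (rule nr_le_of_limitin[OF has_riemann_integral_sequence[OF I p]])
    show "riemann_sum M S g (p n) \<in> carrier S" for n
      using gp by (rule riemann_sum_closed)
    show "AE \<omega> in M. nr (riemann_sum M S g (p n)) \<omega> \<le> (\<Sum>q\<in>p n. measure lborel (snd q) * \<phi> (fst q) \<omega>)" for n
      using gp le mesh_below_tag(1)[OF p] by (intro nr_riemann_sum_le mesh_below_finite[OF p]) auto
    show "AE \<omega> in M. (\<lambda>n. \<Sum>q\<in>p n. measure lborel (snd q) * \<phi> (fst q) \<omega>) \<longlonglongrightarrow> integral {a..b} (\<lambda>s. \<phi> s \<omega>)"
      using cont by eventually_elim (intro riemann_sums_tendsto p ab)
  qed
qed

text \<open>Additivity of the integral over adjacent intervals is bypassed: the union of a division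
  of \<open>{a..b}\<close> and one of \<open>{b..c}\<close> is a division of \<open>{a..c}\<close>,
  and in the difference of the Riemann sums only tags in \<open>{b..c}\<close> remain.\<close>

lemma nr_riemann_integral_increment_le:
  assumes I: "has_riemann_integral M S nrm g a b I" and J: "has_riemann_integral M S nrm g a c J"
    and ab: "a \<le> b" and bc: "b \<le> c"
    and g: "\<And>s. s \<in> {a..c} \<Longrightarrow> g s \<in> carrier S"
    and le: "\<And>s. s \<in> {b..c} \<Longrightarrow> AE \<omega> in M. nr (g s) \<omega> \<le> \<phi> s \<omega>"
    and cont: "AE \<omega> in M. continuous_on {b..c} (\<lambda>s. \<phi> s \<omega>)"
  shows "AE \<omega> in M. nr (J \<ominus>\<^bsub>S\<^esub> I) \<omega> \<le> integral {b..c} (\<lambda>s. \<phi> s \<omega>)"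
proof -
  have "\<exists>p. mesh_below (1 / real (Suc n)) a b p" "\<exists>p. mesh_below (1 / real (Suc n)) b c p" for n
    using ab bc by (auto intro: mesh_below_exists)
  then obtain p q where p: "\<And>n. mesh_below (1 / real (Suc n)) a b (p n)"
    and q: "\<And>n. mesh_below (1 / real (Suc n)) b c (q n)" by metis
  have pq: "mesh_below (1 / real (Suc n)) a c (p n \<union> q n)" for n
  proof -
    have "interior {a..b} \<inter> interior {b..c} = {}" by auto
    from tagged_division_Un[OF _ _ this] p[of n] q[of n]
    have "(p n \<union> q n) tagged_division_of ({a..b} \<union> {b..c})" by (auto simp: mesh_below_def)
    also have "{a..b} \<union> {b..c} = {a..c}" using ab bc by auto
    finally show ?thesis using p[of n] q[of n] by (auto simp: mesh_below_def)
  qed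
  have gp: "g (fst r) \<in> carrier S" if "r \<in> p n \<union> q n" for r n
    using mesh_below_tag(1)[OF pq that] g by blast
  have gpq: "(\<lambda>r. act (\<lambda>_. measure lborel (snd r)) (g (fst r))) \<in> A \<rightarrow> carrier S" if "A \<subseteq> p n \<union> q n" for A n
    using gp[of _ n] that by (intro funcsetI act_closed) (simp, blast)
  have fin: "finite (p n)" "finite (q n)" for n
    using mesh_below_finite[OF p] mesh_below_finite[OF q] by blast+
  let ?R = "riemann_sum M S g"
  have R: "?R (p n) \<in> carrier S" "?R (q n - p n) \<in> carrier S" for n
    using gp by (auto intro!: riemann_sum_closed)
  \<comment> \<open>The degenerate interval at b, tagged by b, may belong to both divisions, so what
    remains is the sum over \<open>q n - p n\<close>.\<close>
  have split: "?R (p n \<union> q n) \<ominus>\<^bsub>S\<^esub> ?R (p n) = ?R (q n - p n)" for n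
  proof -
    have "?R (p n \<union> (q n - p n)) = ?R (p n) \<oplus>\<^bsub>S\<^esub> ?R (q n - p n)"
      unfolding riemann_sum_eq using fin by (intro S.M.finsum_Un_disjoint gpq[of _ n]) auto
    then have "?R (p n \<union> q n) = ?R (p n) \<oplus>\<^bsub>S\<^esub> ?R (q n - p n)" by simp
    moreover have "(?R (p n) \<oplus>\<^bsub>S\<^esub> ?R (q n - p n)) \<oplus>\<^bsub>S\<^esub> \<ominus>\<^bsub>S\<^esub> ?R (p n) = ?R (q n - p n)"
      using R[of n] by (simp add: S.M.a_ac S.M.r_neg S.M.r_neg1 S.M.r_neg2)
    ultimately show ?thesis by (simp add: a_minus_def)
  qed
  show ?thesis
  proof (rule nr_le_of_limitin)
    show "limitin (el_topology M S nrm) (\<lambda>n. ?R (q n - p n)) (J \<ominus>\<^bsub>S\<^esub> I) sequentially"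
      using limitin_el_diff[OF has_riemann_integral_sequence[OF J pq] has_riemann_integral_sequence[OF I p]]
      by (simp add: split)
    show "AE \<omega> in M. nr (?R (q n - p n)) \<omega> \<le> (\<Sum>r\<in>q n. measure lborel (snd r) * \<phi> (fst r) \<omega>)" for n
    proof -
      have le': "AE \<omega> in M. nr (g (fst r)) \<omega> \<le> \<phi> (fst r) \<omega>" if "r \<in> q n" for r
        using le mesh_below_tag(1)[OF q that] by blast
      have "AE \<omega> in M. nr (?R (q n - p n)) \<omega> \<le> (\<Sum>r\<in>q n - p n. measure lborel (snd r) * \<phi> (fst r) \<omega>)"
        using gp le' fin by (intro nr_riemann_sum_le) auto
      \<comment> \<open>\<phi> is nonnegative at the tags because it dominates a norm there; this
        allows the sum to be enlarged from \<open>q n - p n\<close> to all of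
        \<open>q n\<close>.\<close>
      moreover have "AE \<omega> in M. \<forall>r\<in>q n. 0 \<le> \<phi> (fst r) \<omega>"
      proof (rule AE_finite_allI[OF fin(2)])
        fix r assume r: "r \<in> q n"
        with gp[of r n] have "AE \<omega> in M. 0 \<le> nr (g (fst r)) \<omega>" by (intro nr_nonneg) auto
        with le'[OF r] show "AE \<omega> in M. 0 \<le> \<phi> (fst r) \<omega>" by eventually_elim linarith
      qed
      ultimately show ?thesis
      proof eventually_elim
        case (elim \<omega>)
        have "(\<Sum>r\<in>q n - p n. measure lborel (snd r) * \<phi> (fst r) \<omega>) \<le>
            (\<Sum>r\<in>q n. measure lborel (snd r) * \<phi> (fst r) \<omega>)"
          using elim(2) fin by (intro sum_mono2) auto
        with elim(1) show ?case by linarith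
      qed
    qed
    show "AE \<omega> in M. (\<lambda>n. \<Sum>r\<in>q n. measure lborel (snd r) * \<phi> (fst r) \<omega>) \<longlonglongrightarrow> integral {b..c} (\<lambda>s. \<phi> s \<omega>)"
      using cont by eventually_elim (intro riemann_sums_tendsto q bc)
  qed (rule R)
qed

lemma has_riemann_integral_diff:
  assumes I: "has_riemann_integral M S nrm g a b I" and J: "has_riemann_integral M S nrm h a b J"
    and g: "\<And>s. s \<in> {a..b} \<Longrightarrow> g s \<in> carrier S" and h: "\<And>s. s \<in> {a..b} \<Longrightarrow> h s \<in> carrier S"
  shows "has_riemann_integral M S nrm (\<lambda>s. g s \<ominus>\<^bsub>S\<^esub> h s) a b (I \<ominus>\<^bsub>S\<^esub> J)"
proof -
  \<comment> \<open>The mesh 1 is an arbitrary choice: the point is that p divides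
    \<open>{a..b}\<close>, so that g and h are evaluated where their values lie in the
    carrier.\<close>
  have "\<forall>\<^sub>F p in mesh_filter a b. mesh_below 1 a b p"
    unfolding eventually_mesh_filter by (intro exI[of _ 1]) auto
  then have "\<forall>\<^sub>F p in mesh_filter a b. riemann_sum M S g p \<ominus>\<^bsub>S\<^esub> riemann_sum M S h p =
      riemann_sum M S (\<lambda>s. g s \<ominus>\<^bsub>S\<^esub> h s) p"
  proof eventually_elim
    case (elim p)
    show ?case using mesh_below_tag(1)[OF elim] g h
      by (intro riemann_sum_diff[symmetric] mesh_below_finite[OF elim]) auto
  qed
  with limitin_el_diff[OF I[unfolded has_riemann_integral_def] J[unfolded has_riemann_integral_def]]
  show ?thesis unfolding has_riemann_integral_def by (rule limitin_transform_eventually[rotated])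
qed

lemma has_riemann_integral_act:
  assumes I: "has_riemann_integral M S nrm g a b I"
    and g: "\<And>s. s \<in> {a..b} \<Longrightarrow> g s \<in> carrier S" and u: "u \<in> borel_measurable M"
  shows "has_riemann_integral M S nrm (\<lambda>s. act u (g s)) a b (act u I)"
proof -
  have "\<forall>\<^sub>F p in mesh_filter a b. mesh_below 1 a b p"
    unfolding eventually_mesh_filter by (intro exI[of _ 1]) auto
  then have "\<forall>\<^sub>F p in mesh_filter a b. act u (riemann_sum M S g p) = riemann_sum M S (\<lambda>s. act u (g s)) p"
  proof eventually_elim
    case (elim p)
    show ?case using mesh_below_tag(1)[OF elim] g u
      by (intro riemann_sum_act[symmetric] mesh_below_finite[OF elim]) auto
  qed
  with limitin_el_act[OF I[unfolded has_riemann_integral_def] u]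
  show ?thesis unfolding has_riemann_integral_def by (rule limitin_transform_eventually[rotated])
qed

end

section \<open>Weighted Laplace integrals\<close>

locale bounded_el_continuous = random_normed_module M S nrm
  for M :: "'w measure"
    and S :: "(('w \<Rightarrow> 'k::{real_normed_field, second_countable_topology}) set, 's, 'm) module_scheme"
    and nrm :: "'s \<Rightarrow> ('w \<Rightarrow> real) set" +
  fixes f :: "real \<Rightarrow> 's" and B :: "('w \<Rightarrow> real) set"
  assumes complete: "el_complete M S nrm"
    and continuous: "continuous_map (top_of_set {0..}) (el_topology M S nrm) f"
    and bound_nonneg: "B \<in> L0_nonneg M"
    and bounded: "0 \<le> s \<Longrightarrow> L0_le M (nrm (f s)) B"
begin

section \<open>The weight and the continuity of \<open>f\<close> in weighted mean\<close>

definition bd :: "'w \<Rightarrow> real" where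
  "bd \<omega> = max 0 (L0_rep B \<omega>)"

lemma bd_measurable [measurable, simp]: "bd \<in> borel_measurable M"
proof -
  have [measurable]: "L0_rep B \<in> borel_measurable M"
    using bound_nonneg by (intro L0_rep_measurable) (auto simp: L0_nonneg_def)
  show ?thesis unfolding bd_def[abs_def] by measurable
qed

lemma bd_nonneg [simp]: "0 \<le> bd \<omega>"
  by (simp add: bd_def)

definition wt :: "'w \<Rightarrow> real" where
  "wt \<omega> = 1 / (1 + bd \<omega>)"

lemma wt_measurable [measurable, simp]: "wt \<in> borel_measurable M"
  unfolding wt_def[abs_def] by measurable

lemma wt_pos: "0 < wt \<omega>" and wt_le_1: "wt \<omega> \<le> 1" and wt_bd_le_1: "wt \<omega> * bd \<omega> \<le> 1"
  using add_pos_nonneg[OF zero_less_one bd_nonneg[of \<omega>]] by (auto simp: wt_def divide_simps)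

lemma f_closed [simp]: "0 \<le> s \<Longrightarrow> f s \<in> carrier S"
  using continuous by (auto simp: continuous_map_def Pi_iff)

lemma nr_f_le: "0 \<le> s \<Longrightarrow> AE \<omega> in M. nr (f s) \<omega> \<le> bd \<omega>"
  using bounded[of s] unfolding L0_le_def nr_def bd_def by (auto elim: eventually_mono)

text \<open>The left side is at most 2 by the weight and at most the norm since the weight is at
  most 1. This turns continuity in probability into continuity in mean, although the bound
  \<open>B\<close> may have infinite expectation.\<close>

lemma nr_f_diff_le:
  assumes "0 \<le> u" "0 \<le> v"
  shows "AE \<omega> in M. wt \<omega> * nr (f u \<ominus>\<^bsub>S\<^esub> f v) \<omega> \<le> 2 * min 1 (nr (f u \<ominus>\<^bsub>S\<^esub> f v) \<omega>)"
  using nr_f_le[OF assms(1)] nr_f_le[OF assms(2)] nr_diff[OF f_closed[OF assms(1)] f_closed[OF assms(2)]]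
    nr_nonneg[OF S.M.minus_closed[OF f_closed[OF assms(1)] f_closed[OF assms(2)]]]
proof eventually_elim
  case (elim \<omega>)
  have "wt \<omega> * nr (f u \<ominus>\<^bsub>S\<^esub> f v) \<omega> \<le> wt \<omega> * (2 * bd \<omega>)"
    using elim wt_pos[of \<omega>] by (intro mult_left_mono) auto
  moreover have "wt \<omega> * nr (f u \<ominus>\<^bsub>S\<^esub> f v) \<omega> \<le> 1 * nr (f u \<ominus>\<^bsub>S\<^esub> f v) \<omega>"
    using elim wt_le_1 by (intro mult_right_mono) auto
  ultimately show ?case using wt_bd_le_1[of \<omega>] elim(4) by (auto simp: min_def)
qed

lemma f_continuous_at:
  assumes "0 \<le> x" "0 < e"
  shows "\<exists>d>0. \<forall>y\<ge>0. \<bar>y - x\<bar> < d \<longrightarrow> mdist (f y) (f x) < e"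
proof -
  have "openin (top_of_set {0..}) {y \<in> topspace (top_of_set {0::real..}). f y \<in> el.mball (f x) e}"
    using continuous unfolding el_topology_eq by (rule openin_continuous_map_preimage) simp
  moreover have "x \<in> {y \<in> topspace (top_of_set {0::real..}). f y \<in> el.mball (f x) e}"
    using assms el.zero[of "f x" "f x"] by simp
  ultimately obtain d where d: "d > 0" "ball x d \<inter> {0..} \<subseteq> {y \<in> topspace (top_of_set {0::real..}). f y \<in> el.mball (f x) e}"
    unfolding openin_contains_ball by blast
  show ?thesis
  proof (intro exI[of _ d] conjI allI impI d(1))
    fix y assume "0 \<le> y" "\<bar>y - x\<bar> < d"
    then have "y \<in> ball x d \<inter> {0..}" by (auto simp: dist_real_def)
    with d(2) have "f y \<in> el.mball (f x) e" by blast
    with \<open>0 \<le> x\<close> \<open>0 \<le> y\<close> show "mdist (f y) (f x) < e" by (simp add: mdist_commute)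
  qed
qed

text \<open>Heine--Cantor by sequential compactness: two sequences in \<open>{0..L}\<close> whose
  distance vanishes have subsequences with the same limit x, and continuity at x contradicts the gap
  e.\<close>

lemma f_uniformly_continuous:
  assumes "0 < e"
  shows "\<exists>d>0. \<forall>u\<in>{0..L}. \<forall>v\<in>{0..L}. \<bar>u - v\<bar> < d \<longrightarrow> mdist (f u) (f v) < e"
proof (rule ccontr)
  assume neg: "\<not> ?thesis"
  have "\<exists>u v. u \<in> {0..L} \<and> v \<in> {0..L} \<and> \<bar>u - v\<bar> < 1 / real (Suc n) \<and> e \<le> mdist (f u) (f v)" for n
  proof -
    have "0 < 1 / real (Suc n)" by simp
    with neg have "\<not> (\<forall>u\<in>{0..L}. \<forall>v\<in>{0..L}. \<bar>u - v\<bar> < 1 / real (Suc n) \<longrightarrow> mdist (f u) (f v) < e)"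
      by blast
    then show ?thesis by (meson not_le)
  qed
  then obtain u v where uv: "\<And>n. u n \<in> {0..L}" "\<And>n. v n \<in> {0..L}"
    "\<And>n. \<bar>u n - v n\<bar> < 1 / real (Suc n)" "\<And>n. e \<le> mdist (f (u n)) (f (v n))" by metis
  have "seq_compact {0..L}" by (simp add: compact_imp_seq_compact)
  with uv(1) obtain x r where x: "x \<in> {0..L}" "strict_mono r" "(\<lambda>n. u (r n)) \<longlonglongrightarrow> x"
    unfolding seq_compact_def o_def by blast
  have "(\<lambda>n. u n - v n) \<longlonglongrightarrow> 0"
  proof (rule Lim_null_comparison[OF _ LIMSEQ_inverse_real_of_nat])
    show "\<forall>\<^sub>F n in sequentially. norm (u n - v n) \<le> inverse (real (Suc n))"
      using uv(3) by (intro always_eventually allI) (simp add: inverse_eq_divide less_imp_le)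
  qed
  then have "(\<lambda>n. u (r n) - v (r n)) \<longlonglongrightarrow> 0"
    using LIMSEQ_subseq_LIMSEQ[OF _ x(2)] by (auto simp: o_def)
  from tendsto_diff[OF x(3) this] have v: "(\<lambda>n. v (r n)) \<longlonglongrightarrow> x" by simp
  from f_continuous_at[of x "e / 2"] x(1) \<open>0 < e\<close> obtain d where d: "d > 0"
    "\<And>y. 0 \<le> y \<Longrightarrow> \<bar>y - x\<bar> < d \<Longrightarrow> mdist (f y) (f x) < e / 2" by auto
  have "\<forall>\<^sub>F n in sequentially. \<bar>u (r n) - x\<bar> < d \<and> \<bar>v (r n) - x\<bar> < d"
    using tendstoD[OF x(3) d(1)] tendstoD[OF v d(1)] by eventually_elim (auto simp: dist_real_def)
  then obtain n where n: "\<bar>u (r n) - x\<bar> < d" "\<bar>v (r n) - x\<bar> < d" by (auto simp: eventually_sequentially)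
  have nn: "0 \<le> u (r n)" "0 \<le> v (r n)" "0 \<le> x" using uv(1,2)[of "r n"] x(1) by auto
  have "mdist (f (u (r n))) (f (v (r n))) \<le> mdist (f (u (r n))) (f x) + mdist (f x) (f (v (r n)))"
    using nn by (intro mdist_triangle) auto
  also have "\<dots> < e" using d(2)[of "u (r n)"] d(2)[of "v (r n)"] n nn by (simp add: mdist_commute[of "f x"])
  finally show False using uv(4)[of "r n"] by simp
qed

section \<open>The Laplace kernels and their Riemann integrability\<close>

definition kern :: "nat \<Rightarrow> ('w \<Rightarrow> real) \<Rightarrow> real \<Rightarrow> 'w \<Rightarrow> real" where
  "kern k \<eta> s \<omega> = (- s) ^ k * exp (- (\<eta> \<omega> * s))"

text \<open>\<open>kern k \<eta> s\<close> is the k-th derivative of exp(-\<eta> s) with respect to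
  \<eta>, its sign included, so these are the formal derivatives of the Laplace integrand.\<close>

definition integrand :: "nat \<Rightarrow> ('w \<Rightarrow> real) \<Rightarrow> real \<Rightarrow> 's" where
  "integrand k \<eta> s = act (kern k \<eta> s) (f s)"

lemma kern_measurable [measurable (raw), simp]:
  assumes [measurable]: "\<eta> \<in> borel_measurable M"
  shows "kern k \<eta> s \<in> borel_measurable M"
  unfolding kern_def[abs_def] by simp

lemma integrand_closed [simp]: "\<eta> \<in> borel_measurable M \<Longrightarrow> 0 \<le> s \<Longrightarrow> integrand k \<eta> s \<in> carrier S"
  by (simp add: integrand_def)

lemma nr_act_f_le:
  assumes "0 \<le> s" "u \<in> borel_measurable M"
  shows "AE \<omega> in M. nr (act u (f s)) \<omega> \<le> \<bar>u \<omega>\<bar> * bd \<omega>"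
  using nr_act[OF assms(2) f_closed[OF assms(1)]] nr_f_le[OF assms(1)]
  by eventually_elim (simp add: mult_left_mono)

text \<open>First \<open>f\<close> moves while the kernel is fixed, then the kernel moves while
  \<open>f v\<close> is fixed; in the kernel the power and the exponential are varied separately.
  Each resulting term is deterministic or contains a minimum with 1, hence has a finite mean
  whatever the size of \<eta>.\<close>

lemma integrand_diff_le:
  assumes \<eta>: "\<eta> \<in> borel_measurable M" "AE \<omega> in M. 0 < \<eta> \<omega>"
    and uv: "u \<in> {0..L}" "v \<in> {0..L}"
  shows "AE \<omega> in M. wt \<omega> * nr (integrand k \<eta> u \<ominus>\<^bsub>S\<^esub> integrand k \<eta> v) \<omega> \<le>
      2 * L ^ k * min 1 (nr (f u \<ominus>\<^bsub>S\<^esub> f v) \<omega>) + \<bar>u ^ k - v ^ k\<bar> + L ^ k * min 1 (\<eta> \<omega> * \<bar>u - v\<bar>)"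
proof -
  have nn: "0 \<le> u" "0 \<le> v" using uv by auto
  have fu: "f u \<in> carrier S" and fv: "f v \<in> carrier S" using nn by auto
  have D: "f u \<ominus>\<^bsub>S\<^esub> f v \<in> carrier S" using fu fv by simp
  have m: "kern k \<eta> s \<in> borel_measurable M" "(\<lambda>\<omega>. kern k \<eta> u \<omega> - kern k \<eta> v \<omega>) \<in> borel_measurable M" for s
    using borel_measurable_diff[OF kern_measurable[OF \<eta>(1)] kern_measurable[OF \<eta>(1)]] \<eta>(1) by simp_all
  have "integrand k \<eta> u \<ominus>\<^bsub>S\<^esub> integrand k \<eta> v =
      (act (kern k \<eta> u) (f u) \<ominus>\<^bsub>S\<^esub> act (kern k \<eta> u) (f v)) \<oplus>\<^bsub>S\<^esub> (act (kern k \<eta> u) (f v) \<ominus>\<^bsub>S\<^esub> act (kern k \<eta> v) (f v))"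
    unfolding integrand_def using m fu fv by (intro diff_telescope) auto
  also have "\<dots> = act (kern k \<eta> u) (f u \<ominus>\<^bsub>S\<^esub> f v) \<oplus>\<^bsub>S\<^esub> act (\<lambda>\<omega>. kern k \<eta> u \<omega> - kern k \<eta> v \<omega>) (f v)"
    using m fu fv by (simp add: act_diff_right act_diff_left)
  finally have eq: "integrand k \<eta> u \<ominus>\<^bsub>S\<^esub> integrand k \<eta> v =
      act (kern k \<eta> u) (f u \<ominus>\<^bsub>S\<^esub> f v) \<oplus>\<^bsub>S\<^esub> act (\<lambda>\<omega>. kern k \<eta> u \<omega> - kern k \<eta> v \<omega>) (f v)" .
  have "AE \<omega> in M. nr (integrand k \<eta> u \<ominus>\<^bsub>S\<^esub> integrand k \<eta> v) \<omega> \<le>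
      nr (act (kern k \<eta> u) (f u \<ominus>\<^bsub>S\<^esub> f v)) \<omega> + nr (act (\<lambda>\<omega>. kern k \<eta> u \<omega> - kern k \<eta> v \<omega>) (f v)) \<omega>"
    unfolding eq using m D fv by (intro nr_add) auto
  moreover have "AE \<omega> in M. nr (act (kern k \<eta> u) (f u \<ominus>\<^bsub>S\<^esub> f v)) \<omega> = \<bar>kern k \<eta> u \<omega>\<bar> * nr (f u \<ominus>\<^bsub>S\<^esub> f v) \<omega>"
    using m D by (intro nr_act) auto
  moreover have "AE \<omega> in M. nr (act (\<lambda>\<omega>. kern k \<eta> u \<omega> - kern k \<eta> v \<omega>) (f v)) \<omega> \<le> \<bar>kern k \<eta> u \<omega> - kern k \<eta> v \<omega>\<bar> * bd \<omega>"
    using m nn by (intro nr_act_f_le) auto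
  moreover note nr_f_diff_le[OF nn] nr_nonneg[OF D] \<eta>(2)
  ultimately show ?thesis
  proof eventually_elim
    case (elim \<omega>)
    let ?n = "nr (f u \<ominus>\<^bsub>S\<^esub> f v) \<omega>" and ?w = "wt \<omega>"
    have w: "0 \<le> ?w" using wt_pos[of \<omega>] by simp
    have e1: "\<bar>kern k \<eta> u \<omega>\<bar> \<le> L ^ k"
    proof -
      have "\<bar>kern k \<eta> u \<omega>\<bar> = u ^ k * exp (- (\<eta> \<omega> * u))" using nn by (simp add: kern_def abs_mult power_abs)
      also have "\<dots> \<le> L ^ k * 1" using uv nn elim(6) by (intro mult_mono power_mono) auto
      finally show ?thesis by simp
    qed
    have e2: "\<bar>kern k \<eta> u \<omega> - kern k \<eta> v \<omega>\<bar> \<le> \<bar>u ^ k - v ^ k\<bar> + L ^ k * min 1 (\<eta> \<omega> * \<bar>u - v\<bar>)"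
    proof -
      let ?a = "exp (- (\<eta> \<omega> * u))" and ?b = "exp (- (\<eta> \<omega> * v))"
      have "kern k \<eta> u \<omega> - kern k \<eta> v \<omega> = (- 1) ^ k * ((u ^ k - v ^ k) * ?a + v ^ k * (?a - ?b))"
        unfolding kern_def power_minus[of u] power_minus[of v] by (simp add: algebra_simps)
      then have "\<bar>kern k \<eta> u \<omega> - kern k \<eta> v \<omega>\<bar> = \<bar>(u ^ k - v ^ k) * ?a + v ^ k * (?a - ?b)\<bar>"
        by (simp add: abs_mult power_abs)
      also have "\<dots> \<le> \<bar>u ^ k - v ^ k\<bar> * ?a + v ^ k * \<bar>?a - ?b\<bar>"
        using nn by (intro order_trans[OF abs_triangle_ineq]) (simp add: abs_mult)
      also have "\<dots> \<le> \<bar>u ^ k - v ^ k\<bar> * 1 + L ^ k * min 1 \<bar>\<eta> \<omega> * u - \<eta> \<omega> * v\<bar>"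
        using nn uv elim(6) by (intro add_mono mult_mono power_mono abs_exp_diff_le) auto
      also have "\<bar>\<eta> \<omega> * u - \<eta> \<omega> * v\<bar> = \<eta> \<omega> * \<bar>u - v\<bar>"
        using elim(6) by (simp add: right_diff_distrib[symmetric] abs_mult)
      finally show ?thesis by simp
    qed
    have "?w * nr (integrand k \<eta> u \<ominus>\<^bsub>S\<^esub> integrand k \<eta> v) \<omega> \<le>
        ?w * (\<bar>kern k \<eta> u \<omega>\<bar> * ?n + \<bar>kern k \<eta> u \<omega> - kern k \<eta> v \<omega>\<bar> * bd \<omega>)"
      using elim(1,2,3) w by (intro mult_left_mono) linarith+
    \<comment> \<open>The single weight is used in both summands: it tames the norm of the
      difference in the first and the bound \<open>bd\<close> in the second.\<close>
    also have "\<dots> = \<bar>kern k \<eta> u \<omega>\<bar> * (?w * ?n) + \<bar>kern k \<eta> u \<omega> - kern k \<eta> v \<omega>\<bar> * (?w * bd \<omega>)"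
      by (simp add: algebra_simps)
    also have "\<dots> \<le> L ^ k * (2 * min 1 ?n) + (\<bar>u ^ k - v ^ k\<bar> + L ^ k * min 1 (\<eta> \<omega> * \<bar>u - v\<bar>)) * 1"
      using w by (intro add_mono mult_mono[OF e1 elim(4)] mult_mono[OF e2 wt_bd_le_1]) (use elim(5,6) uv in auto)
    finally show ?case by (simp add: algebra_simps)
  qed
qed

lemma integrand_weighted_integrable:
  assumes \<eta>: "\<eta> \<in> borel_measurable M" "AE \<omega> in M. 0 < \<eta> \<omega>"
    and uv: "u \<in> {0..L}" "v \<in> {0..L}"
  shows "integrable M (\<lambda>\<omega>. wt \<omega> * nr (integrand k \<eta> u \<ominus>\<^bsub>S\<^esub> integrand k \<eta> v) \<omega>)" (is "integrable M ?F")
    and "(\<integral>\<omega>. wt \<omega> * nr (integrand k \<eta> u \<ominus>\<^bsub>S\<^esub> integrand k \<eta> v) \<omega> \<partial>M) \<le>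
      2 * L ^ k * mdist (f u) (f v) + \<bar>u ^ k - v ^ k\<bar> + L ^ k * E1 (\<lambda>\<omega>. \<eta> \<omega> * \<bar>u - v\<bar>)"
proof -
  have nn: "0 \<le> u" "0 \<le> v" using uv by auto
  have fu: "f u \<in> carrier S" and fv: "f v \<in> carrier S" using nn by auto
  have D: "f u \<ominus>\<^bsub>S\<^esub> f v \<in> carrier S" using fu fv by simp
  have G: "integrand k \<eta> u \<ominus>\<^bsub>S\<^esub> integrand k \<eta> v \<in> carrier S" using nn \<eta> by simp
  let ?H = "\<lambda>\<omega>. 2 * L ^ k * min 1 (nr (f u \<ominus>\<^bsub>S\<^esub> f v) \<omega>) + \<bar>u ^ k - v ^ k\<bar> + L ^ k * min 1 (\<eta> \<omega> * \<bar>u - v\<bar>)"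
  have \<eta>0: "AE \<omega> in M. 0 \<le> \<eta> \<omega> * \<bar>u - v\<bar>" using \<eta>(2) by eventually_elim simp
  have i1: "integrable M (\<lambda>\<omega>. min 1 (nr (f u \<ominus>\<^bsub>S\<^esub> f v) \<omega>))"
    using D by (intro integrable_min1 nr_nonneg) auto
  have i2: "integrable M (\<lambda>\<omega>. min 1 (\<eta> \<omega> * \<bar>u - v\<bar>))"
    using \<eta>(1) by (intro integrable_min1 \<eta>0) auto
  have H: "integrable M ?H" using i1 i2 by simp
  note le = integrand_diff_le[OF \<eta> uv, of k]
  show F: "integrable M ?F"
  proof (rule Bochner_Integration.integrable_bound[OF H])
    show "AE \<omega> in M. norm (?F \<omega>) \<le> norm (?H \<omega>)"
      using le nr_nonneg[OF G]
    proof eventually_elim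
      case (elim \<omega>)
      then have "0 \<le> ?F \<omega>" using wt_pos[of \<omega>] by simp
      with elim(1) show ?case by simp
    qed
  qed (use G in measurable)
  have "(\<integral>\<omega>. ?F \<omega> \<partial>M) \<le> (\<integral>\<omega>. ?H \<omega> \<partial>M)"
    using le by (intro integral_mono_AE F H)
  also have "\<dots> = 2 * L ^ k * mdist (f u) (f v) + \<bar>u ^ k - v ^ k\<bar> + L ^ k * E1 (\<lambda>\<omega>. \<eta> \<omega> * \<bar>u - v\<bar>)"
    using i1 i2 by (simp add: E1_def mdist_def prob_space)
  finally show "(\<integral>\<omega>. ?F \<omega> \<partial>M) \<le> \<dots>" .
qed

lemma riemann_integrable_integrand:
  assumes \<eta>: "\<eta> \<in> borel_measurable M" "AE \<omega> in M. 0 < \<eta> \<omega>" and "0 \<le> L"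
  shows "\<exists>I. has_riemann_integral M S nrm (integrand k \<eta>) 0 L I"
proof (rule riemann_integrable[OF complete, where w = wt])
  fix e :: real assume e: "0 < e"
  \<comment> \<open>c dominates the three coefficients 2 L^k, 1 and L^k of the estimate, each of
    which is allowed a third of e.\<close>
  define c where "c = 2 * L ^ k + 1"
  have Lk: "0 \<le> L ^ k" using \<open>0 \<le> L\<close> by simp
  then have c: "0 < c" by (simp add: c_def)
  define e' where "e' = e / (3 * c)"
  have e': "0 < e'" using e c by (simp add: e'_def)
  obtain d1 where d1: "d1 > 0" "\<And>u v. u \<in> {0..L} \<Longrightarrow> v \<in> {0..L} \<Longrightarrow> \<bar>u - v\<bar> < d1 \<Longrightarrow> mdist (f u) (f v) < e'"
    using f_uniformly_continuous[OF e', of L] by blast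
  have "uniformly_continuous_on {0..L} (\<lambda>u. u ^ k)"
    by (intro compact_uniformly_continuous continuous_intros) auto
  then obtain d2 where d2: "d2 > 0" "\<And>u v. u \<in> {0..L} \<Longrightarrow> v \<in> {0..L} \<Longrightarrow> \<bar>u - v\<bar> < d2 \<Longrightarrow> \<bar>u ^ k - v ^ k\<bar> < e'"
    unfolding uniformly_continuous_on_def dist_real_def using e' by (metis abs_minus_commute)
  have \<eta>0: "AE \<omega> in M. 0 \<le> \<eta> \<omega>" using \<eta>(2) by eventually_elim simp
  from E1_mult_small[OF \<eta>(1) \<eta>0 e'] obtain d3 where d3: "d3 > 0"
    "\<And>X. X \<in> borel_measurable M \<Longrightarrow> (AE \<omega> in M. 0 \<le> X \<omega>) \<Longrightarrow> E1 X < d3 \<Longrightarrow> E1 (\<lambda>\<omega>. \<eta> \<omega> * X \<omega>) < e'" by blast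
  show "\<exists>d>0. \<forall>u\<in>{0..L}. \<forall>v\<in>{0..L}. \<bar>u - v\<bar> < d \<longrightarrow>
      (\<integral>\<omega>. wt \<omega> * nr (integrand k \<eta> u \<ominus>\<^bsub>S\<^esub> integrand k \<eta> v) \<omega> \<partial>M) \<le> e"
  proof (intro exI[of _ "min d1 (min d2 d3)"] conjI ballI impI)
    fix u v assume uv: "u \<in> {0..L}" "v \<in> {0..L}" and d: "\<bar>u - v\<bar> < min d1 (min d2 d3)"
    \<comment> \<open>The deterministic distance is treated as a constant random variable, to be
      multiplied by the unbounded rate \<eta>.\<close>
    have "E1 (\<lambda>_. \<bar>u - v\<bar>) < d3" using d by (simp add: E1_def prob_space min_less_iff_disj)
    then have 3: "E1 (\<lambda>\<omega>. \<eta> \<omega> * \<bar>u - v\<bar>) < e'" by (intro d3(2)) auto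
    have "(\<integral>\<omega>. wt \<omega> * nr (integrand k \<eta> u \<ominus>\<^bsub>S\<^esub> integrand k \<eta> v) \<omega> \<partial>M) \<le>
        2 * L ^ k * mdist (f u) (f v) + \<bar>u ^ k - v ^ k\<bar> + L ^ k * E1 (\<lambda>\<omega>. \<eta> \<omega> * \<bar>u - v\<bar>)"
      by (rule integrand_weighted_integrable[OF \<eta> uv])
    also have "\<dots> \<le> 2 * L ^ k * e' + e' + L ^ k * e'"
      using 3 d1(2)[OF uv] d2(2)[OF uv] d Lk by (intro add_mono mult_left_mono) auto
    also have "\<dots> \<le> 3 * (c * e')"
      using Lk e' by (simp add: c_def algebra_simps)
    also have "\<dots> = e" using c by (simp add: e'_def)
    finally show "(\<integral>\<omega>. wt \<omega> * nr (integrand k \<eta> u \<ominus>\<^bsub>S\<^esub> integrand k \<eta> v) \<omega> \<partial>M) \<le> e" .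
  qed (use d1 d2 d3 in auto)
qed (use \<open>0 \<le> L\<close> \<eta> wt_pos in \<open>auto intro!: integrand_weighted_integrable(1)[OF \<eta>]\<close>)

section \<open>Integrals over the half-line\<close>

definition truncated :: "nat \<Rightarrow> ('w \<Rightarrow> real) \<Rightarrow> real \<Rightarrow> 's" where
  "truncated k \<eta> L = riemann_integral M S nrm (integrand k \<eta>) 0 L"

lemma truncated:
  assumes "\<eta> \<in> borel_measurable M" "AE \<omega> in M. 0 < \<eta> \<omega>" "0 \<le> L"
  shows "has_riemann_integral M S nrm (integrand k \<eta>) 0 L (truncated k \<eta> L)"
  using riemann_integrable_integrand[OF assms] riemann_integral_unique[OF _ assms(3)]
  unfolding truncated_def by metis

lemma truncated_closed [simp]:
  assumes "\<eta> \<in> borel_measurable M" "AE \<omega> in M. 0 < \<eta> \<omega>" "0 \<le> L"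
  shows "truncated k \<eta> L \<in> carrier S"
  using truncated[OF assms] by (simp add: has_riemann_integral_def limitin_el_iff)

text \<open>After the power has consumed half of the rate, the tail of the remaining exponential is
  integrated. Since \<eta> may come arbitrarily close to 0, the bound tends to 0 with growing L only
  almost surely, without a uniform rate.\<close>

lemma truncated_increment_le:
  assumes \<eta>: "\<eta> \<in> borel_measurable M" "AE \<omega> in M. 0 < \<eta> \<omega>" and L: "0 \<le> L" "L \<le> L'"
  shows "AE \<omega> in M. nr (truncated k \<eta> L' \<ominus>\<^bsub>S\<^esub> truncated k \<eta> L) \<omega> \<le>
    fact k * (2 / \<eta> \<omega>) ^ k * bd \<omega> / (\<eta> \<omega> / 2) * exp (- (\<eta> \<omega> / 2 * L))"
proof -
  let ?\<phi> = "\<lambda>s \<omega>. fact k * (2 / \<eta> \<omega>) ^ k * bd \<omega> * exp (- (\<eta> \<omega> / 2 * s))"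
  have L': "0 \<le> L'" using L by simp
  have "AE \<omega> in M. nr (truncated k \<eta> L' \<ominus>\<^bsub>S\<^esub> truncated k \<eta> L) \<omega> \<le> integral {L..L'} (\<lambda>s. ?\<phi> s \<omega>)"
  proof (rule nr_riemann_integral_increment_le[OF truncated[OF \<eta> L(1)] truncated[OF \<eta> L'] L])
    fix s assume "s \<in> {L..L'}"
    with L have s: "0 \<le> s" by simp
    have "AE \<omega> in M. nr (integrand k \<eta> s) \<omega> \<le> \<bar>kern k \<eta> s \<omega>\<bar> * bd \<omega>"
      unfolding integrand_def using s \<eta> by (intro nr_act_f_le) auto
    with \<eta>(2) show "AE \<omega> in M. nr (integrand k \<eta> s) \<omega> \<le> ?\<phi> s \<omega>"
    proof eventually_elim
      case (elim \<omega>)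
      have "\<bar>kern k \<eta> s \<omega>\<bar> = s ^ k * exp (- (\<eta> \<omega> * s))" using s by (simp add: kern_def abs_mult power_abs)
      also have "\<dots> \<le> fact k * (2 / \<eta> \<omega>) ^ k * exp (- (\<eta> \<omega> / 2 * s))"
        using s elim by (intro power_mult_exp_le) auto
      finally have "\<bar>kern k \<eta> s \<omega>\<bar> * bd \<omega> \<le> fact k * (2 / \<eta> \<omega>) ^ k * exp (- (\<eta> \<omega> / 2 * s)) * bd \<omega>"
        by (intro mult_right_mono) auto
      with elim show ?case by (simp add: mult_ac)
    qed
  qed (use \<eta> in \<open>auto intro!: continuous_intros\<close>)
  with \<eta>(2) show ?thesis
  proof eventually_elim
    case (elim \<omega>)
    have "integral {L..L'} (\<lambda>s. ?\<phi> s \<omega>) \<le>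
        fact k * (2 / \<eta> \<omega>) ^ k * bd \<omega> / (\<eta> \<omega> / 2) * exp (- (\<eta> \<omega> / 2 * L))"
      using elim L by (intro integral_exp_le) auto
    with elim show ?case by linarith
  qed
qed

text \<open>Completeness is applied to integer endpoints. Any two real endpoints beyond N give
  values within \<open>E1 (\<rho> N)\<close> of each other, and this carries the limit over to all
  real L.\<close>

lemma truncated_converges:
  assumes \<eta>: "\<eta> \<in> borel_measurable M" "AE \<omega> in M. 0 < \<eta> \<omega>"
  shows "\<exists>I. limitin (el_topology M S nrm) (truncated k \<eta>) I at_top"
proof -
  let ?T = "truncated k \<eta>"
  have [measurable]: "\<eta> \<in> borel_measurable M" by fact
  define \<rho> where "\<rho> L \<omega> = fact k * (2 / \<eta> \<omega>) ^ k * bd \<omega> / (\<eta> \<omega> / 2) * exp (- (\<eta> \<omega> / 2 * L))" for L \<omega>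
  have \<rho>m [measurable]: "\<rho> L \<in> borel_measurable M" for L unfolding \<rho>_def by measurable
  have \<rho>0: "AE \<omega> in M. 0 \<le> \<rho> L \<omega>" for L using \<eta>(2) by eventually_elim (simp add: \<rho>_def)
  have T: "?T L \<in> carrier S" if "0 \<le> L" for L using that \<eta> by simp
  have le: "mdist (?T L') (?T L) \<le> E1 (\<rho> N)" if "0 \<le> N" "N \<le> L" "L \<le> L'" for N L L'
    unfolding mdist_def
  proof (intro E1_mono nr_nonneg)
    have LL: "0 \<le> L" "0 \<le> L'" using that by auto
    show "AE \<omega> in M. nr (?T L' \<ominus>\<^bsub>S\<^esub> ?T L) \<omega> \<le> \<rho> N \<omega>"
      using truncated_increment_le[OF \<eta> LL(1) that(3), of k] \<eta>(2)
    proof eventually_elim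
      case (elim \<omega>)
      have "exp (- (\<eta> \<omega> / 2 * L)) \<le> exp (- (\<eta> \<omega> / 2 * N))" using elim(2) that by simp
      then have "fact k * (2 / \<eta> \<omega>) ^ k * bd \<omega> / (\<eta> \<omega> / 2) * exp (- (\<eta> \<omega> / 2 * L)) \<le> \<rho> N \<omega>"
        unfolding \<rho>_def using elim(2) by (intro mult_left_mono) auto
      with elim(1) show ?case by linarith
    qed
  qed (use T that in auto)
  \<comment> \<open>Dominated convergence with the constant 1 as majorant turns the almost sure
    decay of the tail bound into decay of its truncated mean.\<close>
  have lim: "(\<lambda>n. E1 (\<rho> (real n))) \<longlonglongrightarrow> 0"
  proof -
    have "(\<lambda>n. E1 (\<rho> (real n))) \<longlonglongrightarrow> (\<integral>\<omega>. 0 \<partial>M)"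
      unfolding E1_def
    proof (rule integral_dominated_convergence)
      show "AE \<omega> in M. (\<lambda>n. min 1 (\<rho> (real n) \<omega>)) \<longlonglongrightarrow> 0"
        using \<eta>(2)
      proof eventually_elim
        case (elim \<omega>)
        have "(\<lambda>n. \<rho> (real n) \<omega>) \<longlonglongrightarrow> fact k * (2 / \<eta> \<omega>) ^ k * bd \<omega> / (\<eta> \<omega> / 2) * 0"
          unfolding \<rho>_def
        proof (intro tendsto_mult tendsto_const)
          have "filterlim (\<lambda>n. \<eta> \<omega> / 2 * real n) at_top sequentially"
            using elim by (intro filterlim_tendsto_pos_mult_at_top[OF tendsto_const _ filterlim_real_sequentially]) auto
          then show "(\<lambda>n. exp (- (\<eta> \<omega> / 2 * real n))) \<longlonglongrightarrow> 0"
            by (intro filterlim_compose[OF exp_at_bot] filterlim_uminus_at_top[THEN iffD1]) auto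
        qed
        from tendsto_min[OF tendsto_const[of 1] this] show ?case by simp
      qed
      show "AE \<omega> in M. norm (min 1 (\<rho> (real n) \<omega>)) \<le> 1" for n using \<rho>0[of "real n"] by eventually_elim auto
      show "integrable M (\<lambda>_. 1::real)" by simp
    qed simp_all
    then show ?thesis by simp
  qed
  have small: "\<exists>N. E1 (\<rho> (real N)) < e" if "e > 0" for e
    using order_tendstoD(2)[OF lim that] by (auto simp: eventually_sequentially)
  have near: "mdist (?T a) (?T b) \<le> E1 (\<rho> (real N))" if "real N \<le> a" "real N \<le> b" for N a b
  proof (cases "a \<le> b")
    case True
    with le[of "real N" a b] that T[of a] T[of b] show ?thesis by (simp add: mdist_commute[of "?T a"])
  next
    case False
    with le[of "real N" b a] that show ?thesis by simp
  qed
  have "\<exists>I. limitin (el_topology M S nrm) (\<lambda>n. ?T (real n)) I sequentially"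
  proof (rule el_complete_Cauchy[OF complete])
    fix e :: real assume "e > 0"
    from small[OF this] obtain N where N: "E1 (\<rho> (real N)) < e" by blast
    show "\<exists>N. \<forall>m\<ge>N. \<forall>n\<ge>N. mdist (?T (real m)) (?T (real n)) < e"
    proof (intro exI[of _ N] allI impI)
      fix m n :: nat assume "N \<le> m" "N \<le> n"
      with near[of N "real m" "real n"] N show "mdist (?T (real m)) (?T (real n)) < e" by simp
    qed
  qed (use T in simp)
  then obtain I where I: "limitin (el_topology M S nrm) (\<lambda>n. ?T (real n)) I sequentially" by blast
  then have Ic: "I \<in> carrier S" by (simp add: limitin_el_iff)
  have "limitin (el_topology M S nrm) ?T I at_top"
    unfolding limitin_el_iff
  proof (intro conjI allI impI Ic)
    fix e :: real assume "e > 0"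
    then have e2: "e / 2 > 0" by simp
    from small[OF this] obtain N where N: "E1 (\<rho> (real N)) < e / 2" by blast
    have "\<forall>\<^sub>F n in sequentially. ?T (real n) \<in> carrier S \<and> mdist (?T (real n)) I < e / 2"
      using I e2 unfolding limitin_el_iff by blast
    then have "\<forall>\<^sub>F n in sequentially. mdist (?T (real n)) I < e / 2 \<and> N \<le> n"
      using eventually_ge_at_top[of N] by eventually_elim auto
    then obtain n where n: "mdist (?T (real n)) I < e / 2" "N \<le> n" by (auto simp: eventually_sequentially)
    show "\<forall>\<^sub>F L in at_top. ?T L \<in> carrier S \<and> mdist (?T L) I < e"
      using eventually_ge_at_top[of "real N"]
    proof eventually_elim
      case (elim L)
      then have TL: "?T L \<in> carrier S" by (intro T) simp
      have "mdist (?T L) I \<le> mdist (?T L) (?T (real n)) + mdist (?T (real n)) I"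
        using TL T[of "real n"] Ic by (intro mdist_triangle) auto
      also have "mdist (?T L) (?T (real n)) \<le> E1 (\<rho> (real N))" using elim n by (intro near) auto
      finally show ?case using N n(1) TL by simp
    qed
  qed
  then show ?thesis by blast
qed

text \<open>The element written \<open>D\<^sub>k(\<eta>)\<close> in the overview, with a measurable
  function as rate.\<close>

definition moment :: "nat \<Rightarrow> ('w \<Rightarrow> real) \<Rightarrow> 's" where
  "moment k \<eta> = (THE I. limitin (el_topology M S nrm) (truncated k \<eta>) I at_top)"

lemma moment:
  assumes "\<eta> \<in> borel_measurable M" "AE \<omega> in M. 0 < \<eta> \<omega>"
  shows "limitin (el_topology M S nrm) (truncated k \<eta>) (moment k \<eta>) at_top"
  unfolding moment_def
proof (rule theI')
  show "\<exists>!I. limitin (el_topology M S nrm) (truncated k \<eta>) I at_top"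
    using truncated_converges[OF assms, of k] limitin_el_unique[of "truncated k \<eta>" _ at_top]
    by (metis trivial_limit_at_top_linorder)
qed

lemma moment_closed [simp]:
  assumes "\<eta> \<in> borel_measurable M" "AE \<omega> in M. 0 < \<eta> \<omega>"
  shows "moment k \<eta> \<in> carrier S"
  using moment[OF assms, of k] by (simp add: limitin_el_iff)

lemma moment_sequence:
  assumes "\<eta> \<in> borel_measurable M" "AE \<omega> in M. 0 < \<eta> \<omega>"
  shows "limitin (el_topology M S nrm) (\<lambda>n. truncated k \<eta> (real n)) (moment k \<eta>) sequentially"
  using moment[OF assms, of k] filterlim_real_sequentially
  unfolding limitin_el_iff filterlim_iff by blast

text \<open>Taylor's formula in x = -r s leaves r^2 s^2, hence the power k + 2. The factor
  exp\<bar>x\<bar> costs half of the rate because \<bar>r\<bar> \<le> \<eta>/2; absorbing the power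
  by \<open>power_mult_exp_le\<close> halves the rate again, which yields 4/\<eta> and the decay
  \<eta>/4.\<close>

lemma abs_kern_second_order_le:
  assumes "0 \<le> s" "0 < \<eta> \<omega>" "\<bar>r \<omega>\<bar> \<le> \<eta> \<omega> / 2"
  shows "\<bar>kern k (\<lambda>\<omega>. \<eta> \<omega> + r \<omega>) s \<omega> - kern k \<eta> s \<omega> - r \<omega> * kern (Suc k) \<eta> s \<omega>\<bar> \<le>
    (r \<omega>)\<^sup>2 / 2 * (fact (k + 2) * (4 / \<eta> \<omega>) ^ (k + 2)) * exp (- (\<eta> \<omega> / 4 * s))"
proof -
  let ?r = "r \<omega>" and ?e = "\<eta> \<omega>"
  let ?x = "- (?r * s)"
  have "exp (- ((?e + ?r) * s)) = exp (- (?e * s)) * exp ?x"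
    by (simp add: exp_add[symmetric] algebra_simps)
  then have "kern k (\<lambda>\<omega>. \<eta> \<omega> + r \<omega>) s \<omega> - kern k \<eta> s \<omega> - r \<omega> * kern (Suc k) \<eta> s \<omega> =
      (- s) ^ k * exp (- (?e * s)) * (exp ?x - 1 - ?x)"
    by (simp add: kern_def algebra_simps)
  then have "\<bar>kern k (\<lambda>\<omega>. \<eta> \<omega> + r \<omega>) s \<omega> - kern k \<eta> s \<omega> - r \<omega> * kern (Suc k) \<eta> s \<omega>\<bar> =
      s ^ k * exp (- (?e * s)) * \<bar>exp ?x - 1 - ?x\<bar>"
    using assms by (simp add: abs_mult power_abs)
  also have "\<dots> \<le> s ^ k * exp (- (?e * s)) * (?x\<^sup>2 / 2 * exp \<bar>?x\<bar>)"
    using assms abs_exp_second_order_le[of ?x] by (intro mult_left_mono) simp_all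
  also have "\<dots> \<le> s ^ k * exp (- (?e * s)) * (?x\<^sup>2 / 2 * exp (?e / 2 * s))"
  proof (intro mult_left_mono)
    have "\<bar>?x\<bar> = \<bar>?r\<bar> * s" using assms by (simp add: abs_mult)
    also have "\<dots> \<le> ?e / 2 * s" using assms by (intro mult_right_mono) auto
    finally show "exp \<bar>?x\<bar> \<le> exp (?e / 2 * s)" by simp
  qed (use assms in auto)
  also have "\<dots> = ?r\<^sup>2 / 2 * (s ^ (k + 2) * (exp (- (?e * s)) * exp (?e / 2 * s)))"
    by (simp add: power_mult_distrib power_add power2_eq_square)
  also have "exp (- (?e * s)) * exp (?e / 2 * s) = exp (- (?e / 2 * s))"
    by (simp add: exp_add[symmetric])
  also have "?r\<^sup>2 / 2 * (s ^ (k + 2) * exp (- (?e / 2 * s))) \<le>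
      ?r\<^sup>2 / 2 * (fact (k + 2) * (2 / (?e / 2)) ^ (k + 2) * exp (- (?e / 2 / 2 * s)))"
    using assms by (intro mult_left_mono power_mult_exp_le) auto
  finally show ?thesis by (simp add: mult_ac)
qed

text \<open>The pointwise kernel estimate is integrated over \<open>{0..L}\<close> and then passed
  to the limit in L. Integrating the exponential of rate \<eta>/4 contributes one more factor
  4/\<eta>, which raises the exponent to k + 3.\<close>

lemma moment_second_order_le:
  assumes \<eta>: "\<eta> \<in> borel_measurable M" "AE \<omega> in M. 0 < \<eta> \<omega>"
    and r: "r \<in> borel_measurable M" "AE \<omega> in M. \<bar>r \<omega>\<bar> \<le> \<eta> \<omega> / 2"
  shows "AE \<omega> in M. nr (moment k (\<lambda>\<omega>. \<eta> \<omega> + r \<omega>) \<ominus>\<^bsub>S\<^esub> moment k \<eta> \<ominus>\<^bsub>S\<^esub> act r (moment (Suc k) \<eta>)) \<omega> \<le>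
    (r \<omega>)\<^sup>2 * (fact (k + 2) * (4 / \<eta> \<omega>) ^ (k + 3) * bd \<omega>)"
proof -
  have [measurable]: "\<eta> \<in> borel_measurable M" "r \<in> borel_measurable M" by fact+
  let ?\<eta>' = "\<lambda>\<omega>. \<eta> \<omega> + r \<omega>"
  have \<eta>': "?\<eta>' \<in> borel_measurable M" "AE \<omega> in M. 0 < ?\<eta>' \<omega>"
    using \<eta>(2) r(2) by (simp, eventually_elim, linarith)
  let ?X = "\<lambda>L. truncated k ?\<eta>' L \<ominus>\<^bsub>S\<^esub> truncated k \<eta> L \<ominus>\<^bsub>S\<^esub> act r (truncated (Suc k) \<eta> L)"
  let ?C = "\<lambda>\<omega>. (r \<omega>)\<^sup>2 * (fact (k + 2) * (4 / \<eta> \<omega>) ^ (k + 3) * bd \<omega>)"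
  let ?\<phi> = "\<lambda>s \<omega>. (r \<omega>)\<^sup>2 / 2 * (fact (k + 2) * (4 / \<eta> \<omega>) ^ (k + 2)) * bd \<omega> * exp (- (\<eta> \<omega> / 4 * s))"
  let ?d = "\<lambda>s \<omega>. kern k ?\<eta>' s \<omega> - kern k \<eta> s \<omega> - r \<omega> * kern (Suc k) \<eta> s \<omega>"
  have X: "AE \<omega> in M. nr (?X L) \<omega> \<le> ?C \<omega>" if L: "0 \<le> L" for L
  proof -
    have "AE \<omega> in M. nr (?X L) \<omega> \<le> integral {0..L} (\<lambda>s. ?\<phi> s \<omega>)"
    proof (rule nr_riemann_integral_le[OF _ L])
      show "has_riemann_integral M S nrm
          (\<lambda>s. integrand k ?\<eta>' s \<ominus>\<^bsub>S\<^esub> integrand k \<eta> s \<ominus>\<^bsub>S\<^esub> act r (integrand (Suc k) \<eta> s)) 0 L (?X L)"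
        using \<eta> \<eta>' r L by (intro has_riemann_integral_diff has_riemann_integral_act truncated) auto
      fix s assume "s \<in> {0..L}"
      then have s: "0 \<le> s" by simp
      have m: "kern k ?\<eta>' s \<in> borel_measurable M" "kern k \<eta> s \<in> borel_measurable M" "kern (Suc k) \<eta> s \<in> borel_measurable M"
        using \<eta> \<eta>' by auto
      note [measurable] = m
      \<comment> \<open>The three terms are merged into one scalar acting on \<open>f s\<close>
        before the norm is taken; otherwise the second-order cancellation would be lost.\<close>
      have eq: "integrand k ?\<eta>' s \<ominus>\<^bsub>S\<^esub> integrand k \<eta> s \<ominus>\<^bsub>S\<^esub> act r (integrand (Suc k) \<eta> s) = act (?d s) (f s)"
        unfolding integrand_def using m s r(1) by (simp add: act_act act_diff_left)
      show "integrand k ?\<eta>' s \<ominus>\<^bsub>S\<^esub> integrand k \<eta> s \<ominus>\<^bsub>S\<^esub> act r (integrand (Suc k) \<eta> s) \<in> carrier S"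
        using \<eta> \<eta>' r s by simp
      have "AE \<omega> in M. nr (act (?d s) (f s)) \<omega> \<le> \<bar>?d s \<omega>\<bar> * bd \<omega>"
        using s by (intro nr_act_f_le) auto
      with \<eta>(2) r(2)
      show "AE \<omega> in M. nr (integrand k ?\<eta>' s \<ominus>\<^bsub>S\<^esub> integrand k \<eta> s \<ominus>\<^bsub>S\<^esub> act r (integrand (Suc k) \<eta> s)) \<omega> \<le> ?\<phi> s \<omega>"
        unfolding eq
      proof eventually_elim
        case (elim \<omega>)
        have "\<bar>?d s \<omega>\<bar> * bd \<omega> \<le> (r \<omega>)\<^sup>2 / 2 * (fact (k + 2) * (4 / \<eta> \<omega>) ^ (k + 2)) * exp (- (\<eta> \<omega> / 4 * s)) * bd \<omega>"
          using s elim by (intro mult_right_mono abs_kern_second_order_le) auto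
        with elim(3) show ?case by (simp add: mult_ac)
      qed
    qed (intro AE_I2 continuous_intros)
    with \<eta>(2) show ?thesis
    proof eventually_elim
      case (elim \<omega>)
      have "integral {0..L} (\<lambda>s. ?\<phi> s \<omega>) \<le>
          (r \<omega>)\<^sup>2 / 2 * (fact (k + 2) * (4 / \<eta> \<omega>) ^ (k + 2)) * bd \<omega> / (\<eta> \<omega> / 4) * exp (- (\<eta> \<omega> / 4 * 0))"
        using elim L by (intro integral_exp_le) auto
      also have "\<dots> = ?C \<omega> / 2" by (simp add: power_add power2_eq_square power3_eq_cube mult_ac)
      also have "\<dots> \<le> ?C \<omega>" using elim by simp
      finally show ?case using elim by linarith
    qed
  qed
  have "limitin (el_topology M S nrm) (\<lambda>n. ?X (real n))
      (moment k ?\<eta>' \<ominus>\<^bsub>S\<^esub> moment k \<eta> \<ominus>\<^bsub>S\<^esub> act r (moment (Suc k) \<eta>)) sequentially"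
    using \<eta> \<eta>' r by (intro limitin_el_diff limitin_el_act moment_sequence) auto
  then show ?thesis
    by (rule nr_le_of_limitin[where c = "\<lambda>_. ?C"]) (use X \<eta> \<eta>' r in auto)
qed

end

section \<open>Differentiation in the locally L0-convex topology\<close>

context prob_space
begin

section \<open>Random radii and open balls\<close>

lemma L0_pos_iff: "X \<in> L0_pos M \<longleftrightarrow> X \<in> L0 M \<and> (AE \<omega> in M. 0 < L0_rep X \<omega>)"
proof -
  have c: "AE \<omega> in M. L0_rep (L0_const M (0::real)) \<omega> = 0" by (rule L0_rep_const)
  have "(AE \<omega> in M. L0_rep (L0_const M 0) \<omega> < L0_rep X \<omega>) \<longleftrightarrow> (AE \<omega> in M. 0 < L0_rep X \<omega>)"
  proof
    assume "AE \<omega> in M. L0_rep (L0_const M 0) \<omega> < L0_rep X \<omega>"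
    with c show "AE \<omega> in M. 0 < L0_rep X \<omega>" by eventually_elim simp
  next
    assume "AE \<omega> in M. 0 < L0_rep X \<omega>"
    with c show "AE \<omega> in M. L0_rep (L0_const M 0) \<omega> < L0_rep X \<omega>" by eventually_elim simp
  qed
  then show ?thesis by (auto simp: L0_pos_def L0_less_def)
qed

lemma L0_class_pos:
  assumes "u \<in> borel_measurable M" "AE \<omega> in M. 0 < u \<omega>"
  shows "L0_class M u \<in> L0_pos M"
proof -
  have "AE \<omega> in M. 0 < L0_rep (L0_class M u) \<omega>"
    using L0_rep_class[OF assms(1)] assms(2) by eventually_elim simp
  then show ?thesis using assms(1) by (simp add: L0_pos_iff)
qed

text \<open>Around a point y of the ball, the random slack between \<epsilon> and the distance of y
  to the centre is an admissible radius, being positive almost surely. \<open>G\<close> and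
  \<open>N\<close> are abstract so that the result serves both \<open>S\<close> and the base
  ring.\<close>

lemma openin_Tc_ball:
  assumes N: "\<And>x y. x \<in> carrier G \<Longrightarrow> y \<in> carrier G \<Longrightarrow> N (x \<ominus>\<^bsub>G\<^esub> y) \<in> L0 M"
    and triangle: "\<And>x y z. x \<in> carrier G \<Longrightarrow> y \<in> carrier G \<Longrightarrow> z \<in> carrier G \<Longrightarrow>
      AE \<omega> in M. L0_rep (N (x \<ominus>\<^bsub>G\<^esub> z)) \<omega> \<le> L0_rep (N (x \<ominus>\<^bsub>G\<^esub> y)) \<omega> + L0_rep (N (y \<ominus>\<^bsub>G\<^esub> z)) \<omega>"
    and \<epsilon>: "\<epsilon> \<in> L0 M" and x: "x \<in> carrier G"
  shows "openin (Tc_topology M G N) (Tc_ball M G N \<epsilon> x)"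
  unfolding openin_Tc_topology
proof (intro conjI ballI)
  show "Tc_ball M G N \<epsilon> x \<subseteq> carrier G" by (auto simp: Tc_ball_def)
  fix y assume "y \<in> Tc_ball M G N \<epsilon> x"
  then have y: "y \<in> carrier G" "AE \<omega> in M. L0_rep (N (y \<ominus>\<^bsub>G\<^esub> x)) \<omega> < L0_rep \<epsilon> \<omega>"
    by (auto simp: Tc_ball_def L0_less_def)
  define d where "d \<omega> = L0_rep \<epsilon> \<omega> - L0_rep (N (y \<ominus>\<^bsub>G\<^esub> x)) \<omega>" for \<omega>
  have d: "d \<in> borel_measurable M"
    unfolding d_def using N[OF y(1) x] \<epsilon> by (intro borel_measurable_diff L0_rep_measurable)
  have "Tc_ball M G N (L0_class M d) y \<subseteq> Tc_ball M G N \<epsilon> x"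
  proof
    fix z assume "z \<in> Tc_ball M G N (L0_class M d) y"
    then have z: "z \<in> carrier G" "AE \<omega> in M. L0_rep (N (z \<ominus>\<^bsub>G\<^esub> y)) \<omega> < L0_rep (L0_class M d) \<omega>"
      by (auto simp: Tc_ball_def L0_less_def)
    have "AE \<omega> in M. L0_rep (N (z \<ominus>\<^bsub>G\<^esub> x)) \<omega> < L0_rep \<epsilon> \<omega>"
      using z(2) L0_rep_class[OF d] triangle[OF z(1) y(1) x]
      by eventually_elim (simp add: d_def)
    then show "z \<in> Tc_ball M G N \<epsilon> x" using z(1) by (simp add: Tc_ball_def L0_less_def)
  qed
  moreover have "L0_class M d \<in> L0_pos M"
    using y(2) by (intro L0_class_pos d) (auto simp: d_def elim: eventually_mono)
  ultimately show "\<exists>\<delta>\<in>L0_pos M. Tc_ball M G N \<delta> y \<subseteq> Tc_ball M G N \<epsilon> x" by blast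
qed

end

context random_normed_module
begin

section \<open>The base ring and the invertible elements near zero\<close>

abbreviation R0 :: "('w \<Rightarrow> real) set ring" where
  "R0 \<equiv> L0_ring M"

sublocale R0: cring R0
  by (rule cring_L0_ring)

lemma L0_rep_diff:
  assumes "X \<in> L0 M" "Y \<in> L0 M"
  shows "AE \<omega> in M. L0_rep (X \<ominus>\<^bsub>R0\<^esub> Y) \<omega> = L0_rep X \<omega> - L0_rep Y \<omega>"
proof -
  have X: "X \<in> carrier R0" "Y \<in> carrier R0" using assms by (simp_all add: carrier_L0_ring)
  have D: "X \<ominus>\<^bsub>R0\<^esub> Y \<in> L0 M" using R0.minus_closed[OF X] by (simp add: carrier_L0_ring)
  have "(X \<ominus>\<^bsub>R0\<^esub> Y) \<oplus>\<^bsub>R0\<^esub> Y = X"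
    using X by (simp add: a_minus_def R0.a_assoc R0.l_neg)
  with L0_rep_add[OF D assms(2)] show ?thesis by (auto elim: eventually_mono)
qed

lemma L0_rep_zero: "AE \<omega> in M. L0_rep \<zero>\<^bsub>R0\<^esub> \<omega> = 0"
  using L0_rep_const[of M "0::real"] by (simp add: L0_ring_def)

lemma L0_abs_L0 [simp]: "X \<in> L0 M \<Longrightarrow> L0_abs M (X :: ('w \<Rightarrow> real) set) \<in> L0 M"
  by (auto simp: L0_abs_def)

lemma L0_rep_abs_diff:
  assumes "X \<in> L0 M" "Y \<in> L0 M"
  shows "AE \<omega> in M. L0_rep (L0_abs M (X \<ominus>\<^bsub>R0\<^esub> Y)) \<omega> = \<bar>L0_rep X \<omega> - L0_rep Y \<omega>\<bar>"
proof -
  have "X \<ominus>\<^bsub>R0\<^esub> Y \<in> L0 M" using R0.minus_closed[of X Y] assms by (simp add: carrier_L0_ring)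
  from L0_rep_abs[OF this] L0_rep_diff[OF assms] show ?thesis by eventually_elim simp
qed

lemma openin_Tc_ball_S:
  assumes "\<epsilon> \<in> L0 M" "x \<in> carrier S"
  shows "openin (Tc_topology M S nrm) (Tc_ball M S nrm \<epsilon> x)"
  using nr_diff_triangle assms by (intro openin_Tc_ball) (auto intro!: nrm_L0 simp: nr_def)

lemma openin_Tc_ball_R0:
  assumes "\<epsilon> \<in> L0 M" "x \<in> L0 M"
  shows "openin (Tc_topology M R0 (L0_abs M)) (Tc_ball M R0 (L0_abs M) \<epsilon> x)"
proof (rule openin_Tc_ball)
  fix x y z assume "x \<in> carrier R0" "y \<in> carrier R0" "z \<in> carrier R0"
  then have *: "x \<in> L0 M" "y \<in> L0 M" "z \<in> L0 M" by (simp_all add: carrier_L0_ring)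
  show "AE \<omega> in M. L0_rep (L0_abs M (x \<ominus>\<^bsub>R0\<^esub> z)) \<omega> \<le>
      L0_rep (L0_abs M (x \<ominus>\<^bsub>R0\<^esub> y)) \<omega> + L0_rep (L0_abs M (y \<ominus>\<^bsub>R0\<^esub> z)) \<omega>"
    using L0_rep_abs_diff[OF *(1,3)] L0_rep_abs_diff[OF *(1,2)] L0_rep_abs_diff[OF *(2,3)]
    by eventually_elim simp
next
  fix x y assume "x \<in> carrier R0" "y \<in> carrier R0"
  then show "L0_abs M (x \<ominus>\<^bsub>R0\<^esub> y) \<in> L0 M"
    using R0.minus_closed[of x y] by (simp add: carrier_L0_ring)
qed (use assms in \<open>simp_all add: carrier_L0_ring\<close>)

lemma mem_Tc_ball_R0_zero:
  assumes "d \<in> borel_measurable M" "r \<in> L0 M"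
  shows "r \<in> Tc_ball M R0 (L0_abs M) (L0_class M d) \<zero>\<^bsub>R0\<^esub> \<longleftrightarrow> (AE \<omega> in M. \<bar>L0_rep r \<omega>\<bar> < d \<omega>)"
proof -
  have z: "\<zero>\<^bsub>R0\<^esub> \<in> L0 M" using R0.zero_closed by (simp add: carrier_L0_ring)
  have "AE \<omega> in M. (L0_rep (L0_abs M (r \<ominus>\<^bsub>R0\<^esub> \<zero>\<^bsub>R0\<^esub>)) \<omega> < L0_rep (L0_class M d) \<omega>) =
      (\<bar>L0_rep r \<omega>\<bar> < d \<omega>)"
    using L0_rep_abs_diff[OF assms(2) z] L0_rep_zero L0_rep_class[OF assms(1)]
    by eventually_elim simp
  then have "(AE \<omega> in M. L0_rep (L0_abs M (r \<ominus>\<^bsub>R0\<^esub> \<zero>\<^bsub>R0\<^esub>)) \<omega> < L0_rep (L0_class M d) \<omega>) =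
      (AE \<omega> in M. \<bar>L0_rep r \<omega>\<bar> < d \<omega>)"
    by (rule eventually_subst)
  with assms(2) show ?thesis by (simp add: Tc_ball_def L0_less_def carrier_L0_ring)
qed

lemma mem_Tc_ball_S_zero:
  assumes "x \<in> carrier S"
  shows "x \<in> Tc_ball M S nrm \<epsilon> \<zero>\<^bsub>S\<^esub> \<longleftrightarrow> (AE \<omega> in M. nr x \<omega> < L0_rep \<epsilon> \<omega>)"
  using assms by (simp add: Tc_ball_def L0_less_def diff_zero nr_def)

abbreviation invertible_at_0 :: "('w \<Rightarrow> real) set filter" where
  "invertible_at_0 \<equiv> atin_within (Tc_topology M R0 (L0_abs M)) \<zero>\<^bsub>R0\<^esub> {r \<in> L0 M. L0_abs M r \<in> L0_pos M}"

text \<open>Replaces the topological filter by a pointwise condition. The radius \<open>d\<close>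
  may vary with \<omega>, and it is this freedom that lets a random error constant be
  compensated.\<close>

lemma eventually_invertible_small:
  assumes d: "d \<in> borel_measurable M" "AE \<omega> in M. 0 < d \<omega>"
    and P: "\<And>r. r \<in> L0 M \<Longrightarrow> (AE \<omega> in M. L0_rep r \<omega> \<noteq> 0) \<Longrightarrow> (AE \<omega> in M. \<bar>L0_rep r \<omega>\<bar> < d \<omega>) \<Longrightarrow> P r"
  shows "eventually P invertible_at_0"
proof -
  let ?T = "Tc_ball M R0 (L0_abs M) (L0_class M d) \<zero>\<^bsub>R0\<^esub>"
  have z: "\<zero>\<^bsub>R0\<^esub> \<in> L0 M" using R0.zero_closed by (simp add: carrier_L0_ring)
  have "openin (Tc_topology M R0 (L0_abs M)) ?T" using d z by (intro openin_Tc_ball_R0) auto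
  moreover have "\<zero>\<^bsub>R0\<^esub> \<in> ?T"
    unfolding mem_Tc_ball_R0_zero[OF d(1) z] using L0_rep_zero d(2) by eventually_elim simp
  moreover have "P r" if r: "r \<in> ?T" "r \<in> L0 M" "L0_abs M r \<in> L0_pos M" for r
  proof (rule P[OF r(2)])
    have "AE \<omega> in M. 0 < L0_rep (L0_abs M r) \<omega>" using r(3) by (simp add: L0_pos_iff)
    with L0_rep_abs[OF r(2)] show "AE \<omega> in M. L0_rep r \<omega> \<noteq> 0" by eventually_elim auto
    show "AE \<omega> in M. \<bar>L0_rep r \<omega>\<bar> < d \<omega>" using r(1) by (simp add: mem_Tc_ball_R0_zero[OF d(1) r(2)])
  qed
  ultimately show ?thesis unfolding eventually_atin_within by blast
qed

text \<open>Every ball of radius \<delta> around zero contains the invertible element \<delta>/2.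
  Without this, limits along the filter would not determine the derivative.\<close>

lemma invertible_at_0_neq_bot: "invertible_at_0 \<noteq> bot"
proof
  assume "invertible_at_0 = bot"
  then have "eventually (\<lambda>_. False) invertible_at_0" by simp
  then obtain T where T: "openin (Tc_topology M R0 (L0_abs M)) T" "\<zero>\<^bsub>R0\<^esub> \<in> T"
    "\<And>r. r \<in> T \<Longrightarrow> r \<in> L0 M \<Longrightarrow> L0_abs M r \<in> L0_pos M \<Longrightarrow> r = \<zero>\<^bsub>R0\<^esub>"
  proof -
    assume a: "\<And>T. openin (Tc_topology M R0 (L0_abs M)) T \<Longrightarrow> \<zero>\<^bsub>R0\<^esub> \<in> T \<Longrightarrow>
      (\<And>r. r \<in> T \<Longrightarrow> r \<in> L0 M \<Longrightarrow> L0_abs M r \<in> L0_pos M \<Longrightarrow> r = \<zero>\<^bsub>R0\<^esub>) \<Longrightarrow> thesis"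
    have z: "\<zero>\<^bsub>R0\<^esub> \<in> L0 M" using R0.zero_closed by (simp add: carrier_L0_ring)
    \<comment> \<open>An \<open>atin_within\<close> filter is trivial at a point outside the
      topological space, so zero has to be exhibited as a point of it.\<close>
    have "openin (Tc_topology M R0 (L0_abs M)) (carrier R0)"
      unfolding openin_Tc_topology
      by (intro conjI ballI bexI[of _ "L0_class M (\<lambda>_. 1)"] L0_class_pos) (auto simp: Tc_ball_def)
    then have "\<zero>\<^bsub>R0\<^esub> \<in> topspace (Tc_topology M R0 (L0_abs M))"
      using openin_subset R0.zero_closed by blast
    with \<open>eventually (\<lambda>_. False) invertible_at_0\<close> show thesis
      unfolding eventually_atin_within using a by blast
  qed
  then obtain \<delta> where \<delta>: "\<delta> \<in> L0_pos M" "Tc_ball M R0 (L0_abs M) \<delta> \<zero>\<^bsub>R0\<^esub> \<subseteq> T"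
    unfolding openin_Tc_topology by blast
  then have \<delta>L: "\<delta> \<in> L0 M" "AE \<omega> in M. 0 < L0_rep \<delta> \<omega>" by (auto simp: L0_pos_iff)
  have m: "L0_rep \<delta> \<in> borel_measurable M" using \<delta>L by simp
  define r where "r = L0_class M (\<lambda>\<omega>. L0_rep \<delta> \<omega> / 2)"
  have r: "r \<in> L0 M" using m by (auto simp: r_def)
  have rep: "AE \<omega> in M. L0_rep r \<omega> = L0_rep \<delta> \<omega> / 2" unfolding r_def using m by (intro L0_rep_class) auto
  have "AE \<omega> in M. \<bar>L0_rep r \<omega>\<bar> < L0_rep \<delta> \<omega>" using rep \<delta>L(2) by eventually_elim simp
  then have "r \<in> Tc_ball M R0 (L0_abs M) \<delta> \<zero>\<^bsub>R0\<^esub>" using mem_Tc_ball_R0_zero[OF m r] \<delta>L by simp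
  moreover have "AE \<omega> in M. 0 < L0_rep (L0_abs M r) \<omega>"
    using L0_rep_abs[OF r] rep \<delta>L(2) by eventually_elim simp
  then have "L0_abs M r \<in> L0_pos M" using r by (simp add: L0_pos_iff)
  ultimately have "r = \<zero>\<^bsub>R0\<^esub>" using T(3) \<delta>(2) r by blast
  with L0_rep_zero have "AE \<omega> in M. L0_rep r \<omega> = 0" by simp
  with rep \<delta>L(2) have "AE \<omega> in M. False" by eventually_elim simp
  then show False by simp
qed

lemma L0_of_real_eq: "L0_of_real M X = sc (L0_rep X)"
  by (simp add: L0_of_real_def sc_def)

text \<open>The ring inverse of a class is computed by dividing by its representative; where that
  vanishes, the convention 1/0 = 0 only fills in a value on a null set.\<close>

lemma L0_of_real_inv_smult:
  assumes r: "r \<in> L0 M" "AE \<omega> in M. L0_rep r \<omega> \<noteq> 0"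
  shows "L0_of_real M (inv\<^bsub>R0\<^esub> r) \<odot>\<^bsub>S\<^esub> x = act (\<lambda>\<omega>. 1 / L0_rep r \<omega>) x"
proof -
  have m: "L0_rep r \<in> borel_measurable M" using r(1) by simp
  then have m': "(\<lambda>\<omega>. 1 / L0_rep r \<omega>) \<in> borel_measurable M" by measurable
  let ?q = "L0_class M (\<lambda>\<omega>. 1 / L0_rep r \<omega>)"
  have q: "?q \<in> L0 M" using m' by auto
  have "r \<otimes>\<^bsub>R0\<^esub> ?q = \<one>\<^bsub>R0\<^esub>"
  proof (rule L0_eqI[of _ M])
    show "r \<otimes>\<^bsub>R0\<^esub> ?q \<in> L0 M" "\<one>\<^bsub>R0\<^esub> \<in> L0 M"
      using R0.m_closed[of r ?q] R0.one_closed r(1) q by (simp_all add: carrier_L0_ring)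
    have one: "AE \<omega> in M. L0_rep \<one>\<^bsub>R0\<^esub> \<omega> = 1" using L0_rep_const[of M "1::real"] by (simp add: L0_ring_def)
    show "AE \<omega> in M. L0_rep (r \<otimes>\<^bsub>R0\<^esub> ?q) \<omega> = L0_rep \<one>\<^bsub>R0\<^esub> \<omega>"
      using L0_rep_mult[OF r(1) q] L0_rep_class[OF m'] one r(2) by eventually_elim simp
  qed
  then have "inv\<^bsub>R0\<^esub> r = ?q" using r(1) q by (intro R0.comm_inv_char) (simp_all add: carrier_L0_ring)
  moreover have "act (L0_rep ?q) x = act (\<lambda>\<omega>. 1 / L0_rep r \<omega>) x"
    using q m' by (intro act_cong L0_rep_class) auto
  ultimately show ?thesis by (simp add: L0_of_real_eq act_def)
qed

lemma L0_pos_add_small: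
  assumes "\<eta> \<in> L0_pos M" "r \<in> L0 M" "AE \<omega> in M. \<bar>L0_rep r \<omega>\<bar> < L0_rep \<eta> \<omega> / 2"
  shows "\<eta> \<oplus>\<^bsub>R0\<^esub> r \<in> L0_pos M"
proof -
  have \<eta>: "\<eta> \<in> L0 M" using assms(1) by (simp add: L0_pos_iff)
  have "AE \<omega> in M. 0 < L0_rep (\<eta> \<oplus>\<^bsub>R0\<^esub> r) \<omega>"
    using L0_rep_add[OF \<eta> assms(2)] assms(3) by eventually_elim linarith
  moreover have "\<eta> \<oplus>\<^bsub>R0\<^esub> r \<in> L0 M" using R0.a_closed[of \<eta> r] \<eta> assms(2) by (simp add: carrier_L0_ring)
  ultimately show ?thesis by (simp add: L0_pos_iff)
qed

text \<open>Constant radii 1/(n + 1) suffice to separate points: a common r for which the quotient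
  is close to both candidates bounds the norm of their difference by 2/(n + 1) for every n. The
  definite description in \<open>Tc_deriv\<close> rests on this.\<close>

lemma has_Tc_derivative_unique:
  assumes I: "has_Tc_derivative M S nrm H \<eta> I" and J: "has_Tc_derivative M S nrm H \<eta> J"
    and H: "\<And>\<xi>. \<xi> \<in> L0_pos M \<Longrightarrow> H \<xi> \<in> carrier S" and \<eta>: "\<eta> \<in> L0_pos M"
  shows "I = J"
proof -
  let ?q = "\<lambda>r. L0_of_real M (inv\<^bsub>R0\<^esub> r) \<odot>\<^bsub>S\<^esub> (H (\<eta> \<oplus>\<^bsub>R0\<^esub> r) \<ominus>\<^bsub>S\<^esub> H \<eta>)"
  have c: "I \<in> carrier S" "J \<in> carrier S" using I J by (auto simp: has_Tc_derivative_def)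
  have \<eta>m: "L0_rep \<eta> \<in> borel_measurable M" "AE \<omega> in M. 0 < L0_rep \<eta> \<omega>" using \<eta> by (auto simp: L0_pos_iff)
  have "AE \<omega> in M. nr (I \<ominus>\<^bsub>S\<^esub> J) \<omega> \<le> 2 / real (Suc n)" for n
  proof -
    define \<epsilon> where "\<epsilon> = L0_class M (\<lambda>_::'w. 1 / real (Suc n))"
    have \<epsilon>: "\<epsilon> \<in> L0_pos M" unfolding \<epsilon>_def by (intro L0_class_pos) auto
    have \<epsilon>r: "AE \<omega> in M. L0_rep \<epsilon> \<omega> = 1 / real (Suc n)" unfolding \<epsilon>_def by (intro L0_rep_class) auto
    let ?U = "Tc_ball M S nrm \<epsilon> \<zero>\<^bsub>S\<^esub>"
    have U: "openin (Tc_topology M S nrm) ?U" using \<epsilon> by (intro openin_Tc_ball_S) (auto simp: L0_pos_iff)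
    have "AE \<omega> in M. nr \<zero>\<^bsub>S\<^esub> \<omega> < L0_rep \<epsilon> \<omega>" using nr_zero \<epsilon>r by eventually_elim simp
    then have 0: "\<zero>\<^bsub>S\<^esub> \<in> ?U" by (simp add: mem_Tc_ball_S_zero)
    have "\<forall>\<^sub>F r in invertible_at_0. ?q r \<ominus>\<^bsub>S\<^esub> I \<in> ?U" "\<forall>\<^sub>F r in invertible_at_0. ?q r \<ominus>\<^bsub>S\<^esub> J \<in> ?U"
      using I J U 0 by (auto simp: has_Tc_derivative_def dest: limitinD)
    \<comment> \<open>\<open>H\<close> is known to take values in the carrier only on
      \<open>L0_pos M\<close>; for \<bar>r\<bar> < \<eta>/2 the shifted point stays there.\<close>
    moreover have "\<forall>\<^sub>F r in invertible_at_0. ?q r \<in> carrier S"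
    proof (rule eventually_invertible_small[of "\<lambda>\<omega>. L0_rep \<eta> \<omega> / 2"])
      fix r assume r: "r \<in> L0 M" "AE \<omega> in M. L0_rep r \<omega> \<noteq> 0" "AE \<omega> in M. \<bar>L0_rep r \<omega>\<bar> < L0_rep \<eta> \<omega> / 2"
      have "L0_rep r \<in> borel_measurable M" using r(1) by simp
      then show "?q r \<in> carrier S"
        unfolding L0_of_real_inv_smult[OF r(1,2)]
        using H[OF \<eta>] H[OF L0_pos_add_small[OF \<eta> r(1,3)]] by (intro act_closed S.M.minus_closed) auto
    qed (use \<eta>m in auto)
    ultimately have "\<forall>\<^sub>F r in invertible_at_0. ?q r \<in> carrier S \<and> ?q r \<ominus>\<^bsub>S\<^esub> I \<in> ?U \<and> ?q r \<ominus>\<^bsub>S\<^esub> J \<in> ?U"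
      by eventually_elim auto
    then obtain r where r: "?q r \<in> carrier S" "?q r \<ominus>\<^bsub>S\<^esub> I \<in> ?U" "?q r \<ominus>\<^bsub>S\<^esub> J \<in> ?U"
      using eventually_happens'[OF invertible_at_0_neq_bot] by blast
    have "AE \<omega> in M. nr (?q r \<ominus>\<^bsub>S\<^esub> I) \<omega> < L0_rep \<epsilon> \<omega>" "AE \<omega> in M. nr (?q r \<ominus>\<^bsub>S\<^esub> J) \<omega> < L0_rep \<epsilon> \<omega>"
      using r c by (simp_all add: mem_Tc_ball_S_zero)
    with nr_diff_triangle[OF c(1) r(1) c(2)] nr_diff_commute[OF c(1) r(1)] \<epsilon>r show ?thesis
    proof eventually_elim
      case (elim \<omega>)
      then have "nr (I \<ominus>\<^bsub>S\<^esub> J) \<omega> \<le> 2 * L0_rep \<epsilon> \<omega>" by linarith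
      with elim show ?case by simp
    qed
  qed
  then have "AE \<omega> in M. \<forall>n. nr (I \<ominus>\<^bsub>S\<^esub> J) \<omega> \<le> 2 / real (Suc n)" by (simp add: AE_all_countable)
  moreover have "AE \<omega> in M. 0 \<le> nr (I \<ominus>\<^bsub>S\<^esub> J) \<omega>" using c by (intro nr_nonneg) simp
  ultimately have "AE \<omega> in M. nr (I \<ominus>\<^bsub>S\<^esub> J) \<omega> = 0"
  proof eventually_elim
    case (elim \<omega>)
    have "(\<lambda>n. 2 * (1 / real (Suc n))) \<longlonglongrightarrow> 2 * 0"
      using LIMSEQ_inverse_real_of_nat by (intro tendsto_mult tendsto_const) (simp add: inverse_eq_divide)
    then have "nr (I \<ominus>\<^bsub>S\<^esub> J) \<omega> \<le> 0"
      using elim(1) by (intro LIMSEQ_le_const[of "\<lambda>n. 2 * (1 / real (Suc n))" 0]) auto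
    with elim(2) show ?case by simp
  qed
  then have "I \<ominus>\<^bsub>S\<^esub> J = \<zero>\<^bsub>S\<^esub>" using c by (intro nr_eq_0) auto
  then show ?thesis using c by (simp add: diff_eq_zero_iff)
qed

end

context bounded_el_continuous
begin

section \<open>Iterated derivatives of the Laplace transform\<close>

lemma moment_cong:
  assumes "\<eta> \<in> borel_measurable M" "\<xi> \<in> borel_measurable M" "AE \<omega> in M. \<eta> \<omega> = \<xi> \<omega>"
  shows "moment k \<eta> = moment k \<xi>"
proof -
  have "integrand k \<eta> = integrand k \<xi>"
  proof
    fix s
    have "AE \<omega> in M. kern k \<eta> s \<omega> = kern k \<xi> s \<omega>" using assms(3) by eventually_elim (simp add: kern_def)
    then show "integrand k \<eta> s = integrand k \<xi> s"
      unfolding integrand_def using assms by (intro act_cong) auto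
  qed
  then show ?thesis by (simp add: moment_def truncated_def[abs_def])
qed

text \<open>Dividing the second-order estimate by r leaves an error of at most \<bar>r\<bar> times a
  random constant. \<open>F\<close> is tied to the moments on \<open>L0_pos M\<close> alone, which
  is the information that the induction over iterated derivatives provides.\<close>

lemma has_Tc_derivative_moment:
  assumes F: "\<And>\<xi>. \<xi> \<in> L0_pos M \<Longrightarrow> F \<xi> = moment k (L0_rep \<xi>)" and \<eta>: "\<eta> \<in> L0_pos M"
  shows "has_Tc_derivative M S nrm F \<eta> (moment (Suc k) (L0_rep \<eta>))"
proof -
  define e where "e = L0_rep \<eta>"
  have \<eta>L: "\<eta> \<in> L0 M" using \<eta> by (simp add: L0_pos_iff)
  have e [measurable]: "e \<in> borel_measurable M" and e0: "AE \<omega> in M. 0 < e \<omega>" using \<eta> by (auto simp: L0_pos_iff e_def)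
  let ?D = "moment (Suc k) e"
  have D: "?D \<in> carrier S" using e e0 by simp
  define C where "C \<omega> = fact (k + 2) * (4 / e \<omega>) ^ (k + 3) * bd \<omega>" for \<omega>
  have C [measurable]: "C \<in> borel_measurable M" unfolding C_def by measurable
  have C0: "AE \<omega> in M. 0 \<le> C \<omega>" using e0 by eventually_elim (simp add: C_def)
  let ?q = "\<lambda>r. (L0_of_real M (inv\<^bsub>R0\<^esub> r) \<odot>\<^bsub>S\<^esub> (F (\<eta> \<oplus>\<^bsub>R0\<^esub> r) \<ominus>\<^bsub>S\<^esub> F \<eta>)) \<ominus>\<^bsub>S\<^esub> ?D"
  have bound: "?q r \<in> carrier S \<and> (AE \<omega> in M. nr (?q r) \<omega> \<le> \<bar>L0_rep r \<omega>\<bar> * C \<omega>)"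
    if r: "r \<in> L0 M" "AE \<omega> in M. L0_rep r \<omega> \<noteq> 0" "AE \<omega> in M. \<bar>L0_rep r \<omega>\<bar> < e \<omega> / 2" for r
  proof -
    define \<rho> where "\<rho> = L0_rep r"
    have \<rho> [measurable]: "\<rho> \<in> borel_measurable M" using r(1) by (simp add: \<rho>_def)
    have \<rho>0: "AE \<omega> in M. \<rho> \<omega> \<noteq> 0" and \<rho>s: "AE \<omega> in M. \<bar>\<rho> \<omega>\<bar> \<le> e \<omega> / 2"
      using r(2,3) by (auto simp: \<rho>_def elim: eventually_mono)
    let ?e' = "\<lambda>\<omega>. e \<omega> + \<rho> \<omega>"
    have e': "?e' \<in> borel_measurable M" "AE \<omega> in M. 0 < ?e' \<omega>"
      using e0 \<rho>s by (measurable, eventually_elim, linarith)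
    have pos: "\<eta> \<oplus>\<^bsub>R0\<^esub> r \<in> L0_pos M" using r(3) by (intro L0_pos_add_small[OF \<eta> r(1)]) (simp add: e_def)
    have "F (\<eta> \<oplus>\<^bsub>R0\<^esub> r) = moment k ?e'"
      unfolding F[OF pos] using pos e'(1) L0_rep_add[OF \<eta>L r(1)]
      by (intro moment_cong) (auto simp: L0_pos_iff e_def \<rho>_def)
    moreover have "F \<eta> = moment k e" unfolding F[OF \<eta>] e_def ..
    ultimately have q: "?q r = act (\<lambda>\<omega>. 1 / \<rho> \<omega>) (moment k ?e' \<ominus>\<^bsub>S\<^esub> moment k e) \<ominus>\<^bsub>S\<^esub> ?D"
      using L0_of_real_inv_smult[OF r(1,2)] by (simp add: \<rho>_def)
    have m: "moment k ?e' \<in> carrier S" "moment k e \<in> carrier S" using e e0 e' by auto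
    \<comment> \<open>Writing the candidate derivative as 1/\<rho> times \<rho> times itself brings
      the whole expression under one factor 1/\<rho>, in the form of the second-order
      estimate.\<close>
    have "act (\<lambda>\<omega>. 1 / \<rho> \<omega>) (act \<rho> ?D) = act (\<lambda>\<omega>. 1 / \<rho> \<omega> * \<rho> \<omega>) ?D"
      using D by (intro act_act) auto
    also have "\<dots> = act (\<lambda>_. 1) ?D"
      using \<rho>0 by (intro act_cong) (auto elim: eventually_mono)
    finally have "act (\<lambda>\<omega>. 1 / \<rho> \<omega>) (act \<rho> ?D) = ?D" using D by (simp add: act_one)
    then have q': "?q r = act (\<lambda>\<omega>. 1 / \<rho> \<omega>) (moment k ?e' \<ominus>\<^bsub>S\<^esub> moment k e \<ominus>\<^bsub>S\<^esub> act \<rho> ?D)"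
      unfolding q using m D by (subst act_diff_right) auto
    have c: "moment k ?e' \<ominus>\<^bsub>S\<^esub> moment k e \<ominus>\<^bsub>S\<^esub> act \<rho> ?D \<in> carrier S" using m D by simp
    have "AE \<omega> in M. nr (?q r) \<omega> = \<bar>1 / \<rho> \<omega>\<bar> * nr (moment k ?e' \<ominus>\<^bsub>S\<^esub> moment k e \<ominus>\<^bsub>S\<^esub> act \<rho> ?D) \<omega>"
      unfolding q' using c by (intro nr_act) auto
    moreover note moment_second_order_le[OF e e0 \<rho> \<rho>s, of k] \<rho>0
    ultimately have "AE \<omega> in M. nr (?q r) \<omega> \<le> \<bar>\<rho> \<omega>\<bar> * C \<omega>"
    proof eventually_elim
      case (elim \<omega>)
      have "nr (?q r) \<omega> \<le> \<bar>1 / \<rho> \<omega>\<bar> * ((\<rho> \<omega>)\<^sup>2 * C \<omega>)"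
        unfolding elim(1) using elim(2) by (intro mult_left_mono) (auto simp: C_def)
      also have "\<dots> = \<bar>\<rho> \<omega>\<bar> * C \<omega>"
        using elim(3) by (simp add: power2_eq_square abs_if)
      finally show ?case .
    qed
    moreover have "?q r \<in> carrier S" unfolding q' using c by (intro act_closed) auto
    ultimately show ?thesis by (simp add: \<rho>_def)
  qed
  have "limitin (Tc_topology M S nrm) ?q \<zero>\<^bsub>S\<^esub> invertible_at_0"
    unfolding limitin_def
  proof (intro conjI allI impI)
    have "openin (Tc_topology M S nrm) (carrier S)"
      unfolding openin_Tc_topology
      by (intro conjI ballI bexI[of _ "L0_class M (\<lambda>_. 1)"] L0_class_pos) (auto simp: Tc_ball_def)
    then show "\<zero>\<^bsub>S\<^esub> \<in> topspace (Tc_topology M S nrm)"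
      using openin_subset by blast
    fix U assume U: "openin (Tc_topology M S nrm) U \<and> \<zero>\<^bsub>S\<^esub> \<in> U"
    then obtain \<epsilon> where \<epsilon>: "\<epsilon> \<in> L0_pos M" "Tc_ball M S nrm \<epsilon> \<zero>\<^bsub>S\<^esub> \<subseteq> U"
      unfolding openin_Tc_topology by blast
    then have \<epsilon>m [measurable]: "L0_rep \<epsilon> \<in> borel_measurable M" and \<epsilon>0: "AE \<omega> in M. 0 < L0_rep \<epsilon> \<omega>"
      by (auto simp: L0_pos_iff)
    \<comment> \<open>The first entry keeps \<eta> + r positive, the second makes \<bar>r\<bar> C
      smaller than the given radius; C + 1 is positive even where C vanishes.\<close>
    define d where "d \<omega> = min (e \<omega> / 2) (L0_rep \<epsilon> \<omega> / (C \<omega> + 1))" for \<omega>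
    show "\<forall>\<^sub>F r in invertible_at_0. ?q r \<in> U"
    proof (rule eventually_invertible_small[of d])
      show "d \<in> borel_measurable M" unfolding d_def by measurable
      show "AE \<omega> in M. 0 < d \<omega>" using e0 \<epsilon>0 C0 by eventually_elim (simp add: d_def)
      fix r assume r: "r \<in> L0 M" "AE \<omega> in M. L0_rep r \<omega> \<noteq> 0" "AE \<omega> in M. \<bar>L0_rep r \<omega>\<bar> < d \<omega>"
      have "AE \<omega> in M. \<bar>L0_rep r \<omega>\<bar> < e \<omega> / 2" using r(3) by eventually_elim (simp add: d_def)
      note b = bound[OF r(1,2) this]
      then have "AE \<omega> in M. nr (?q r) \<omega> \<le> \<bar>L0_rep r \<omega>\<bar> * C \<omega>" by blast
      with r(3) C0 have "AE \<omega> in M. nr (?q r) \<omega> < L0_rep \<epsilon> \<omega>"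
      proof eventually_elim
        case (elim \<omega>)
        have "\<bar>L0_rep r \<omega>\<bar> * C \<omega> \<le> \<bar>L0_rep r \<omega>\<bar> * (C \<omega> + 1)" by (simp add: distrib_left)
        also have "\<dots> < L0_rep \<epsilon> \<omega>" using elim by (simp add: d_def pos_less_divide_eq)
        finally show ?case using elim by simp
      qed
      then show "?q r \<in> U" using b \<epsilon>(2) mem_Tc_ball_S_zero[of "?q r" \<epsilon>] by blast
    qed
  qed
  then show ?thesis using D by (simp add: has_Tc_derivative_def e_def)
qed

text \<open>The integrand in \<open>has_laplace\<close> is assembled from classes and agrees with
  the kernel of index 0 up to null sets. The equivalence delivers existence and uniqueness together,
  as the definite description in \<open>laplace\<close> requires.\<close>

lemma has_laplace_iff:
  assumes \<eta>: "\<eta> \<in> L0_pos M"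
  shows "has_laplace M S nrm f \<eta> I \<longleftrightarrow> I = moment 0 (L0_rep \<eta>)"
proof -
  let ?e = "L0_rep \<eta>"
  have e: "?e \<in> borel_measurable M" "AE \<omega> in M. 0 < ?e \<omega>" using \<eta> by (auto simp: L0_pos_iff)
  have "L0_of_real M (L0_class M (\<lambda>\<omega>. exp (- (?e \<omega> * s)))) \<odot>\<^bsub>S\<^esub> f s = integrand 0 ?e s" for s
  proof -
    have m: "(\<lambda>\<omega>. exp (- (?e \<omega> * s))) \<in> borel_measurable M" using e(1) by measurable
    have "AE \<omega> in M. L0_rep (L0_class M (\<lambda>\<omega>. exp (- (?e \<omega> * s)))) \<omega> = kern 0 ?e s \<omega>"
      using L0_rep_class[OF m] by eventually_elim (simp add: kern_def)
    then have "act (L0_rep (L0_class M (\<lambda>\<omega>. exp (- (?e \<omega> * s))))) (f s) = act (kern 0 ?e s) (f s)"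
      using m e(1) by (intro act_cong) auto
    then show ?thesis by (simp add: L0_of_real_eq act_def integrand_def)
  qed
  then have "has_laplace M S nrm f \<eta> I \<longleftrightarrow> limitin (el_topology M S nrm) (truncated 0 ?e) I at_top"
    using riemann_integrable_integrand[OF e]
    by (simp add: has_laplace_def has_improper_integral_def truncated_def[abs_def])
  with moment[OF e, of 0] limitin_el_unique[of "truncated 0 ?e" _ at_top] show ?thesis
    by (metis trivial_limit_at_top_linorder)
qed

text \<open>The induction ranges over all \<eta>, since differentiating at one point uses the
  previous derivative at the points around it.\<close>

lemma Tc_deriv_laplace:
  "\<eta> \<in> L0_pos M \<Longrightarrow> (Tc_deriv M S nrm ^^ k) (laplace M S nrm f) \<eta> = moment k (L0_rep \<eta>)"
proof (induction k arbitrary: \<eta>)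
  case 0
  then show ?case
    unfolding laplace_def funpow_0 by (intro the_equality) (simp_all add: has_laplace_iff)
next
  case (Suc k)
  let ?F = "(Tc_deriv M S nrm ^^ k) (laplace M S nrm f)"
  have d: "has_Tc_derivative M S nrm ?F \<eta> (moment (Suc k) (L0_rep \<eta>))"
    by (rule has_Tc_derivative_moment[OF Suc.IH Suc.prems])
  have c: "?F \<xi> \<in> carrier S" if "\<xi> \<in> L0_pos M" for \<xi>
    unfolding Suc.IH[OF that] using that by (intro moment_closed) (auto simp: L0_pos_iff)
  have "(THE I. has_Tc_derivative M S nrm ?F \<eta> I) = moment (Suc k) (L0_rep \<eta>)"
    using d has_Tc_derivative_unique[OF _ d c Suc.prems] by (rule the_equality)
  then have "Tc_deriv M S nrm ?F \<eta> = moment (Suc k) (L0_rep \<eta>)" by (subst Tc_deriv_def)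
  then show ?case by simp
qed

end

section \<open>The Post--Widder limit\<close>

lemma has_bochner_integral_erlang_moment:
  assumes "0 < l"
  shows "has_bochner_integral lborel (\<lambda>x. erlang_density k l x * x ^ i) (fact (k + i) / (fact k * l ^ i))"
proof (rule has_bochner_integral_nn_integral)
  show "AE x in lborel. 0 \<le> erlang_density k l x * x ^ i"
    using assms by (intro AE_I2) (auto simp: erlang_density_def)
  show "(\<integral>\<^sup>+ x. ennreal (erlang_density k l x * x ^ i) \<partial>lborel) = ennreal (fact (k + i) / (fact k * l ^ i))"
    using assms by (rule nn_integral_erlang_ith_moment)
qed (use assms in auto)

text \<open>With rate l = k/t the raw moments are (k + 1)/l and (k + 1)(k + 2)/l^2. Expanding the
  square about t, which is not the mean, gives t^2 ((k + 1)(k + 2) - 2 k (k + 1) + k^2)/k^2 = t^2 (k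
  + 2)/k^2.\<close>

lemma has_bochner_integral_erlang_centered:
  assumes "0 < t" "1 \<le> k"
  shows "has_bochner_integral lborel (\<lambda>x. erlang_density k (real k / t) x * (a + b * (x - t)\<^sup>2))
    (a + b * (t\<^sup>2 * (real k + 2) / (real k)\<^sup>2))"
proof -
  let ?l = "real k / t" and ?d = "erlang_density k (real k / t)"
  have l: "0 < ?l" using assms by simp
  note m = has_bochner_integral_erlang_moment[OF l, of k]
  have "has_bochner_integral lborel
      (\<lambda>x. (a + b * t\<^sup>2) * (?d x * x ^ 0) + (b * (?d x * x ^ 2) - 2 * b * t * (?d x * x ^ 1)))
      ((a + b * t\<^sup>2) * (fact (k + 0) / (fact k * ?l ^ 0)) +
        (b * (fact (k + 2) / (fact k * ?l ^ 2)) - 2 * b * t * (fact (k + 1) / (fact k * ?l ^ 1))))"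
    by (intro has_bochner_integral_add has_bochner_integral_diff has_bochner_integral_mult_right m)
  moreover have "(a + b * t\<^sup>2) * (fact (k + 0) / (fact k * ?l ^ 0)) +
        (b * (fact (k + 2) / (fact k * ?l ^ 2)) - 2 * b * t * (fact (k + 1) / (fact k * ?l ^ 1))) =
      a + b * (t\<^sup>2 * (real k + 2) / (real k)\<^sup>2)"
    using assms by (simp add: field_simps power2_eq_square)
  moreover have "(a + b * t\<^sup>2) * (?d x * x ^ 0) + (b * (?d x * x ^ 2) - 2 * b * t * (?d x * x ^ 1)) =
      ?d x * (a + b * (x - t)\<^sup>2)" for x
    by (simp add: power2_eq_square algebra_simps)
  ultimately show ?thesis by (simp only:)
qed

text \<open>The formula of the Erlang density without its case distinction at 0: it is continuous on
  the whole line for every k, so its Riemann sums can be handled directly, and the two agree on the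
  half-line.\<close>

definition gamma_kernel :: "nat \<Rightarrow> real \<Rightarrow> real \<Rightarrow> real" where
  "gamma_kernel k l s = l ^ (k + 1) * s ^ k * exp (- (l * s)) / fact k"

lemma gamma_kernel_eq: "0 \<le> s \<Longrightarrow> gamma_kernel k l s = erlang_density k l s"
  by (simp add: gamma_kernel_def erlang_density_def)

lemma gamma_kernel_nonneg: "0 \<le> l \<Longrightarrow> 0 \<le> s \<Longrightarrow> 0 \<le> gamma_kernel k l s"
  by (simp add: gamma_kernel_def)

lemma continuous_on_gamma_kernel [continuous_intros]: "continuous_on A (gamma_kernel k l)"
  unfolding gamma_kernel_def[abs_def] by (intro continuous_intros) auto

text \<open>Bridge from the integral over a compact interval to the Lebesgue integral. The density
  vanishes on the negative axis, so the indicator may be that of \<open>{..L}\<close>, the shape in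
  which the limit in L is taken.\<close>

lemma integral_gamma_kernel:
  assumes g: "integrable lborel (\<lambda>x. erlang_density k l x * g x)"
  shows "integral {0..L} (\<lambda>s. gamma_kernel k l s * g s) =
    (\<integral>x. indicator {..L} x *\<^sub>R (erlang_density k l x * g x) \<partial>lborel)"
proof -
  have "integral {0..L} (\<lambda>s. gamma_kernel k l s * g s) = integral {0..L} (\<lambda>x. erlang_density k l x * g x)"
    by (intro integral_cong) (simp add: gamma_kernel_eq)
  also have "\<dots> = (\<integral>x\<in>{0..L}. (erlang_density k l x * g x) \<partial>lborel)"
  proof (rule set_borel_integral_eq_integral(2)[symmetric])
    show "set_integrable lborel {0..L} (\<lambda>x. erlang_density k l x * g x)"
      unfolding set_integrable_def by (rule integrable_mult_indicator[OF _ g]) simp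
  qed
  also have "\<dots> = (\<integral>x. indicator {..L} x *\<^sub>R (erlang_density k l x * g x) \<partial>lborel)"
    unfolding set_lebesgue_integral_def
    by (intro Bochner_Integration.integral_cong refl) (auto simp: indicator_def erlang_density_def)
  finally show ?thesis .
qed

lemma integral_gamma_kernel_le:
  assumes "0 < t" "1 \<le> k" "0 \<le> a" "0 \<le> b"
  shows "integral {0..L} (\<lambda>s. gamma_kernel k (real k / t) s * (a + b * (s - t)\<^sup>2)) \<le>
    a + b * (t\<^sup>2 * (real k + 2) / (real k)\<^sup>2)"
proof -
  let ?g = "\<lambda>x. erlang_density k (real k / t) x * (a + b * (x - t)\<^sup>2)"
  note m = has_bochner_integral_erlang_centered[OF assms(1,2), of a b]
  have i: "integrable lborel ?g" using m by (simp add: has_bochner_integral_iff)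
  have "integral {0..L} (\<lambda>s. gamma_kernel k (real k / t) s * (a + b * (s - t)\<^sup>2)) =
      (\<integral>x. indicator {..L} x *\<^sub>R ?g x \<partial>lborel)"
    by (rule integral_gamma_kernel[OF i])
  also have "\<dots> \<le> (\<integral>x. ?g x \<partial>lborel)"
    using assms by (intro integral_mono i integrable_mult_indicator) (auto simp: indicator_def)
  also have "\<dots> = a + b * (t\<^sup>2 * (real k + 2) / (real k)\<^sup>2)"
    using m by (simp add: has_bochner_integral_iff)
  finally show ?thesis .
qed

lemma integral_gamma_kernel_tendsto:
  assumes "0 < l"
  shows "(\<lambda>n. integral {0..real n} (gamma_kernel k l)) \<longlonglongrightarrow> 1"
proof -
  have m: "has_bochner_integral lborel (\<lambda>x. erlang_density k l x * 1) 1"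
    using has_bochner_integral_erlang_moment[OF assms, of k 0] by simp
  then have i: "integrable lborel (\<lambda>x. erlang_density k l x * 1)" by (simp add: has_bochner_integral_iff)
  have "((\<lambda>y. \<integral>x. indicator {..y} x *\<^sub>R (erlang_density k l x * 1) \<partial>lborel) \<longlongrightarrow> 1) at_top"
    using tendsto_integral_at_top[OF _ i] m by (simp add: has_bochner_integral_iff)
  from filterlim_compose[OF this filterlim_real_sequentially] integral_gamma_kernel[OF i]
  show ?thesis by simp
qed

section \<open>Concentration at t and passage to the limit\<close>

context random_normed_module
begin

text \<open>The roles in \<open>E1_mult_small\<close> are exchanged: the fixed random factor is the
  norm of x, and the small variable is the constant \<open>\<bar>a n - c\<bar>\<close>.\<close>

lemma limitin_act_const:
  assumes "a \<longlonglongrightarrow> c" "x \<in> carrier S"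
  shows "limitin (el_topology M S nrm) (\<lambda>n. act (\<lambda>_. a n) x) (act (\<lambda>_. c) x) sequentially"
  unfolding limitin_el_iff
proof (intro conjI allI impI)
  show "act (\<lambda>_. c) x \<in> carrier S" using assms by simp
  fix e :: real assume "0 < e"
  from E1_mult_small[OF nr_measurable[OF assms(2)] nr_nonneg[OF assms(2)] this]
  obtain d where d: "d > 0"
    "\<And>X. X \<in> borel_measurable M \<Longrightarrow> (AE \<omega> in M. 0 \<le> X \<omega>) \<Longrightarrow> E1 X < d \<Longrightarrow> E1 (\<lambda>\<omega>. nr x \<omega> * X \<omega>) < e" by blast
  have "\<forall>\<^sub>F n in sequentially. \<bar>a n - c\<bar> < d"
    using tendstoD[OF assms(1) d(1)] by (simp add: dist_real_def)
  then show "\<forall>\<^sub>F n in sequentially. act (\<lambda>_. a n) x \<in> carrier S \<and> mdist (act (\<lambda>_. a n) x) (act (\<lambda>_. c) x) < e"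
  proof eventually_elim
    case (elim n)
    have "mdist (act (\<lambda>_. a n) x) (act (\<lambda>_. c) x) = E1 (nr (act (\<lambda>_. a n - c) x))"
      using assms by (simp add: mdist_def act_diff_left)
    also have "\<dots> = E1 (\<lambda>\<omega>. nr x \<omega> * \<bar>a n - c\<bar>)"
      using assms nr_act[of "\<lambda>_. a n - c" x] by (intro E1_cong) (auto simp: mult.commute)
    also have "\<dots> < e" using elim by (intro d(2)) (auto simp: E1_def prob_space min_less_iff_disj)
    finally show ?case using assms by simp
  qed
qed

end

context bounded_el_continuous
begin

text \<open>Since the weight is at most 1, the weighted truncated mean changes by at most the
  \<open>mdist\<close> distance; so bounds in mean pass to the limit without extracting a
  subsequence.\<close>

lemma E1_weighted_le_of_limitin:
  assumes lim: "limitin (el_topology M S nrm) X x sequentially" and X: "\<And>n. X n \<in> carrier S"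
    and le: "\<And>n. E1 (\<lambda>\<omega>. wt \<omega> * nr (X n) \<omega>) \<le> c n" and c: "c \<longlonglongrightarrow> C"
  shows "E1 (\<lambda>\<omega>. wt \<omega> * nr x \<omega>) \<le> C"
proof -
  have x: "x \<in> carrier S" using lim by (simp add: limitin_el_iff)
  have "(\<lambda>n. mdist (X n) x) \<longlonglongrightarrow> 0"
  proof (rule tendstoI)
    fix e :: real assume "0 < e"
    with lim have "\<forall>\<^sub>F n in sequentially. X n \<in> carrier S \<and> mdist (X n) x < e" unfolding limitin_el_iff by blast
    then show "\<forall>\<^sub>F n in sequentially. dist (mdist (X n) x) 0 < e"
      by eventually_elim (use mdist_nonneg[OF X x] in auto)
  qed
  from tendsto_add[OF c this] have "(\<lambda>n. c n + mdist (X n) x) \<longlonglongrightarrow> C" by simp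
  moreover have "E1 (\<lambda>\<omega>. wt \<omega> * nr x \<omega>) \<le> c n + mdist (X n) x" for n
  proof -
    have D: "x \<ominus>\<^bsub>S\<^esub> X n \<in> carrier S" using x X by simp
    have w: "AE \<omega> in M. 0 \<le> wt \<omega> * nr y \<omega>" if "y \<in> carrier S" for y
      using nr_nonneg[OF that] by eventually_elim (use wt_pos in \<open>simp add: less_imp_le\<close>)
    have "E1 (\<lambda>\<omega>. wt \<omega> * nr x \<omega>) \<le> E1 (\<lambda>\<omega>. wt \<omega> * nr (X n) \<omega>) + E1 (nr (x \<ominus>\<^bsub>S\<^esub> X n))"
    proof (intro E1_le_add w nr_nonneg X x D)
      have "AE \<omega> in M. nr x \<omega> \<le> nr (x \<ominus>\<^bsub>S\<^esub> X n) \<omega> + nr (X n) \<omega>"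
        using nr_diff_triangle[of x "X n" "\<zero>\<^bsub>S\<^esub>"] x X by (simp add: diff_zero)
      with nr_nonneg[OF D] show "AE \<omega> in M. wt \<omega> * nr x \<omega> \<le> wt \<omega> * nr (X n) \<omega> + nr (x \<ominus>\<^bsub>S\<^esub> X n) \<omega>"
      proof eventually_elim
        case (elim \<omega>)
        have "wt \<omega> * nr x \<omega> \<le> wt \<omega> * (nr (x \<ominus>\<^bsub>S\<^esub> X n) \<omega> + nr (X n) \<omega>)"
          using elim wt_pos[of \<omega>] by (intro mult_left_mono) auto
        moreover have "wt \<omega> * nr (x \<ominus>\<^bsub>S\<^esub> X n) \<omega> \<le> 1 * nr (x \<ominus>\<^bsub>S\<^esub> X n) \<omega>"
          using elim wt_le_1 by (intro mult_right_mono) auto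
        ultimately show ?case by (simp add: distrib_left)
      qed
    qed (use x X D in simp_all)
    also have "E1 (nr (x \<ominus>\<^bsub>S\<^esub> X n)) = mdist (X n) x"
      using mdist_commute[OF x X] by (simp add: mdist_def)
    finally show ?thesis using le[of n] by simp
  qed
  ultimately show ?thesis by (intro LIMSEQ_le_const) auto
qed

lemma weighted_f_diff:
  assumes "0 \<le> u" "0 \<le> v"
  shows "integrable M (\<lambda>\<omega>. wt \<omega> * nr (f u \<ominus>\<^bsub>S\<^esub> f v) \<omega>)"
    and "(\<integral>\<omega>. wt \<omega> * nr (f u \<ominus>\<^bsub>S\<^esub> f v) \<omega> \<partial>M) \<le> 2 * mdist (f u) (f v)"
proof -
  have D: "f u \<ominus>\<^bsub>S\<^esub> f v \<in> carrier S" using assms by simp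
  have i: "integrable M (\<lambda>\<omega>. 2 * min 1 (nr (f u \<ominus>\<^bsub>S\<^esub> f v) \<omega>))"
    using D by (intro integrable_mult_right integrable_min1 nr_nonneg) auto
  show int: "integrable M (\<lambda>\<omega>. wt \<omega> * nr (f u \<ominus>\<^bsub>S\<^esub> f v) \<omega>)"
  proof (rule Bochner_Integration.integrable_bound[OF i])
    show "AE \<omega> in M. norm (wt \<omega> * nr (f u \<ominus>\<^bsub>S\<^esub> f v) \<omega>) \<le> norm (2 * min 1 (nr (f u \<ominus>\<^bsub>S\<^esub> f v) \<omega>))"
      using nr_f_diff_le[OF assms] nr_nonneg[OF D]
    proof eventually_elim
      case (elim \<omega>)
      have "0 \<le> wt \<omega> * nr (f u \<ominus>\<^bsub>S\<^esub> f v) \<omega>" using elim wt_pos[of \<omega>] by simp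
      with elim(1) show ?case by simp
    qed
  qed (use D in measurable)
  have "(\<integral>\<omega>. wt \<omega> * nr (f u \<ominus>\<^bsub>S\<^esub> f v) \<omega> \<partial>M) \<le> (\<integral>\<omega>. 2 * min 1 (nr (f u \<ominus>\<^bsub>S\<^esub> f v) \<omega>) \<partial>M)"
    by (intro integral_mono_AE int i nr_f_diff_le assms)
  then show "(\<integral>\<omega>. wt \<omega> * nr (f u \<ominus>\<^bsub>S\<^esub> f v) \<omega> \<partial>M) \<le> 2 * mdist (f u) (f v)"
    by (simp add: mdist_def E1_def)
qed

text \<open>The kernel K is deterministic because the rate k/t is constant, so the expectation
  passes through it to each difference of \<open>f\<close>, where \<open>weighted_f_diff\<close>
  accounts for the factor 2.\<close>

lemma E1_weighted_riemann_sum_le: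
  assumes p: "mesh_below d 0 L p" and t: "0 \<le> t"
    and K: "\<And>s. 0 \<le> s \<Longrightarrow> 0 \<le> K s"
    and \<psi>: "\<And>s. 0 \<le> s \<Longrightarrow> 2 * mdist (f s) (f t) \<le> \<psi> s"
  shows "E1 (\<lambda>\<omega>. wt \<omega> * nr (riemann_sum M S (\<lambda>s. act (\<lambda>_. K s) (f s \<ominus>\<^bsub>S\<^esub> f t)) p) \<omega>) \<le>
    (\<Sum>q\<in>p. measure lborel (snd q) * (K (fst q) * \<psi> (fst q)))"
proof -
  let ?G = "\<lambda>s. act (\<lambda>_. K s) (f s \<ominus>\<^bsub>S\<^esub> f t)"
  let ?N = "\<lambda>q \<omega>. measure lborel (snd q) * (K (fst q) * (wt \<omega> * nr (f (fst q) \<ominus>\<^bsub>S\<^esub> f t) \<omega>))"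
  have tag: "0 \<le> fst q" if "q \<in> p" for q using mesh_below_tag(1)[OF p that] by simp
  have G: "?G (fst q) \<in> carrier S" if "q \<in> p" for q using tag[OF that] t by simp
  have fin: "finite p" by (rule mesh_below_finite[OF p])
  have R: "riemann_sum M S ?G p \<in> carrier S" using G by (rule riemann_sum_closed)
  have "AE \<omega> in M. nr (riemann_sum M S ?G p) \<omega> \<le>
      (\<Sum>q\<in>p. measure lborel (snd q) * (K (fst q) * nr (f (fst q) \<ominus>\<^bsub>S\<^esub> f t) \<omega>))"
  proof (rule nr_riemann_sum_le[where g = ?G and \<phi> = "\<lambda>s \<omega>. K s * nr (f s \<ominus>\<^bsub>S\<^esub> f t) \<omega>", OF fin])
    show "?G (fst q) \<in> carrier S" if "q \<in> p" for q by (rule G[OF that])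
    fix q assume "q \<in> p"
    then show "AE \<omega> in M. nr (?G (fst q)) \<omega> \<le> K (fst q) * nr (f (fst q) \<ominus>\<^bsub>S\<^esub> f t) \<omega>"
      using nr_act[of "\<lambda>_. K (fst q)" "f (fst q) \<ominus>\<^bsub>S\<^esub> f t"] tag t K by (auto elim: eventually_mono)
  qed
  then have le: "AE \<omega> in M. wt \<omega> * nr (riemann_sum M S ?G p) \<omega> \<le> (\<Sum>q\<in>p. ?N q \<omega>)"
  proof eventually_elim
    case (elim \<omega>)
    then have "wt \<omega> * nr (riemann_sum M S ?G p) \<omega> \<le>
        wt \<omega> * (\<Sum>q\<in>p. measure lborel (snd q) * (K (fst q) * nr (f (fst q) \<ominus>\<^bsub>S\<^esub> f t) \<omega>))"
      using wt_pos[of \<omega>] by (intro mult_left_mono) auto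
    then show ?case by (simp add: sum_distrib_left mult_ac)
  qed
  have i: "integrable M (?N q)" if "q \<in> p" for q
    using weighted_f_diff(1)[OF tag[OF that] t] by (intro integrable_mult_right)
  have "AE \<omega> in M. 0 \<le> wt \<omega> * nr (riemann_sum M S ?G p) \<omega>"
    using nr_nonneg[OF R] by eventually_elim (use wt_pos in \<open>simp add: less_imp_le\<close>)
  then have "E1 (\<lambda>\<omega>. wt \<omega> * nr (riemann_sum M S ?G p) \<omega>) \<le> (\<integral>\<omega>. (\<Sum>q\<in>p. ?N q \<omega>) \<partial>M)"
    unfolding E1_def using le i R
    by (intro integral_mono_AE integrable_min1 Bochner_Integration.integrable_sum) (auto elim: eventually_mono)
  also have "\<dots> = (\<Sum>q\<in>p. measure lborel (snd q) * (K (fst q) * (\<integral>\<omega>. wt \<omega> * nr (f (fst q) \<ominus>\<^bsub>S\<^esub> f t) \<omega> \<partial>M)))"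
    using i by (subst Bochner_Integration.integral_sum) auto
  also have "\<dots> \<le> (\<Sum>q\<in>p. measure lborel (snd q) * (K (fst q) * \<psi> (fst q)))"
  proof (intro sum_mono mult_left_mono)
    fix q assume "q \<in> p"
    from weighted_f_diff(2)[OF tag[OF this] t] \<psi>[OF tag[OF this]]
    show "(\<integral>\<omega>. wt \<omega> * nr (f (fst q) \<ominus>\<^bsub>S\<^esub> f t) \<omega> \<partial>M) \<le> \<psi> (fst q)" by linarith
  qed (use K tag in auto)
  finally show ?thesis .
qed

text \<open>The alternating sign of the Post--Widder factor cancels the one in \<open>kern\<close>;
  what remains is a nonnegative weight for nonnegative l and s.\<close>

lemma post_widder_coeff_kern:
  "(- 1) ^ k * l ^ (k + 1) * (1 / fact k) * kern k (\<lambda>_. l) s \<omega> = gamma_kernel k l s"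
proof -
  have "(- 1) ^ k * l ^ (k + 1) * (1 / fact k) * kern k (\<lambda>_. l) s \<omega> =
      ((- 1) ^ k * (- 1) ^ k) * gamma_kernel k l s"
    unfolding kern_def gamma_kernel_def power_minus[of s] by simp
  then show ?thesis by (simp flip: power_mult_distrib)
qed

text \<open>The quadratic majorant is averaged against the Erlang kernel. The inequality starts with
  Riemann sums, passes to the integral over \<open>{0..L}\<close>, and finally to the half-line; its
  right side does not depend on L.\<close>

lemma E1_weighted_post_widder_le:
  assumes t: "0 < t" and k: "1 \<le> k" and ab: "0 \<le> a" "0 \<le> b"
    and \<psi>: "\<And>s. 0 \<le> s \<Longrightarrow> 2 * mdist (f s) (f t) \<le> a + b * (s - t)\<^sup>2"
  defines "l \<equiv> real k / t"
  defines "c \<equiv> (- 1) ^ k * l ^ (k + 1) * (1 / fact k)"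
  shows "E1 (\<lambda>\<omega>. wt \<omega> * nr (act (\<lambda>_. c) (moment k (\<lambda>_. l)) \<ominus>\<^bsub>S\<^esub> f t) \<omega>) \<le>
    a + b * (t\<^sup>2 * (real k + 2) / (real k)\<^sup>2)" (is "_ \<le> ?V")
proof -
  let ?\<eta> = "\<lambda>_::'w. l"
  let ?K = "gamma_kernel k l"
  have l: "0 < l" using t k by (simp add: l_def)
  have \<eta>: "?\<eta> \<in> borel_measurable M" "AE \<omega> in M. 0 < ?\<eta> \<omega>" using l by auto
  have ft: "f t \<in> carrier S" using t by simp
  \<comment> \<open>The kernel need not have full mass on \<open>{0..L}\<close>, so
    \<open>f t\<close> is scaled by the mass it has there; that mass tends to 1 with growing
    L.\<close>
  let ?Y = "\<lambda>L. act (\<lambda>_. c) (truncated k ?\<eta> L) \<ominus>\<^bsub>S\<^esub> act (\<lambda>_. integral {0..L} ?K) (f t)"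
  have Y: "E1 (\<lambda>\<omega>. wt \<omega> * nr (?Y L) \<omega>) \<le> ?V" if L: "0 \<le> L" for L
  proof -
    have "\<exists>p. mesh_below (1 / real (Suc n)) 0 L p" for n
      using L by (intro mesh_below_exists) auto
    then obtain p where p: "\<And>n. mesh_below (1 / real (Suc n)) 0 L (p n)" by metis
    have tag: "0 \<le> fst q" if "q \<in> p n" for q n using mesh_below_tag(1)[OF p that] by simp
    let ?G = "\<lambda>s. act (\<lambda>_. ?K s) (f s \<ominus>\<^bsub>S\<^esub> f t)"
    let ?s = "\<lambda>n. \<Sum>q\<in>p n. measure lborel (snd q) * ?K (fst q)"
    have fin: "finite (p n)" for n by (rule mesh_below_finite[OF p])
    \<comment> \<open>At the level of Riemann sums the weighted difference splits exactly into a sum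
      for the moment and a scalar sum acting on \<open>f t\<close>; each part has its own
      limit.\<close>
    have eq: "riemann_sum M S ?G (p n) =
        act (\<lambda>_. c) (riemann_sum M S (integrand k ?\<eta>) (p n)) \<ominus>\<^bsub>S\<^esub> act (\<lambda>_. ?s n) (f t)" for n
    proof -
      have 1: "?G s = act (\<lambda>_. c) (integrand k ?\<eta> s) \<ominus>\<^bsub>S\<^esub> act (\<lambda>_. ?K s) (f t)" if "0 \<le> s" for s
      proof -
        have "act (\<lambda>_. c) (integrand k ?\<eta> s) = act (\<lambda>\<omega>. c * kern k ?\<eta> s \<omega>) (f s)"
          unfolding integrand_def using that by (intro act_act) auto
        also have "(\<lambda>\<omega>. c * kern k ?\<eta> s \<omega>) = (\<lambda>_. ?K s)"
          unfolding c_def post_widder_coeff_kern ..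
        finally show ?thesis using that ft by (simp add: act_diff_right)
      qed
      have "riemann_sum M S ?G (p n) =
          riemann_sum M S (\<lambda>s. act (\<lambda>_. c) (integrand k ?\<eta> s) \<ominus>\<^bsub>S\<^esub> act (\<lambda>_. ?K s) (f t)) (p n)"
        unfolding riemann_sum_eq using tag ft
        by (intro S.M.finsum_cong' refl) (auto simp: 1)
      also have "\<dots> = riemann_sum M S (\<lambda>s. act (\<lambda>_. c) (integrand k ?\<eta> s)) (p n)
          \<ominus>\<^bsub>S\<^esub> riemann_sum M S (\<lambda>s. act (\<lambda>_. ?K s) (f t)) (p n)"
        using tag ft fin by (intro riemann_sum_diff) auto
      also have "riemann_sum M S (\<lambda>s. act (\<lambda>_. c) (integrand k ?\<eta> s)) (p n) =
          act (\<lambda>_. c) (riemann_sum M S (integrand k ?\<eta>) (p n))"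
        using tag fin by (intro riemann_sum_act) auto
      also have "riemann_sum M S (\<lambda>s. act (\<lambda>_. ?K s) (f t)) (p n) =
          (\<Oplus>\<^bsub>S\<^esub>q\<in>p n. act (\<lambda>_. measure lborel (snd q) * ?K (fst q)) (f t))"
        unfolding riemann_sum_eq using ft by (intro S.M.finsum_cong' refl) (auto simp: act_act)
      also have "\<dots> = act (\<lambda>_. ?s n) (f t)"
        using fin ft by (intro act_finsum_left[symmetric]) auto
      finally show ?thesis .
    qed
    have lim: "limitin (el_topology M S nrm) (\<lambda>n. riemann_sum M S ?G (p n)) (?Y L) sequentially"
      unfolding eq
    proof (intro limitin_el_diff limitin_el_act limitin_act_const ft)
      show "limitin (el_topology M S nrm) (\<lambda>n. riemann_sum M S (integrand k ?\<eta>) (p n)) (truncated k ?\<eta> L) sequentially"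
        by (rule has_riemann_integral_sequence[OF truncated[OF \<eta> L] p])
      show "?s \<longlonglongrightarrow> integral {0..L} ?K"
        using L p by (intro riemann_sums_tendsto continuous_intros) auto
    qed simp
    have "E1 (\<lambda>\<omega>. wt \<omega> * nr (?Y L) \<omega>) \<le> integral {0..L} (\<lambda>s. ?K s * (a + b * (s - t)\<^sup>2))"
    proof (rule E1_weighted_le_of_limitin[OF lim])
      show "riemann_sum M S ?G (p n) \<in> carrier S" for n using tag t by (intro riemann_sum_closed) simp
      show "E1 (\<lambda>\<omega>. wt \<omega> * nr (riemann_sum M S ?G (p n)) \<omega>) \<le>
          (\<Sum>q\<in>p n. measure lborel (snd q) * (?K (fst q) * (a + b * (fst q - t)\<^sup>2)))" for n
        using t l \<psi> by (intro E1_weighted_riemann_sum_le[OF p] gamma_kernel_nonneg) auto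
      show "(\<lambda>n. \<Sum>q\<in>p n. measure lborel (snd q) * (?K (fst q) * (a + b * (fst q - t)\<^sup>2))) \<longlonglongrightarrow>
          integral {0..L} (\<lambda>s. ?K s * (a + b * (s - t)\<^sup>2))"
        using L p by (intro riemann_sums_tendsto continuous_intros) auto
    qed
    also have "\<dots> \<le> ?V" unfolding l_def by (rule integral_gamma_kernel_le[OF t k ab])
    finally show ?thesis .
  qed
  have m: "truncated k ?\<eta> (real n) \<in> carrier S" for n by (rule truncated_closed[OF \<eta>]) simp
  have "limitin (el_topology M S nrm) (\<lambda>n. ?Y (real n))
      (act (\<lambda>_. c) (moment k ?\<eta>) \<ominus>\<^bsub>S\<^esub> act (\<lambda>_. 1) (f t)) sequentially"
    by (intro limitin_el_diff limitin_el_act limitin_act_const moment_sequence \<eta> ft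
        integral_gamma_kernel_tendsto l) simp
  then have "limitin (el_topology M S nrm) (\<lambda>n. ?Y (real n)) (act (\<lambda>_. c) (moment k ?\<eta>) \<ominus>\<^bsub>S\<^esub> f t) sequentially"
    using ft by (simp add: act_one)
  then show ?thesis
    by (rule E1_weighted_le_of_limitin[OF _ _ _ tendsto_const]) (use Y m ft in auto)
qed

lemma post_widder:
  assumes t: "0 < t"
  shows "limitin (el_topology M S nrm)
    (\<lambda>k. act (\<lambda>_. (- 1) ^ k * (real k / t) ^ (k + 1) * (1 / fact k)) (moment k (\<lambda>_. real k / t)))
    (f t) sequentially"
  unfolding limitin_el_iff
proof (intro conjI allI impI)
  show ft: "f t \<in> carrier S" using t by simp
  let ?x = "\<lambda>k. act (\<lambda>_. (- 1) ^ k * (real k / t) ^ (k + 1) * (1 / fact k)) (moment k (\<lambda>_. real k / t))"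
  fix e :: real assume "0 < e"
  have "AE \<omega> in M. 0 < wt \<omega>" by (simp add: wt_pos)
  from mdist_small_if_weighted_small[OF wt_measurable this \<open>0 < e\<close>]
  obtain e1 where e1: "0 < e1" "\<And>x y. x \<in> carrier S \<Longrightarrow> y \<in> carrier S \<Longrightarrow>
      E1 (\<lambda>\<omega>. wt \<omega> * nr (x \<ominus>\<^bsub>S\<^esub> y) \<omega>) < e1 \<Longrightarrow> mdist x y < e" by blast
  \<comment> \<open>The factor 2 of the weighted estimate turns e1/4 into e1/2; the other half of e1
    is kept for the second-moment term.\<close>
  from f_continuous_at[of t "e1 / 4"] t e1(1) obtain d where d: "0 < d"
    "\<And>s. 0 \<le> s \<Longrightarrow> \<bar>s - t\<bar> < d \<Longrightarrow> mdist (f s) (f t) < e1 / 4" by auto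
  \<comment> \<open>Chebyshev's majorant: near t continuity gives the constant term, and at distance
    at least d the quadratic term is at least 2, while \<open>mdist\<close> never exceeds 1.\<close>
  have \<psi>: "2 * mdist (f s) (f t) \<le> e1 / 2 + 2 / d\<^sup>2 * (s - t)\<^sup>2" if s: "0 \<le> s" for s
  proof (cases "\<bar>s - t\<bar> < d")
    case True
    moreover have "0 \<le> 2 / d\<^sup>2 * (s - t)\<^sup>2" by simp
    ultimately show ?thesis using d(2)[OF s] by linarith
  next
    case False
    then have "d\<^sup>2 \<le> (s - t)\<^sup>2" using d(1) by (intro abs_le_square_iff[THEN iffD1]) auto
    then have "2 \<le> 2 / d\<^sup>2 * (s - t)\<^sup>2" using d(1) by (simp add: field_simps)
    moreover have "mdist (f s) (f t) \<le> 1"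
    proof -
      have D: "f s \<ominus>\<^bsub>S\<^esub> f t \<in> carrier S" using s ft by simp
      have "mdist (f s) (f t) \<le> (\<integral>\<omega>. 1 \<partial>M)"
        unfolding mdist_def E1_def using D by (intro integral_mono_AE integrable_min1 nr_nonneg) auto
      then show ?thesis by (simp add: prob_space)
    qed
    ultimately show ?thesis using e1(1) by linarith
  qed
  have "(\<lambda>k. e1 / 2 + 2 / d\<^sup>2 * (t\<^sup>2 * (real k + 2) / (real k)\<^sup>2)) \<longlonglongrightarrow> e1 / 2"
    by real_asymp
  then have "\<forall>\<^sub>F k in sequentially. e1 / 2 + 2 / d\<^sup>2 * (t\<^sup>2 * (real k + 2) / (real k)\<^sup>2) < e1"
    by (rule order_tendstoD(2)) (use e1(1) in simp)
  then show "\<forall>\<^sub>F k in sequentially. ?x k \<in> carrier S \<and> mdist (?x k) (f t) < e"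
    \<comment> \<open>At k = 0 the rate k/t is 0, which is outside the range of positive rates where
      the moments were constructed.\<close>
    using eventually_ge_at_top[of 1]
  proof eventually_elim
    case (elim k)
    have "moment k (\<lambda>_. real k / t) \<in> carrier S" using elim(2) t by (intro moment_closed) auto
    then have x: "?x k \<in> carrier S" by simp
    have "E1 (\<lambda>\<omega>. wt \<omega> * nr (?x k \<ominus>\<^bsub>S\<^esub> f t) \<omega>) < e1"
      using E1_weighted_post_widder_le[OF t elim(2) _ _ \<psi>] elim(1) e1(1) by auto
    with e1(2)[OF x ft] x show ?case by simp
  qed
qed

end

text \<open>\<open>laplace\<close> and \<open>Tc_deriv\<close> are definite descriptions; the first
  two conjuncts certify that the integrals converge and that every iterated derivative exists on all
  of \<open>L0_pos M\<close>, so the limit formula speaks of genuine derivatives.\<close>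

theorem theorem3p1:
  fixes M :: "'w measure"
    and S :: "(('w \<Rightarrow> 'k::{real_normed_field, second_countable_topology}) set, 's, 'm) module_scheme"
    and nrm :: "'s \<Rightarrow> ('w \<Rightarrow> real) set"
    and f :: "real \<Rightarrow> 's"
    and B :: "('w \<Rightarrow> real) set"
  assumes "random_normed_module M S nrm"
    and "el_complete M S nrm"
    and "continuous_map (top_of_set {0..}) (el_topology M S nrm) f"
    and "B \<in> L0_nonneg M"
    and "\<forall>s\<ge>0. L0_le M (nrm (f s)) B"
  shows "(\<forall>\<eta>\<in>L0_pos M. \<exists>I. has_laplace M S nrm f \<eta> I) \<and>
    (\<forall>k. \<forall>\<eta>\<in>L0_pos M. \<exists>I.
        has_Tc_derivative M S nrm ((Tc_deriv M S nrm ^^ k) (laplace M S nrm f)) \<eta> I) \<and>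
    (\<forall>t>0. limitin (el_topology M S nrm)
        (\<lambda>k::nat. L0_const M (of_real ((-1) ^ k * (real k / t) ^ (k + 1) * (1 / fact k))) \<odot>\<^bsub>S\<^esub>
           (Tc_deriv M S nrm ^^ k) (laplace M S nrm f) (L0_const M (real k / t)))
        (f t) sequentially)"
proof -
  interpret random_normed_module M S nrm by fact
  interpret bounded_el_continuous M S nrm f B
    using assms(2-) by unfold_locales auto
  show ?thesis
  proof (intro conjI ballI allI impI)
    fix \<eta> assume "\<eta> \<in> L0_pos M"
    then show "\<exists>I. has_laplace M S nrm f \<eta> I" by (simp add: has_laplace_iff)
  next
    fix k \<eta> assume "\<eta> \<in> L0_pos M"
    then show "\<exists>I. has_Tc_derivative M S nrm ((Tc_deriv M S nrm ^^ k) (laplace M S nrm f)) \<eta> I"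
      using has_Tc_derivative_moment[OF Tc_deriv_laplace] by blast
  next
    fix t :: real assume t: "0 < t"
    show "limitin (el_topology M S nrm)
        (\<lambda>k::nat. L0_const M (of_real ((-1) ^ k * (real k / t) ^ (k + 1) * (1 / fact k))) \<odot>\<^bsub>S\<^esub>
           (Tc_deriv M S nrm ^^ k) (laplace M S nrm f) (L0_const M (real k / t)))
        (f t) sequentially"
    proof (rule limitin_transform_eventually[OF _ post_widder[OF t]])
      show "\<forall>\<^sub>F k in sequentially.
          act (\<lambda>_. (- 1) ^ k * (real k / t) ^ (k + 1) * (1 / fact k)) (moment k (\<lambda>_. real k / t)) =
          L0_const M (of_real ((-1) ^ k * (real k / t) ^ (k + 1) * (1 / fact k))) \<odot>\<^bsub>S\<^esub>
           (Tc_deriv M S nrm ^^ k) (laplace M S nrm f) (L0_const M (real k / t))"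
        using eventually_ge_at_top[of 1]
      proof eventually_elim
        case (elim k)
        have c: "L0_const M (real k / t) \<in> L0_pos M"
          unfolding L0_const_def using elim t by (intro L0_class_pos) auto
        have "moment k (L0_rep (L0_const M (real k / t))) = moment k (\<lambda>_. real k / t)"
          by (intro moment_cong L0_rep_const L0_rep_measurable) auto
        then show ?case
          unfolding Tc_deriv_laplace[OF c] by (simp add: act_def sc_def L0_const_def)
      qed
    qed
  qed
qed

end
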